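(* Let $(Z^k)_{k\ge 0}$ be the sequence generated by the asynchronous algorithm $Z^{k+1}=Z^k-\eta_{i_k}\mathcal S_{i_k}\widehat Z^k$ described in the context, from an arbitrary starting point $Z^0\in\mathbb R^{(n+m)\times p}$, with relaxation parameters $\eta_i=\eta/(nq_i)$, where $\eta\in(0,\eta_{\max}]$ for a certain $\eta_{\max}$ satisfying $$0<\eta_{\max}<\frac{n\,q_{\min}}{2\tau\sqrt{\kappa\, q_{\min}}+\kappa}.$$ Suppose that the Bounded delay assumption, the Activation assumption and the Conditional independence assumption stated in the context hold. Then $(Z^k)_{k\ge0}$ converges almost surely to a $\mathbf{Fix}\,\mathcal T$-valued random variable.
   Context: Network. There are $n$ agents $\mathcal V=\{1,\dots,n\}$ on a connected undirected graph with $m$ edges; every edge is written $e=(i,j)$ with $i<j$, and edges are also indexed $1,\dots,m$. $W=[w_{ij}]\in\mathbb R^{n\times n}$ is symmetric and doubly stochastic, $w_{ij}=w_{ji}>0$ if $i\ne j$ are joined by an edge, $w_{ij}=0$ if $i\neq j$ are not joined, and $w_{ii}>0$ for at least one $i$. $D\in\mathbb R^{m\times m}$ is diagonal with $D_{e,e}=\sqrt{w_{ij}/2}$ for $e=(i,j)$; $C\in\mathbb R^{m\times n}$ is the incidence matrix with $c_{ei}=1$ and $c_{ej}=-1$ for $e=(i,j)$, $i<j$, and zero otherwise; $V:=DC$. $\mathcal L_i$ is the set of edges $e=(i,j)$ with $j>i$. Functions. For each agent $i$, $s_i:\mathbb R^p\to\mathbb R$ and $r_i:\mathbb R^p\to\mathbb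 R\cup\{+\infty\}$ are closed, proper and convex, $s_i$ is differentiable with $\|\nabla s_i(x)-\nabla s_i(\tilde x)\|\le L_i\|x-\tilde x\|$ for all $x,\tilde x\in\mathbb R^p$, $L_i>0$; $L:=\max_iL_i$. For $X\in\mathbb R^{n\times p}$ with rows $(x^i)^\top$: $\mathbf s(X)=\sum_i s_i(x^i)$, $\mathbf r(X)=\sum_i r_i(x^i)$, and $\nabla\mathbf s(X)\in\mathbb R^{n\times p}$ has rows $(\nabla s_i(x^i))^\top$. Matrices. $G:=\begin{bmatrix} I_n & V^\top \\ V & I_m \end{bmatrix}$ (positive definite), $\rho_{\min}:=\lambda_{\min}(G)$; $0<\alpha<2\rho_{\min}/L$; $M:=G/\alpha$; $\kappa:=\lambda_{\max}(M)/\lambda_{\min}(M)$ is the condition number of $G$ (equivalently of $M$). Operators. Write $Z=\begin{bmatrix} X \\ Y \end{bmatrix}\in\mathbb R^{(n+m)\times p}$ with $X\in\mathbb R^{n\times p}$, $Y\in\mathbb R^{m\times p}$. Let $\mathcal A=\begin{bmatrix}\nabla\mathbf s & 0 \\ 0 & 0\end{bmatrix}$, $\mathcal B=\begin{bmatrix}\partial\mathbf r & 0 \\ 0 & 0\end{bmatrix}+\begin{bmatrix} 0 & \frac1\alpha V^\top \\ -\frac1\alpha V & 0\end{bmatrix}$, $\mathcal T:=(I+M^{-1}\mathcal B)^{-1}(I-M^{-1}\mathcal A)$; equivalently $\mathcal T$ maps $(X,Y)$ to $\big(\mathrm{prox}_{\alpha\mathbf r}[WX-\alpha\nabla\mathbf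 s(X)-V^\top Y],\;Y+VX\big)$, where $\mathrm{prox}_{\alpha\mathbf r}(U)=\arg\min_X\{\mathbf r(X)+\frac1{2\alpha}\|X-U\|_F^2\}$. $\mathbf{Fix}\,\mathcal T=\{Z:Z=\mathcal TZ\}$, which is the solution set of $0\in\mathcal AZ+\mathcal BZ$. $\mathcal S:=I-\mathcal T$. Let $\mathcal I_i=\{i\}\cup\{n+e: e\in\mathcal L_i\}$. $\mathcal S_iZ$ is the matrix whose $j$-th row is the $j$-th row of $\mathcal SZ$ if $j\in\mathcal I_i$ and $0$ otherwise. Algorithm. Starting from $Z^0$, at iteration $k\ge0$ a random agent $i_k$ performs $Z^{k+1}=Z^k-\eta_{i_k}\mathcal S_{i_k}\widehat Z^k$, with $\eta_i=\eta/(nq_i)$, $\eta>0$. Here $\widehat Z^k$ is the delayed iterate: its row $j\le n$ is row $j$ of $Z^{k-\tau^k_j}$ and its row $n+e$ is row $n+e$ of $Z^{k-\delta^k_e}$, with random nonnegative integer delays $\tau_j^k$ ($j=1,\dots,n$) and $\delta_e^k$ ($e=1,\dots,m$), and $Z^k:=Z^0$ for $k<0$. Bounded delay assumption: at any iteration $k$, the delays $\tau^k_j$, $j=1,\dots,n$, and $\delta^k_e$, $e=1,\dots,m$, have a uniform upper bound $\tau>0$. Activation assumption: each $i_k$ (the index of the agent responsible for the $k$-th completed update) is a random variable independent of $i_1,\dots,i_{k-1}$, with $P(i_k=i)=q_i>0$, where the $q_i$ are constants; $q_{\min}:=\min_iq_i$. Conditional independence assumption: with $\mathcal Z^k:=\sigma(Z^0,\widehat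 Z^0,\dots,Z^k,\widehat Z^k)$ the generated $\sigma$-algebra, $P(i_k=i\mid\mathcal Z^k)=P(i_k=i)=q_i$ for all $i,k$.
   Formalization: The formal theorem additionally assumes that Fix T is nonempty (a solution exists); without this the claim fails, e.g. for n = 1, r = 0 and s linear and nonconstant, where T has no fixed point. *)

theory Defs
  imports "HOL-Analysis.Analysis" "HOL-Probability.Probability"
begin

definition epi :: "('a \<Rightarrow> ereal) \<Rightarrow> ('a \<times> real) set" where
  "epi f = {(x, t). f x \<le> ereal t}"

definition closed_proper_convex :: "('a::euclidean_space \<Rightarrow> ereal) \<Rightarrow> bool" where
  "closed_proper_convex f \<longleftrightarrow>
     closed (epi f) \<and> convex (epi f) \<and> (\<forall>x. f x \<noteq> - \<infinity>) \<and> (\<exists>x. f x \<noteq> \<infinity>)"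

text \<open>For proper \<open>f\<close> the set is empty wherever \<open>f x = \<infinity>\<close>, since the inequality then fails
  at every point of the effective domain.\<close>

definition subdiff :: "('a::real_inner \<Rightarrow> ereal) \<Rightarrow> 'a \<Rightarrow> 'a set" where
  "subdiff f x = {g. \<forall>y. f x + ereal (g \<bullet> (y - x)) \<le> f y}"

definition eigenvalues :: "real ^ 'k ^ 'k \<Rightarrow> real set" where
  "eigenvalues A = {l. \<exists>x. x \<noteq> 0 \<and> A *v x = l *\<^sub>R x}"

definition lambda_min :: "real ^ 'k ^ 'k \<Rightarrow> real" where
  "lambda_min A = Min (eigenvalues A)"

definition lambda_max :: "real ^ 'k ^ 'k \<Rightarrow> real" where
  "lambda_max A = Max (eigenvalues A)"

text \<open>Agents form a finite linearly ordered type; \<open>E\<close> is the set of edges, each written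
  \<open>(i, j)\<close> with \<open>i < j\<close>.\<close>

definition connected_network :: "('n::{finite,linorder} \<times> 'n) set \<Rightarrow> bool" where
  "connected_network E \<longleftrightarrow> (\<forall>(i, j) \<in> E. i < j) \<and> (E \<union> E\<inverse>)\<^sup>* = UNIV"

definition mixing_matrix :: "('n \<times> 'n) set \<Rightarrow> real ^ 'n ^ 'n \<Rightarrow> bool" where
  "mixing_matrix E W \<longleftrightarrow>
     transpose W = W \<and>
     (\<forall>i j. W $ i $ j \<ge> 0) \<and>
     (\<forall>i. (\<Sum>j\<in>UNIV. W $ i $ j) = 1) \<and>
     (\<forall>j. (\<Sum>i\<in>UNIV. W $ i $ j) = 1) \<and>
     (\<forall>i j. i \<noteq> j \<longrightarrow> (if (i, j) \<in> E \<union> E\<inverse> then W $ i $ j > 0 else W $ i $ j = 0)) \<and>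
     (\<exists>i. W $ i $ i > 0)"

definition Dmat :: "real ^ 'n ^ 'n \<Rightarrow> 'n \<times> 'n \<Rightarrow> 'n \<times> 'n \<Rightarrow> real" where
  "Dmat W e f = (if e = f then sqrt (W $ fst e $ snd e / 2) else 0)"

definition Cmat :: "'n \<times> 'n \<Rightarrow> 'n \<Rightarrow> real" where
  "Cmat e l = (if l = fst e then 1 else if l = snd e then - 1 else 0)"

definition Vmat :: "('n \<times> 'n) set \<Rightarrow> real ^ 'n ^ 'n \<Rightarrow> 'n \<times> 'n \<Rightarrow> 'n \<Rightarrow> real" where
  "Vmat E W e l = (\<Sum>f\<in>E. Dmat W e f * Cmat f l)"

text \<open>A matrix with one row per agent and one row per edge has its rows indexed by a finite type
  \<open>'k\<close> together with a labelling \<open>lab\<close>, a bijection from \<open>'k\<close> onto the agents and edges.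
  Hence \<open>CARD('k) = n + m\<close>. Using \<open>'k\<close> instead of a sum of an agent type and an edge type keeps
  the edgeless one-agent network (\<open>m = 0\<close>) included, as types are never empty.\<close>

datatype 'n row_label = Agent 'n | Edge "'n \<times> 'n"

definition row_labelling :: "('n \<times> 'n) set \<Rightarrow> ('k \<Rightarrow> 'n row_label) \<Rightarrow> bool" where
  "row_labelling E lab \<longleftrightarrow> bij_betw lab UNIV (range Agent \<union> Edge ` E)"

definition agent_rows :: "('k \<Rightarrow> 'n row_label) \<Rightarrow> real ^ 'p ^ 'k \<Rightarrow> real ^ 'p ^ 'n" where
  "agent_rows lab Z = (\<chi> i. Z $ (inv lab (Agent i)))"

definition stack0 :: "('k \<Rightarrow> 'n row_label) \<Rightarrow> real ^ 'p ^ 'n \<Rightarrow> real ^ 'p ^ 'k" where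
  "stack0 lab X = (\<chi> a. case lab a of Agent i \<Rightarrow> X $ i | Edge e \<Rightarrow> 0)"

text \<open>\<open>block_mat lab P Q R S\<close> is the block matrix with first block row \<open>P Q\<close> and second block
  row \<open>R S\<close>.\<close>

definition block_mat ::
  "('k \<Rightarrow> 'n row_label) \<Rightarrow> ('n \<Rightarrow> 'n \<Rightarrow> real) \<Rightarrow> ('n \<Rightarrow> 'n \<times> 'n \<Rightarrow> real) \<Rightarrow>
   ('n \<times> 'n \<Rightarrow> 'n \<Rightarrow> real) \<Rightarrow> ('n \<times> 'n \<Rightarrow> 'n \<times> 'n \<Rightarrow> real) \<Rightarrow> real ^ 'k ^ 'k" where
  "block_mat lab P Q R S = (\<chi> a b.
     case lab a of
       Agent i \<Rightarrow> (case lab b of Agent j \<Rightarrow> P i j | Edge f \<Rightarrow> Q i f)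
     | Edge e \<Rightarrow> (case lab b of Agent j \<Rightarrow> R e j | Edge f \<Rightarrow> S e f))"

definition Gmat ::
  "('n \<times> 'n) set \<Rightarrow> ('k \<Rightarrow> 'n row_label) \<Rightarrow> real ^ 'n ^ 'n \<Rightarrow> real ^ 'k ^ 'k" where
  "Gmat E lab W = block_mat lab
     (\<lambda>i j. of_bool (i = j)) (\<lambda>i e. Vmat E W e i)
     (\<lambda>e i. Vmat E W e i)    (\<lambda>e f. of_bool (e = f))"

definition Mmat ::
  "('n \<times> 'n) set \<Rightarrow> ('k \<Rightarrow> 'n row_label) \<Rightarrow> real ^ 'n ^ 'n \<Rightarrow> real \<Rightarrow> real ^ 'k ^ 'k" where
  "Mmat E lab W \<alpha> = (1 / \<alpha>) *\<^sub>R Gmat E lab W"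

definition cond_number :: "real ^ 'k ^ 'k \<Rightarrow> real" where
  "cond_number A = lambda_max A / lambda_min A"

text \<open>Here \<open>gs i\<close> is the gradient of \<open>s\<^sub>i\<close>. The inner product on \<open>real ^ 'p ^ 'n\<close>, used in the
  subdifferential of the sum of the \<open>r\<^sub>i\<close>, is the Frobenius inner product.\<close>

definition opA ::
  "('k \<Rightarrow> 'n::finite row_label) \<Rightarrow> ('n \<Rightarrow> real ^ 'p \<Rightarrow> real ^ 'p) \<Rightarrow> real ^ 'p ^ 'k \<Rightarrow> real ^ 'p ^ 'k" where
  "opA lab gs Z = stack0 lab (\<chi> i. gs i (agent_rows lab Z $ i))"

definition sum_rows :: "('n::finite \<Rightarrow> real ^ 'p \<Rightarrow> ereal) \<Rightarrow> real ^ 'p ^ 'n \<Rightarrow> ereal" where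
  "sum_rows r X = (\<Sum>i\<in>UNIV. r i (X $ i))"

definition opB ::
  "('n \<times> 'n) set \<Rightarrow> ('k \<Rightarrow> 'n row_label) \<Rightarrow> real ^ 'n ^ 'n \<Rightarrow> ('n \<Rightarrow> real ^ 'p \<Rightarrow> ereal) \<Rightarrow> real \<Rightarrow>
   real ^ 'p ^ 'k \<Rightarrow> (real ^ 'p ^ 'k) set" where
  "opB E lab W r \<alpha> Z =
     {stack0 lab U +
        block_mat lab (\<lambda>i j. 0)                    (\<lambda>i e. Vmat E W e i / \<alpha>)
                      (\<lambda>e i. - (Vmat E W e i / \<alpha>)) (\<lambda>e f. 0) ** Z
      | U. U \<in> subdiff (sum_rows r) (agent_rows lab Z)}"

text \<open>\<open>\<T> Z\<close> is the unique \<open>Z'\<close> with \<open>(I - M\<^sup>-\<^sup>1 \<A>) Z \<in> (I + M\<^sup>-\<^sup>1 \<B>) Z'\<close>.\<close>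

definition opT ::
  "('n \<times> 'n) set \<Rightarrow> ('k \<Rightarrow> 'n row_label) \<Rightarrow> real ^ 'n ^ 'n \<Rightarrow>
   ('n \<Rightarrow> real ^ 'p \<Rightarrow> real ^ 'p) \<Rightarrow> ('n \<Rightarrow> real ^ 'p \<Rightarrow> ereal) \<Rightarrow> real \<Rightarrow>
   real ^ 'p ^ 'k \<Rightarrow> real ^ 'p ^ 'k" where
  "opT E lab W gs r \<alpha> Z =
     (let Minv = matrix_inv (Mmat E lab W \<alpha>) in
      THE Z'. Z - Minv ** opA lab gs Z \<in> (\<lambda>U. Z' + Minv ** U) ` opB E lab W r \<alpha> Z')"

definition Fix :: "('a \<Rightarrow> 'a) \<Rightarrow> 'a set" where
  "Fix T = {z. z = T z}"

definition owned_rows :: "('n \<times> 'n) set \<Rightarrow> ('k \<Rightarrow> 'n row_label) \<Rightarrow> 'n \<Rightarrow> 'k set" where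
  "owned_rows E lab i = {a. lab a = Agent i \<or> (\<exists>e\<in>E. fst e = i \<and> lab a = Edge e)}"

definition opS ::
  "('n \<times> 'n) set \<Rightarrow> ('k \<Rightarrow> 'n row_label) \<Rightarrow> (real ^ 'p ^ 'k \<Rightarrow> real ^ 'p ^ 'k) \<Rightarrow> 'n \<Rightarrow>
   real ^ 'p ^ 'k \<Rightarrow> real ^ 'p ^ 'k" where
  "opS E lab T i Z = (\<chi> a. if a \<in> owned_rows E lab i then (Z - T Z) $ a else 0)"

text \<open>Truncated subtraction on \<open>nat\<close> implements the convention \<open>Z\<^sup>k = Z\<^sup>0\<close> for \<open>k < 0\<close>.\<close>

definition delayed ::
  "('k \<Rightarrow> 'n row_label) \<Rightarrow> (nat \<Rightarrow> 'n \<Rightarrow> 'w \<Rightarrow> nat) \<Rightarrow> (nat \<Rightarrow> 'n \<times> 'n \<Rightarrow> 'w \<Rightarrow> nat) \<Rightarrow>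
   (nat \<Rightarrow> 'w \<Rightarrow> real ^ 'p ^ 'k) \<Rightarrow> nat \<Rightarrow> 'w \<Rightarrow> real ^ 'p ^ 'k" where
  "delayed lab \<tau>d \<delta>d Z k \<omega> = (\<chi> a.
     case lab a of
       Agent j \<Rightarrow> Z (k - \<tau>d k j \<omega>) \<omega> $ a
     | Edge e \<Rightarrow> Z (k - \<delta>d k e \<omega>) \<omega> $ a)"

definition history ::
  "'w measure \<Rightarrow> (nat \<Rightarrow> 'w \<Rightarrow> 'a::topological_space) \<Rightarrow> (nat \<Rightarrow> 'w \<Rightarrow> 'a) \<Rightarrow> nat \<Rightarrow> 'w measure" where
  "history P Z Zh k = sigma (space P)
     (\<Union>l\<in>{..k}. {Z l -` A \<inter> space P | A. A \<in> sets borel} \<union>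
                 {Zh l -` A \<inter> space P | A. A \<in> sets borel})"

definition activation ::
  "'w measure \<Rightarrow> (nat \<Rightarrow> 'w \<Rightarrow> 'n) \<Rightarrow> ('n \<Rightarrow> real) \<Rightarrow> bool" where
  "activation P ag q \<longleftrightarrow>
     (\<forall>k. ag k \<in> measurable P (count_space UNIV)) \<and>
     (\<forall>i. q i > 0) \<and>
     (\<forall>k i. measure P {\<omega> \<in> space P. ag k \<omega> = i} = q i) \<and>
     (\<forall>k. prob_space.indep_set P
        {ag k -` A \<inter> space P | A. True}
        (sigma_sets (space P) {ag l -` A \<inter> space P | l A. l < k}))"

definition cond_independence ::
  "'w measure \<Rightarrow> (nat \<Rightarrow> 'w \<Rightarrow> 'a::topological_space) \<Rightarrow> (nat \<Rightarrow> 'w \<Rightarrow> 'a) \<Rightarrow>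
   (nat \<Rightarrow> 'w \<Rightarrow> 'n) \<Rightarrow> ('n \<Rightarrow> real) \<Rightarrow> bool" where
  "cond_independence P Z Zh ag q \<longleftrightarrow>
     (\<forall>k i. AE \<omega> in P.
        real_cond_exp P (history P Z Zh k) (indicator {\<omega> \<in> space P. ag k \<omega> = i}) \<omega> = q i)"

end

theory Submission
  imports Defs
begin

text \<open>
  The proof combines a deterministic fact about \<open>\<T>\<close> with a stochastic Lyapunov argument.

  In the inner product \<open>\<langle>X, Y\<rangle>\<^sub>M = (M ** X) \<bullet> Y\<close> the residual \<open>S = I - \<T>\<close> is \<open>1/2\<close>-cocoercive
  (\<open>opT_residual_cocoercive\<close>). Indeed \<open>M (Z - \<T> Z) - \<A> Z \<in> \<B> (\<T> Z)\<close>, where \<open>\<B>\<close> is monotone,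
  being a subdifferential plus a skew matrix, and \<open>\<A>\<close> is \<open>1/L\<close>-cocoercive by the
  Baillon-Haddad theorem; the bound on \<open>\<alpha>\<close> makes the sum of the two estimates come out with the
  constant \<open>1/2\<close>. That \<open>\<T>\<close> is defined everywhere rests on the block triangular form of
  \<open>M + \<B>\<close>: the edge rows of the resolvent are explicit, and the agent rows are proximal points.

  Fix a zero \<open>x\<close> of \<open>S\<close> and average one step of the algorithm over the activated agent, whose
  choice is independent of the past. The squared \<open>M\<close>-distance to \<open>x\<close> loses
  \<open>(\<eta>/n) \<parallel>S (Zh k)\<parallel>\<^sup>2\<close> by cocoercivity. It gains a second order term, and a cross term between
  \<open>S (Zh k)\<close> and \<open>Z k - Zh k\<close>. The latter difference is a sum of at most \<open>\<tau>\<close> earlier increments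
  of the sequence, each with some rows masked out, so Young's inequality bounds the cross term by a
  multiple of \<open>\<parallel>S (Zh k)\<parallel>\<^sup>2\<close> and the last \<open>\<tau>\<close> squared increments. Adding a weighted sum of these
  squared increments to the squared distance yields \<open>\<Phi>\<close>, for which the increments telescope. With
  the best Young parameter the net loss is a positive multiple of \<open>\<parallel>S (Zh k)\<parallel>\<^sup>2\<close> exactly under
  the stated bound on \<open>\<eta>\<close> (\<open>descent\<close>).

  Hence \<open>\<Phi>\<close> is a nonnegative supermartingale and converges almost surely, by Doob's upcrossing
  argument (\<open>nonneg_supermartingale_convergent\<close>), and the sum of \<open>\<parallel>S (Zh k)\<parallel>\<^sup>2\<close> is almost surely
  finite. So the increments vanish, the distance of \<open>Z k\<close> to each point of a countable dense set of
  zeros converges, and every cluster point of \<open>Z k\<close> is a zero. Opial's argument (\<open>opial\<close>) turns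
  this into convergence to a single zero.
\<close>

section \<open>Extreme eigenvalues of symmetric matrices\<close>

lemma symmetric_matrix_inner:
  fixes A :: "real^'k^'k"
  assumes "transpose A = A"
  shows "(A *v x) \<bullet> y = x \<bullet> (A *v y)"
  by (metis assms dot_lmul_matrix transpose_matrix_vector)

text \<open>Eigenvectors for distinct eigenvalues are orthogonal, and a pairwise orthogonal set of nonzero
  vectors is finite.\<close>

lemma finite_eigenvalues_symmetric:
  fixes A :: "real^'k^'k"
  assumes "transpose A = A"
  shows "finite (eigenvalues A)"
proof -
  have "\<forall>l\<in>eigenvalues A. \<exists>x. x \<noteq> 0 \<and> A *v x = l *\<^sub>R x"
    by (auto simp: eigenvalues_def)
  then obtain f where f: "\<And>l. l \<in> eigenvalues A \<Longrightarrow> f l \<noteq> 0 \<and> A *v f l = l *\<^sub>R f l"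
    by (metis bchoice)
  have orth: "f l \<bullet> f m = 0" if "l \<in> eigenvalues A" "m \<in> eigenvalues A" "l \<noteq> m" for l m
  proof -
    have "l * (f l \<bullet> f m) = m * (f l \<bullet> f m)"
      using symmetric_matrix_inner[OF assms, of "f l" "f m"] f that by simp
    then show ?thesis using that by simp
  qed
  have inj: "inj_on f (eigenvalues A)"
    by (rule inj_onI) (metis f inner_eq_zero_iff orth)
  have "pairwise orthogonal (f ` eigenvalues A)"
    by (auto simp: pairwise_def orthogonal_def intro: orth)
  then have "finite (f ` eigenvalues A)"
    using pairwise_orthogonal_imp_finite by blast
  then show ?thesis using inj finite_imageD by blast
qed

text \<open>A point where a nonnegative quadratic form vanishes is a minimum, so the gradient \<open>2 N
  x0\<close> vanishes there.\<close>

lemma psd_form_zero_imp_kernel: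
  fixes N :: "real^'k^'k"
  assumes sym: "transpose N = N" and psd: "\<And>x. 0 \<le> (N *v x) \<bullet> x" and z: "(N *v x0) \<bullet> x0 = 0"
  shows "N *v x0 = 0"
proof (rule ccontr)
  define g where "g = N *v x0"
  assume "N *v x0 \<noteq> 0"
  then have gpos: "g \<bullet> g > 0" by (simp add: g_def)
  have quad: "0 \<le> 2 * t * (g \<bullet> g) + t\<^sup>2 * ((N *v g) \<bullet> g)" for t
  proof -
    have "(N *v (x0 + t *\<^sub>R g)) \<bullet> (x0 + t *\<^sub>R g) = 2 * t * (g \<bullet> g) + t\<^sup>2 * ((N *v g) \<bullet> g)"
      using z symmetric_matrix_inner[OF sym, of g x0]
      by (simp add: matrix_vector_right_distrib matrix_vector_mult_scaleR inner_simps g_def[symmetric]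
            power2_eq_square inner_commute algebra_simps)
    then show ?thesis using psd[of "x0 + t *\<^sub>R g"] by simp
  qed
  define c where "c = (N *v g) \<bullet> g"
  have c0: "c \<ge> 0" using psd by (simp add: c_def)
  \<comment> \<open>A step against the gradient direction, short enough for the linear term to dominate;
    \<open>+ 1\<close> avoids division by zero.\<close>
  define t where "t = - (g \<bullet> g) / (c + 1)"
  have "2 * t * (g \<bullet> g) + t\<^sup>2 * c < 0"
  proof -
    have "t\<^sup>2 * (c + 1) = - t * (g \<bullet> g)" using c0 by (simp add: t_def power2_eq_square)
    moreover have "t * (g \<bullet> g) < 0"
      using gpos c0 by (simp add: t_def divide_neg_pos mult_neg_pos)
    moreover have "t\<^sup>2 * c \<le> t\<^sup>2 * (c + 1)" by (intro mult_left_mono) auto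
    ultimately show ?thesis by linarith
  qed
  then show False using quad[of t] by (simp add: c_def)
qed

text \<open>The minimum of the Rayleigh quotient over the unit sphere is attained, and by the previous lemma
  applied to \<open>A - \<mu> I\<close> the minimiser is an eigenvector. So the minimum is the least
  eigenvalue; in particular the set whose \<open>Min\<close> is taken is not empty.\<close>

lemma lambda_min_rayleigh:
  fixes A :: "real^'k^'k"
  assumes sym: "transpose A = A"
  shows "lambda_min A \<in> eigenvalues A" and "lambda_min A * (x \<bullet> x) \<le> (A *v x) \<bullet> x"
proof -
  define S where "S = sphere (0::real^'k) 1"
  have "axis undefined 1 \<in> S" by (simp add: S_def norm_axis_1)
  then have ne: "S \<noteq> {}" by blast
  have "continuous_on S (\<lambda>x. (A *v x) \<bullet> x)"
    by (intro continuous_intros matrix_vector_mult_linear_continuous_on)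
  then obtain x0 where x0: "x0 \<in> S" "\<And>y. y \<in> S \<Longrightarrow> (A *v x0) \<bullet> x0 \<le> (A *v y) \<bullet> y"
    using continuous_attains_inf[of S "\<lambda>x. (A *v x) \<bullet> x"] ne by (auto simp: S_def)
  define \<mu> where "\<mu> = (A *v x0) \<bullet> x0"
  have n0: "x0 \<bullet> x0 = 1" using x0(1) by (simp add: S_def dot_square_norm)
  have ray: "\<mu> * (y \<bullet> y) \<le> (A *v y) \<bullet> y" for y
  proof (cases "y = 0")
    case False
    define u where "u = (1 / norm y) *\<^sub>R y"
    have "u \<in> S" using False by (simp add: S_def u_def)
    then have "\<mu> \<le> (A *v u) \<bullet> u" using x0 by (simp add: \<mu>_def)
    also have "\<dots> = ((A *v y) \<bullet> y) / (y \<bullet> y)"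
      by (simp add: u_def matrix_vector_mult_scaleR dot_square_norm power2_eq_square)
    finally show ?thesis using False by (simp add: pos_le_divide_eq)
  qed simp
  define N where "N = A - \<mu> *\<^sub>R mat 1"
  have Nv: "N *v y = A *v y - \<mu> *\<^sub>R y" for y
    by (simp add: N_def matrix_vector_mult_diff_rdistrib scaleR_matrix_vector_assoc[symmetric])
  have symN: "transpose N = N"
  proof -
    have "transpose N = transpose A - \<mu> *\<^sub>R transpose (mat 1)"
      by (vector N_def transpose_def)
    then show ?thesis using sym by (simp add: N_def)
  qed
  have "N *v x0 = 0"
    by (rule psd_form_zero_imp_kernel[OF symN])
       (use ray n0 in \<open>auto simp: Nv inner_diff_left \<mu>_def\<close>)
  then have mem: "\<mu> \<in> eigenvalues A"
    using n0 by (auto simp: Nv eigenvalues_def intro!: exI[of _ x0])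
  have least: "\<mu> \<le> l" if l: "l \<in> eigenvalues A" for l
  proof -
    obtain y where y: "y \<noteq> 0" "A *v y = l *\<^sub>R y" using l by (auto simp: eigenvalues_def)
    then have "\<mu> * (y \<bullet> y) \<le> l * (y \<bullet> y)" using ray[of y] by simp
    then show ?thesis using y by simp
  qed
  have eq: "lambda_min A = \<mu>"
    unfolding lambda_min_def
    by (rule Min_eqI) (use finite_eigenvalues_symmetric[OF sym] mem least in auto)
  show "lambda_min A \<in> eigenvalues A" using mem eq by simp
  show "lambda_min A * (x \<bullet> x) \<le> (A *v x) \<bullet> x" using ray eq by simp
qed

text \<open>Follows from the lower bound for \<open>- A\<close>.\<close>

lemma lambda_max_rayleigh:
  fixes A :: "real^'k^'k"
  assumes sym: "transpose A = A"
  shows "(A *v x) \<bullet> x \<le> lambda_max A * (x \<bullet> x)"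
proof -
  have mv: "(- A) *v y = - (A *v y)" for y
    by (simp add: vec_eq_iff matrix_vector_mult_def sum_negf)
  have symm: "transpose (- A) = - A"
    using sym by (simp add: transpose_def vec_eq_iff)
  have ev: "eigenvalues (- A) = uminus ` eigenvalues A"
  proof -
    have "l \<in> eigenvalues (- A) \<longleftrightarrow> - l \<in> eigenvalues A" for l
      unfolding eigenvalues_def mv mem_Collect_eq
      by (metis minus_equation_iff scaleR_minus_left)
    then show ?thesis by (force simp: image_iff)
  qed
  have fin: "finite (eigenvalues A)" by (rule finite_eigenvalues_symmetric[OF sym])
  have "- lambda_min (- A) \<in> eigenvalues A"
    using lambda_min_rayleigh(1)[OF symm] ev by auto
  then have "- lambda_min (- A) \<le> lambda_max A"
    unfolding lambda_max_def using fin by auto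
  then have "- lambda_min (- A) * (x \<bullet> x) \<le> lambda_max A * (x \<bullet> x)"
    by (intro mult_right_mono) auto
  moreover have "lambda_min (- A) * (x \<bullet> x) \<le> - ((A *v x) \<bullet> x)"
    using lambda_min_rayleigh(2)[OF symm, of x] mv by simp
  ultimately show ?thesis by linarith
qed

section \<open>Proximal points and subdifferentials\<close>

text \<open>Separate the epigraph from a point just below it. The separating hyperplane is not vertical,
  because the point of the graph above the separated point lies strictly on the other side.\<close>

lemma closed_proper_convex_affine_minorant:
  fixes f :: "'a::euclidean_space \<Rightarrow> ereal"
  assumes "closed_proper_convex f"
  obtains a c where "\<And>x t. (x, t) \<in> epi f \<Longrightarrow> a \<bullet> x + c \<le> t"
proof -
  have cl: "closed (epi f)" and cv: "convex (epi f)"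
    and nm: "\<And>x. f x \<noteq> - \<infinity>" and ex: "\<exists>x. f x \<noteq> \<infinity>"
    using assms by (auto simp: closed_proper_convex_def)
  obtain x0 where "f x0 \<noteq> \<infinity>" using ex by blast
  then obtain t0 where t0: "f x0 = ereal t0" using nm[of x0] by (cases "f x0") auto
  have "(x0, t0 - 1) \<notin> epi f" by (simp add: epi_def t0)
  then obtain v b where v: "v \<bullet> (x0, t0 - 1) < b" "\<And>p. p \<in> epi f \<Longrightarrow> b < v \<bullet> p"
    using separating_hyperplane_closed_point[OF cv cl] by blast
  obtain a s where vs: "v = (a, s)" by (cases v)
  have "(x0, t0) \<in> epi f" by (simp add: epi_def t0)
  from v(2)[OF this] v(1) have spos: "s > 0" by (simp add: vs algebra_simps)
  show ?thesis
  proof (rule that[of "(- 1 / s) *\<^sub>R a" "b / s"])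
    fix x t assume "(x, t) \<in> epi f"
    from v(2)[OF this] have "b < a \<bullet> x + s * t" by (simp add: vs)
    then have "b - a \<bullet> x \<le> s * t" by simp
    then have "(b - a \<bullet> x) / s \<le> t" using spos by (simp add: pos_divide_le_eq mult.commute)
    then show "(- 1 / s) *\<^sub>R a \<bullet> x + b / s \<le> t" by (simp add: diff_divide_distrib)
  qed
qed

text \<open>Minimising \<open>f x + \<parallel>x - u\<parallel>\<^sup>2 / (2 \<alpha>)\<close> amounts to
  minimising the continuous function \<open>\<phi>\<close> on the epigraph of \<open>f\<close>, which spares
  any talk of lower semicontinuity. The sublevel sets are compact, since the quadratic term dominates an
  affine minorant of \<open>f\<close>. The subgradient inequality is the first order condition at the
  minimiser, obtained by moving a little towards \<open>(y, f y)\<close>.\<close>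

lemma prox_exists:
  fixes f :: "'a::euclidean_space \<Rightarrow> ereal"
  assumes cpc: "closed_proper_convex f" and \<alpha>: "\<alpha> > 0"
  shows "\<exists>x. (1 / \<alpha>) *\<^sub>R (u - x) \<in> subdiff f x"
proof -
  have cl: "closed (epi f)" and cv: "convex (epi f)"
    and nm: "\<And>x. f x \<noteq> - \<infinity>" and ex: "\<exists>x. f x \<noteq> \<infinity>"
    using cpc by (auto simp: closed_proper_convex_def)
  obtain a c where ac: "\<And>x t. (x, t) \<in> epi f \<Longrightarrow> a \<bullet> x + c \<le> t"
    using closed_proper_convex_affine_minorant[OF cpc] by blast
  obtain x0 where "f x0 \<noteq> \<infinity>" using ex by blast
  then obtain t0 where t0: "f x0 = ereal t0" using nm[of x0] by (cases "f x0") auto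
  have in0: "(x0, t0) \<in> epi f" by (simp add: epi_def t0)
  define \<phi> where "\<phi> p = snd p + (norm (fst p - u))\<^sup>2 / (2 * \<alpha>)" for p :: "'a \<times> real"
  define K where "K = epi f \<inter> {p. \<phi> p \<le> \<phi> (x0, t0)}"
  have cont: "continuous_on UNIV \<phi>" unfolding \<phi>_def by (intro continuous_intros) (use \<alpha> in auto)
  have "closed {p. \<phi> p \<le> \<phi> (x0, t0)}"
    by (rule closed_Collect_le[OF cont continuous_on_const])
  then have clK: "closed K" unfolding K_def using cl by (rule closed_Int[rotated])
  define R where "R = 2 * \<alpha> * (\<phi> (x0, t0) - c - a \<bullet> u)"
  have bd: "norm (fst p) \<le> norm u + (\<bar>R\<bar> + 2 * \<alpha> * norm a + 1)" if "p \<in> K" for p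
  proof -
    define d where "d = norm (fst p - u)"
    have d0: "d \<ge> 0" by (simp add: d_def)
    have p: "p \<in> epi f" "\<phi> p \<le> \<phi> (x0, t0)" using that by (auto simp: K_def)
    have "a \<bullet> fst p + c \<le> snd p" using ac[of "fst p" "snd p"] p by simp
    moreover have "a \<bullet> fst p = a \<bullet> u + a \<bullet> (fst p - u)" by (simp add: inner_diff_right)
    moreover have "\<bar>a \<bullet> (fst p - u)\<bar> \<le> norm a * d" unfolding d_def by (rule Cauchy_Schwarz_ineq2)
    ultimately have "d\<^sup>2 / (2 * \<alpha>) \<le> \<phi> (x0, t0) - c - a \<bullet> u + norm a * d"
      using p(2) by (simp add: \<phi>_def[of p] d_def[symmetric])
    then have q: "d\<^sup>2 \<le> R + 2 * \<alpha> * norm a * d" using \<alpha> by (simp add: R_def field_simps)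
    have "d \<le> \<bar>R\<bar> + 2 * \<alpha> * norm a + 1"
    proof (rule ccontr)
      assume "\<not> ?thesis"
      then have big: "\<bar>R\<bar> + 2 * \<alpha> * norm a + 1 < d" by simp
      then have "d \<ge> 1" using \<alpha> by (smt (verit) norm_ge_zero mult_nonneg_nonneg)
      then have "\<bar>R\<bar> * 1 \<le> \<bar>R\<bar> * d" by (intro mult_left_mono) auto
      then have "d * d \<le> (\<bar>R\<bar> + 2 * \<alpha> * norm a) * d"
        using q by (simp add: power2_eq_square algebra_simps)
      then have "d \<le> \<bar>R\<bar> + 2 * \<alpha> * norm a" using \<open>d \<ge> 1\<close> by simp
      then show False using big by simp
    qed
    moreover have "norm (fst p) \<le> norm u + d"
      unfolding d_def by (metis add.commute norm_triangle_sub)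
    ultimately show ?thesis by linarith
  qed
  define B1 where "B1 = norm u + (\<bar>R\<bar> + 2 * \<alpha> * norm a + 1)"
  have sb: "\<bar>snd p\<bar> \<le> \<bar>\<phi> (x0, t0)\<bar> + norm a * B1 + \<bar>c\<bar>" if "p \<in> K" for p
  proof -
    have p: "p \<in> epi f" "\<phi> p \<le> \<phi> (x0, t0)" using that by (auto simp: K_def)
    have "(norm (fst p - u))\<^sup>2 / (2 * \<alpha>) \<ge> 0" using \<alpha> by simp
    then have up: "snd p \<le> \<phi> (x0, t0)" using p(2) unfolding \<phi>_def[of p] by linarith
    have "a \<bullet> fst p + c \<le> snd p" using ac[of "fst p" "snd p"] p by simp
    moreover have "\<bar>a \<bullet> fst p\<bar> \<le> norm a * B1"
      using Cauchy_Schwarz_ineq2[of a "fst p"] mult_left_mono[OF bd[OF that], of "norm a"]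
      by (simp add: B1_def)
    moreover have "norm a * B1 \<ge> 0" using bd[OF that] norm_ge_zero[of "fst p"] unfolding B1_def[symmetric]
      by (meson mult_nonneg_nonneg norm_ge_zero order_trans)
    ultimately show ?thesis using up by linarith
  qed
  have "bounded K"
  proof (rule boundedI)
    fix p assume "p \<in> K"
    have "norm p \<le> norm (fst p) + norm (snd p)"
      by (metis norm_Pair_le prod.collapse)
    then show "norm p \<le> B1 + (\<bar>\<phi> (x0, t0)\<bar> + norm a * B1 + \<bar>c\<bar>)"
      using bd[OF \<open>p \<in> K\<close>] sb[OF \<open>p \<in> K\<close>] by (simp add: B1_def)
  qed
  with clK have "compact K" by (simp add: compact_eq_bounded_closed)
  moreover have "K \<noteq> {}" using in0 by (auto simp: K_def)
  moreover have "continuous_on K \<phi>" using cont by (rule continuous_on_subset) simp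
  ultimately obtain p where p: "p \<in> K" "\<And>p'. p' \<in> K \<Longrightarrow> \<phi> p \<le> \<phi> p'"
    using continuous_attains_inf[of K \<phi>] by auto
  obtain x t where xt: "p = (x, t)" by (cases p)
  have pe: "(x, t) \<in> epi f" using p(1) by (simp add: K_def xt)
  have min: "\<phi> (x, t) \<le> \<phi> p'" if "p' \<in> epi f" for p'
  proof (cases "\<phi> p' \<le> \<phi> (x0, t0)")
    case True
    then show ?thesis using p(2)[of p'] that by (simp add: K_def xt)
  next
    case False
    have "\<phi> (x, t) \<le> \<phi> (x0, t0)" using p(1) by (simp add: K_def xt)
    then show ?thesis using False by linarith
  qed
  have fx: "f x \<le> ereal t" using pe by (simp add: epi_def)
  \<comment> \<open>At a minimiser of \<open>\<phi>\<close> the epigraph point lies on the graph.\<close>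
  have "ereal t \<le> f x"
  proof -
    obtain t' where t': "f x = ereal t'" using fx nm[of x] by (cases "f x") auto
    then have "(x, t') \<in> epi f" by (simp add: epi_def)
    from min[OF this] show ?thesis by (simp add: \<phi>_def t')
  qed
  with fx have fx: "f x = ereal t" by simp
  have "(1 / \<alpha>) *\<^sub>R (u - x) \<in> subdiff f x"
    unfolding subdiff_def mem_Collect_eq
  proof
    fix y
    show "f x + ereal ((1 / \<alpha>) *\<^sub>R (u - x) \<bullet> (y - x)) \<le> f y"
    proof (cases "f y")
      case PInf then show ?thesis by simp
    next
      case MInf then show ?thesis using nm by simp
    next
      case (real t')
      then have ye: "(y, t') \<in> epi f" by (simp add: epi_def)
      define g where "g = (u - x) \<bullet> (y - x)"
      define D where "D = (norm (y - x))\<^sup>2"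
      have key: "t + g / \<alpha> \<le> t' + \<epsilon> * (D / (2 * \<alpha>))" if \<epsilon>: "0 < \<epsilon>" "\<epsilon> < 1" for \<epsilon>
      proof -
        have "(1 - \<epsilon>) *\<^sub>R (x, t) + \<epsilon> *\<^sub>R (y, t') \<in> epi f"
          using convexD[OF cv pe ye, of "1 - \<epsilon>" \<epsilon>] \<epsilon> by simp
        from min[OF this]
        have "t + (norm (x - u))\<^sup>2 / (2 * \<alpha>) \<le> (1 - \<epsilon>) * t + \<epsilon> * t' +
               (norm ((1 - \<epsilon>) *\<^sub>R x + \<epsilon> *\<^sub>R y - u))\<^sup>2 / (2 * \<alpha>)" by (simp add: \<phi>_def)
        moreover have "(norm ((1 - \<epsilon>) *\<^sub>R x + \<epsilon> *\<^sub>R y - u))\<^sup>2 = (norm (x - u))\<^sup>2 - 2 * \<epsilon> * g + \<epsilon>\<^sup>2 * D"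
        proof -
          have *: "(1 - \<epsilon>) *\<^sub>R x + \<epsilon> *\<^sub>R y - u = (x - u) + \<epsilon> *\<^sub>R (y - x)"
            by (simp add: algebra_simps)
          have "(x - u) \<bullet> (y - x) = - g" by (simp add: g_def inner_diff_left)
          moreover have "(norm ((x - u) + \<epsilon> *\<^sub>R (y - x)))\<^sup>2
              = (norm (x - u))\<^sup>2 + 2 * \<epsilon> * ((x - u) \<bullet> (y - x)) + \<epsilon>\<^sup>2 * D"
            unfolding power2_norm_eq_inner D_def inner_add_left inner_add_right
            by (simp add: inner_commute power2_eq_square)
          ultimately show ?thesis unfolding * by simp
        qed
        ultimately have "t + (norm (x - u))\<^sup>2 / (2 * \<alpha>) \<le> (1 - \<epsilon>) * t + \<epsilon> * t' +
               ((norm (x - u))\<^sup>2 - 2 * \<epsilon> * g + \<epsilon>\<^sup>2 * D) / (2 * \<alpha>)" by simp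
        then have "\<epsilon> * t + (2 * \<epsilon> * g) / (2 * \<alpha>) \<le> \<epsilon> * t' + (\<epsilon>\<^sup>2 * D) / (2 * \<alpha>)"
          unfolding add_divide_distrib diff_divide_distrib left_diff_distrib by linarith
        then have "\<epsilon> * (t + g / \<alpha>) \<le> \<epsilon> * (t' + \<epsilon> * (D / (2 * \<alpha>)))"
          by (simp add: algebra_simps power2_eq_square)
        then show ?thesis using \<epsilon> by (simp add: mult_le_cancel_left_pos)
      qed
      have "t + g / \<alpha> \<le> t'"
      proof (rule tendsto_lowerbound[where f="\<lambda>\<epsilon>. t' + \<epsilon> * (D / (2 * \<alpha>))" and F="at_right 0"])
        have "((\<lambda>\<epsilon>. t' + \<epsilon> * (D / (2 * \<alpha>))) \<longlongrightarrow> t' + 0 * (D / (2 * \<alpha>))) (at_right 0)"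
          by (intro tendsto_intros)
        then show "((\<lambda>\<epsilon>. t' + \<epsilon> * (D / (2 * \<alpha>))) \<longlongrightarrow> t') (at_right 0)" by simp
        show "\<forall>\<^sub>F \<epsilon> in at_right 0. t + g / \<alpha> \<le> t' + \<epsilon> * (D / (2 * \<alpha>))"
          unfolding eventually_at_right_field using key by (intro exI[of _ 1]) auto
      qed simp
      then show ?thesis by (simp add: fx real g_def)
    qed
  qed
  then show ?thesis by blast
qed

text \<open>Add the two subgradient inequalities; \<open>f\<close> is finite wherever it has a
  subgradient.\<close>

lemma subdiff_monotone:
  assumes "\<And>x. f x \<noteq> - \<infinity>" "\<exists>x. f x \<noteq> \<infinity>" and g: "g \<in> subdiff f x" and h: "h \<in> subdiff f y"
  shows "0 \<le> (g - h) \<bullet> (x - y)"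
proof -
  have fin: "\<exists>t. f z = ereal t" if "k \<in> subdiff f z" for z k
  proof -
    obtain w where w: "f w \<noteq> \<infinity>" using assms by blast
    have "f z + ereal (k \<bullet> (w - z)) \<le> f w" using that by (simp add: subdiff_def)
    then show ?thesis using w assms(1)[of z] by (cases "f z") auto
  qed
  obtain a b where ab: "f x = ereal a" "f y = ereal b" using fin[OF g] fin[OF h] by blast
  have "f x + ereal (g \<bullet> (y - x)) \<le> f y" "f y + ereal (h \<bullet> (x - y)) \<le> f x"
    using g h by (simp_all add: subdiff_def)
  then have "a + g \<bullet> (y - x) \<le> b" "b + h \<bullet> (x - y) \<le> a" by (simp_all add: ab)
  then show ?thesis by (simp add: inner_diff_left inner_diff_right)
qed

section \<open>Gradients of smooth convex functions\<close>

lemma convex_on_of_closed_proper_convex: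
  fixes s :: "'a::euclidean_space \<Rightarrow> real"
  assumes "closed_proper_convex (\<lambda>x. ereal (s x))"
  shows "convex_on UNIV s"
proof -
  have "convex (epigraph UNIV s)"
  proof -
    have "epigraph UNIV s = epi (\<lambda>x. ereal (s x))"
      by (auto simp: epigraph_def epi_def)
    then show ?thesis using assms by (simp add: closed_proper_convex_def)
  qed
  then show ?thesis by (simp add: convex_epigraph)
qed

lemma gderiv_line:
  assumes "\<And>x. GDERIV s x :> gs x"
  shows "((\<lambda>t. s (x + t *\<^sub>R d)) has_real_derivative (gs (x + t *\<^sub>R d) \<bullet> d)) (at t)"
proof -
  have "((\<lambda>t. x + t *\<^sub>R d) has_derivative (\<lambda>h. h *\<^sub>R d)) (at t)"
    by (auto intro!: derivative_eq_intros)
  moreover have "(s has_derivative (\<lambda>h. h \<bullet> gs (x + t *\<^sub>R d))) (at (x + t *\<^sub>R d))"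
    using assms by (simp add: gderiv_def)
  ultimately have "((\<lambda>t. s (x + t *\<^sub>R d)) has_derivative (\<lambda>h. (h *\<^sub>R d) \<bullet> gs (x + t *\<^sub>R d))) (at t)"
    by (rule has_derivative_compose)
  then show ?thesis
    by (rule has_derivative_imp_has_field_derivative) (simp add: inner_commute)
qed

lemma convex_gradient_inequality:
  fixes s :: "'a::euclidean_space \<Rightarrow> real"
  assumes cv: "convex_on UNIV s" and gr: "\<And>x. GDERIV s x :> gs x"
  shows "s x + gs x \<bullet> (y - x) \<le> s y"
proof -
  define h where "h t = s (x + t *\<^sub>R (y - x))" for t
  have "convex_on UNIV h"
    unfolding h_def
  proof (rule convex_onI)
    fix t a b :: real assume t: "0 < t" "t < 1"
    have "x + ((1 - t) *\<^sub>R a + t *\<^sub>R b) *\<^sub>R (y - x)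
        = (1 - t) *\<^sub>R (x + a *\<^sub>R (y - x)) + t *\<^sub>R (x + b *\<^sub>R (y - x))"
      by (simp add: algebra_simps)
    then show "s (x + ((1 - t) *\<^sub>R a + t *\<^sub>R b) *\<^sub>R (y - x))
        \<le> (1 - t) * s (x + a *\<^sub>R (y - x)) + t * s (x + b *\<^sub>R (y - x))"
      using convex_onD[OF cv, of t] t by simp
  qed simp
  moreover have "(h has_real_derivative gs x \<bullet> (y - x)) (at 0)"
    using gderiv_line[OF gr, of x "y - x" 0] by (simp add: h_def[abs_def])
  ultimately have "h 1 - h 0 \<ge> (gs x \<bullet> (y - x)) * (1 - 0)"
    by (intro convex_on_imp_above_tangent[where A=UNIV]) auto
  then show ?thesis by (simp add: h_def)
qed

text \<open>Along the segment from \<open>x\<close> to \<open>y\<close> the difference of the two sides is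
  monotone, as the Lipschitz bound signs its derivative.\<close>

lemma descent_lemma:
  fixes s :: "'a::euclidean_space \<Rightarrow> real"
  assumes gr: "\<And>x. GDERIV s x :> gs x" and lip: "\<And>x y. norm (gs x - gs y) \<le> L * norm (x - y)"
  shows "s y \<le> s x + gs x \<bullet> (y - x) + L / 2 * (norm (y - x))\<^sup>2"
proof -
  define d where "d = y - x"
  define h where "h t = s (x + t *\<^sub>R d) - t * (gs x \<bullet> d) - L / 2 * t\<^sup>2 * (norm d)\<^sup>2" for t
  have "h 1 \<le> h 0"
  proof (rule DERIV_nonpos_imp_nonincreasing[of 0 1 h])
    fix t :: real assume t: "0 \<le> t" "t \<le> 1"
    have "(h has_real_derivative (gs (x + t *\<^sub>R d) \<bullet> d - gs x \<bullet> d - L * t * (norm d)\<^sup>2)) (at t)"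
      unfolding h_def by (rule derivative_eq_intros gderiv_line[OF gr] refl | simp)+
    moreover have "gs (x + t *\<^sub>R d) \<bullet> d - gs x \<bullet> d - L * t * (norm d)\<^sup>2 \<le> 0"
    proof -
      have "gs (x + t *\<^sub>R d) \<bullet> d - gs x \<bullet> d = (gs (x + t *\<^sub>R d) - gs x) \<bullet> d"
        by (simp add: inner_diff_left)
      also have "\<dots> \<le> norm (gs (x + t *\<^sub>R d) - gs x) * norm d" by (rule norm_cauchy_schwarz)
      also have "\<dots> \<le> (L * norm (t *\<^sub>R d)) * norm d"
        using lip[of "x + t *\<^sub>R d" x] by (intro mult_right_mono) auto
      also have "\<dots> = L * t * (norm d)\<^sup>2" using t by (simp add: power2_eq_square)
      finally show ?thesis by simp
    qed
    ultimately show "\<exists>z. (h has_real_derivative z) (at t) \<and> z \<le> 0" by blast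
  qed simp
  then show ?thesis by (simp add: h_def d_def)
qed

text \<open>This is the Baillon-Haddad theorem. The gradient step \<open>z = y - v / L\<close>, where
  \<open>v\<close> is the gradient difference, lies above the tangent at \<open>x\<close> and below the
  quadratic upper model at \<open>y\<close>; comparing the two bounds sharpens the gradient inequality by
  \<open>\<parallel>v\<parallel>\<^sup>2 / (2 L)\<close>. Adding the sharpened inequalities for \<open>(x,
  y)\<close> and \<open>(y, x)\<close> gives the claim.\<close>

lemma gradient_cocoercive:
  fixes s :: "'a::euclidean_space \<Rightarrow> real"
  assumes cv: "convex_on UNIV s" and gr: "\<And>x. GDERIV s x :> gs x"
    and lip: "\<And>x y. norm (gs x - gs y) \<le> L * norm (x - y)" and L: "L > 0"
  shows "(norm (gs x - gs y))\<^sup>2 \<le> L * ((gs x - gs y) \<bullet> (x - y))"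
proof -
  have half: "s x + gs x \<bullet> (y - x) + (norm (gs y - gs x))\<^sup>2 / (2 * L) \<le> s y" for x y
  proof -
    define v where "v = gs y - gs x"
    define z where "z = y - (1 / L) *\<^sub>R v"
    have "s x + gs x \<bullet> (z - x) \<le> s z" by (rule convex_gradient_inequality[OF cv gr])
    moreover have "s z \<le> s y + gs y \<bullet> (z - y) + L / 2 * (norm (z - y))\<^sup>2"
      by (rule descent_lemma[OF gr lip])
    moreover have "gs y \<bullet> (z - y) = - (gs y \<bullet> v) / L" by (simp add: z_def)
    moreover have "gs x \<bullet> (z - x) = gs x \<bullet> (y - x) - (gs x \<bullet> v) / L"
      by (simp add: z_def inner_diff_right)
    moreover have "L / 2 * (norm (z - y))\<^sup>2 = (norm v)\<^sup>2 / (2 * L)"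
      using L by (simp add: z_def power_divide power2_eq_square)
    moreover have "(gs y \<bullet> v) / L - (gs x \<bullet> v) / L = (norm v)\<^sup>2 / L"
      by (simp add: v_def inner_diff_left power2_norm_eq_inner flip: diff_divide_distrib)
    moreover have "(norm v)\<^sup>2 / L = 2 * ((norm v)\<^sup>2 / (2 * L))" by simp
    ultimately show ?thesis unfolding v_def[symmetric] by linarith
  qed
  have "s x + gs x \<bullet> (y - x) + (norm (gs x - gs y))\<^sup>2 / (2 * L) \<le> s y"
    using half[of x y] by (simp add: norm_minus_commute)
  moreover have "s y + gs y \<bullet> (x - y) + (norm (gs x - gs y))\<^sup>2 / (2 * L) \<le> s x" by (rule half)
  moreover have "(norm (gs x - gs y))\<^sup>2 / L = 2 * ((norm (gs x - gs y))\<^sup>2 / (2 * L))" by simp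
  ultimately have "(norm (gs x - gs y))\<^sup>2 / L \<le> (gs x - gs y) \<bullet> (x - y)"
    unfolding inner_diff_left inner_diff_right by argo
  then show ?thesis using L by (simp add: divide_le_eq mult.commute)
qed

section \<open>Almost sure convergence of nonnegative supermartingales\<close>

text \<open>A trader buys when the price \<open>x\<close> is below \<open>a\<close> and sells when it exceeds
  \<open>b\<close>. Whether the asset is held after time \<open>k\<close> depends only on the prices up to
  time \<open>k\<close>, so on a supermartingale the expected gain is at most zero; each completed sale earns
  at least \<open>b - a\<close>.\<close>

fun holding :: "real \<Rightarrow> real \<Rightarrow> (nat \<Rightarrow> real) \<Rightarrow> nat \<Rightarrow> bool" where
  "holding a b x 0 \<longleftrightarrow> x 0 < a"
| "holding a b x (Suc k) \<longleftrightarrow> (if holding a b x k then x (Suc k) \<le> b else x (Suc k) < a)"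

definition sales :: "real \<Rightarrow> real \<Rightarrow> (nat \<Rightarrow> real) \<Rightarrow> nat \<Rightarrow> real" where
  "sales a b x k = (\<Sum>j<k. of_bool (holding a b x j \<and> b < x (Suc j)))"

definition gain :: "real \<Rightarrow> real \<Rightarrow> (nat \<Rightarrow> real) \<Rightarrow> nat \<Rightarrow> real" where
  "gain a b x k = (\<Sum>j<k. of_bool (holding a b x j) * (x (Suc j) - x j))"

text \<open>The second summand on the left, the paper profit of an open position, is what makes the induction
  work.\<close>

lemma gain_ge_sales:
  assumes "a < b"
  shows "(b - a) * sales a b x k + (if holding a b x k then x k - a else 0) \<le> gain a b x k"
proof (induction k)
  case 0
  then show ?case by (simp add: sales_def gain_def)
next
  case (Suc k)
  then show ?case using assms
    by (auto simp: sales_def gain_def algebra_simps not_le split: if_splits)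
qed

text \<open>With finitely many sales, an asset bought late is held for ever, and then the price never exceeds
  \<open>b\<close> again.\<close>

lemma bounded_sales_imp_no_crossing:
  assumes ab: "a < b" and bd: "\<And>k. sales a b x k \<le> B"
  shows "(\<forall>\<^sub>F k in sequentially. a \<le> x k) \<or> (\<forall>\<^sub>F k in sequentially. x k \<le> b)"
proof -
  define c :: "nat \<Rightarrow> real" where "c j = of_bool (holding a b x j \<and> b < x (Suc j))" for j
  have "summable c"
    by (rule summableI_nonneg_bounded[of _ B]) (use bd in \<open>auto simp: c_def[abs_def] sales_def\<close>)
  then have "c \<longlonglongrightarrow> 0" by (rule summable_LIMSEQ_zero)
  then have "\<forall>\<^sub>F j in sequentially. c j < 1" by (rule order_tendstoD) simp
  then obtain N where N: "\<And>j. j \<ge> N \<Longrightarrow> holding a b x j \<Longrightarrow> x (Suc j) \<le> b"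
    unfolding eventually_sequentially c_def by force
  show ?thesis
  proof (rule disjCI)
    assume "\<not> (\<forall>\<^sub>F k in sequentially. x k \<le> b)"
    show "\<forall>\<^sub>F k in sequentially. a \<le> x k"
    proof (rule ccontr)
      assume "\<not> ?thesis"
      then obtain k where k: "k \<ge> N" "x k < a"
        unfolding eventually_sequentially by (meson not_le)
      have h: "holding a b x k" using k ab by (cases k) auto
      have "holding a b x j" if "j \<ge> k" for j
        using that
      proof (induction rule: dec_induct)
        case base then show ?case by (rule h)
      next
        case (step m)
        then show ?case using N[of m] k by simp
      qed
      then have "x (Suc j) \<le> b" if "j \<ge> k" for j using N k that by force
      then have "\<forall>\<^sub>F k in sequentially. x k \<le> b"
        unfolding eventually_sequentially by (metis Suc_le_D Suc_le_mono)
      then show False using \<open>\<not> (\<forall>\<^sub>F k in sequentially. x k \<le> b)\<close> by contradiction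
    qed
  qed
qed

text \<open>If the lower and upper limits differed, two rationals would fit strictly between them. They are
  compared in \<^typ>\<open>ennreal\<close>, where both always exist.\<close>

lemma no_crossings_imp_convergent:
  fixes x :: "nat \<Rightarrow> real"
  assumes nn: "\<And>k. 0 \<le> x k"
    and nc: "\<And>a b. 0 < a \<Longrightarrow> a < b \<Longrightarrow>
       (\<forall>\<^sub>F k in sequentially. real_of_rat a \<le> x k) \<or> (\<forall>\<^sub>F k in sequentially. x k \<le> real_of_rat b)"
    and fin: "liminf (\<lambda>k. ennreal (x k)) \<noteq> \<infinity>"
  shows "convergent x"
proof -
  define l u where "l = liminf (\<lambda>k. ennreal (x k))" and "u = limsup (\<lambda>k. ennreal (x k))"
  have "l \<le> u" unfolding l_def u_def by (rule Liminf_le_Limsup) simp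
  have "u \<le> l"
  proof (rule ccontr)
    assume "\<not> u \<le> l"
    then have "l < u" by simp
    then obtain a where a: "l < ennreal (real_of_rat a)" "ennreal (real_of_rat a) < u"
      using ennreal_rat_dense by blast
    then obtain b where b: "ennreal (real_of_rat a) < ennreal (real_of_rat b)" "ennreal (real_of_rat b) < u"
      using ennreal_rat_dense by blast
    have a0: "0 < real_of_rat a" using a(1) by (metis ennreal_eq_0_iff not_gr_zero not_le zero_le)
    have "real_of_rat a < real_of_rat b" using b(1) a0
      by (metis ennreal_leI not_le)
    then have ab: "0 < a" "a < b" using a0 by (simp_all add: of_rat_less)
    from nc[OF ab] show False
    proof
      assume "\<forall>\<^sub>F k in sequentially. real_of_rat a \<le> x k"
      then have "\<forall>\<^sub>F k in sequentially. ennreal (real_of_rat a) \<le> ennreal (x k)"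
        by (rule eventually_mono) (rule ennreal_leI)
      then have "ennreal (real_of_rat a) \<le> l" unfolding l_def by (rule Liminf_bounded)
      then show False using a by simp
    next
      assume "\<forall>\<^sub>F k in sequentially. x k \<le> real_of_rat b"
      then have "\<forall>\<^sub>F k in sequentially. ennreal (x k) \<le> ennreal (real_of_rat b)"
        by (rule eventually_mono) (rule ennreal_leI)
      then have "u \<le> ennreal (real_of_rat b)" unfolding u_def by (rule Limsup_bounded)
      then show False using b by simp
    qed
  qed
  with \<open>l \<le> u\<close> have eq: "l = u" by simp
  have lim: "(\<lambda>k. ennreal (x k)) \<longlonglongrightarrow> l"
    using tendsto_Liminf[of sequentially "\<lambda>k. ennreal (x k)"] eq by (simp add: l_def u_def)
  have "l \<noteq> top" using fin by (simp add: l_def)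
  then obtain r where r: "r \<ge> 0" "l = ennreal r" by (cases l) auto
  have "x \<longlonglongrightarrow> r"
    using lim r nn by (auto dest: tendsto_ennrealD)
  then show ?thesis by (auto simp: convergent_def)
qed

text \<open>Doob's convergence theorem. Only the integral form of the supermartingale inequality, over events
  of the filtration, enters: it is applied to the event that the trader holds the asset. Since \<open>X \<ge>
  0\<close>, the gain exceeds \<open>(b - a)\<close> times the number of sales up to an error
  \<open>a\<close>, so the expected number of sales is bounded uniformly in time. Fatou's lemma excludes
  convergence to infinity.\<close>

lemma nonneg_supermartingale_convergent:
  fixes X :: "nat \<Rightarrow> 'w \<Rightarrow> real"
  assumes P: "prob_space P"
    and sub: "\<And>k. subalgebra P (F k)" and mono: "\<And>k. sets (F k) \<subseteq> sets (F (Suc k))"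
    and meas: "\<And>k. X k \<in> borel_measurable (F k)"
    and nn: "\<And>k \<omega>. \<omega> \<in> space P \<Longrightarrow> 0 \<le> X k \<omega>"
    and int: "\<And>k. integrable P (X k)"
    and super: "\<And>k A. A \<in> sets (F k) \<Longrightarrow>
        (\<integral>\<omega>. indicator A \<omega> * X (Suc k) \<omega> \<partial>P) \<le> (\<integral>\<omega>. indicator A \<omega> * X k \<omega> \<partial>P)"
  shows "AE \<omega> in P. convergent (\<lambda>k. X k \<omega>)"
proof -
  interpret prob_space P by (rule P)
  have spF: "space (F k) = space P" for k using sub[of k] by (simp add: subalgebra_def)
  have setsFP: "sets (F k) \<subseteq> sets P" for k using sub[of k] by (simp add: subalgebra_def)
  have measP[measurable]: "X k \<in> borel_measurable P" for k
    by (rule measurable_from_subalg[OF sub meas])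
  have Xle: "{\<omega>\<in>space P. X k \<omega> \<le> c} \<in> sets (F k)" "{\<omega>\<in>space P. X k \<omega> < c} \<in> sets (F k)" for k c
    using meas[of k] spF[of k] by (simp_all flip: spF[of k])
  have hold: "{\<omega>\<in>space P. holding a b (\<lambda>k. X k \<omega>) k} \<in> sets (F k)" for a b k
  proof (induction k)
    case 0 then show ?case using Xle(2) by simp
  next
    case (Suc k)
    let ?H = "{\<omega>\<in>space P. holding a b (\<lambda>k. X k \<omega>) k}"
    have H: "?H \<in> sets (F (Suc k))" using Suc mono by blast
    have sp: "space P \<in> sets (F (Suc k))" by (metis spF sets.top)
    have "{\<omega>\<in>space P. holding a b (\<lambda>k. X k \<omega>) (Suc k)} =
        (?H \<inter> {\<omega>\<in>space P. X (Suc k) \<omega> \<le> b}) \<union> ((space P - ?H) \<inter> {\<omega>\<in>space P. X (Suc k) \<omega> < a})"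
      by auto
    also have "\<dots> \<in> sets (F (Suc k))"
      using H sp Xle by (intro sets.Un sets.Int sets.Diff)
    finally show ?case .
  qed
  have holdP[measurable]: "Measurable.pred P (\<lambda>\<omega>. holding a b (\<lambda>k. X k \<omega>) k)" for a b k
    using hold[of a b k] setsFP[of k] unfolding pred_def by blast
  have gain_int: "integrable P (\<lambda>\<omega>. gain a b (\<lambda>k. X k \<omega>) k)"
    and gain_le: "(\<integral>\<omega>. gain a b (\<lambda>k. X k \<omega>) k \<partial>P) \<le> 0" for a b k
  proof -
    let ?h = "\<lambda>j \<omega>. of_bool (holding a b (\<lambda>k. X k \<omega>) j) :: real"
    have i: "integrable P (\<lambda>\<omega>. ?h j \<omega> * X i \<omega>)" for i j
      by (rule Bochner_Integration.integrable_bound[OF int[of i]]) auto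
    have i2: "integrable P (\<lambda>\<omega>. ?h j \<omega> * (X (Suc j) \<omega> - X j \<omega>))" for j
      using i by (simp add: right_diff_distrib)
    then show "integrable P (\<lambda>\<omega>. gain a b (\<lambda>k. X k \<omega>) k)"
      unfolding gain_def by (intro Bochner_Integration.integrable_sum)
    have "(\<integral>\<omega>. ?h j \<omega> * (X (Suc j) \<omega> - X j \<omega>) \<partial>P) \<le> 0" for j
    proof -
      let ?H = "{\<omega>\<in>space P. holding a b (\<lambda>k. X k \<omega>) j}"
      have eq: "(\<integral>\<omega>. ?h j \<omega> * X i \<omega> \<partial>P) = (\<integral>\<omega>. indicator ?H \<omega> * X i \<omega> \<partial>P)" for i
        by (rule Bochner_Integration.integral_cong) (auto simp: indicator_def)
      have "(\<integral>\<omega>. ?h j \<omega> * (X (Suc j) \<omega> - X j \<omega>) \<partial>P) =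
         (\<integral>\<omega>. ?h j \<omega> * X (Suc j) \<omega> \<partial>P) - (\<integral>\<omega>. ?h j \<omega> * X j \<omega> \<partial>P)"
        using i by (simp add: right_diff_distrib)
      also have "\<dots> \<le> 0" using super[OF hold, of a b j] by (simp add: eq)
      finally show ?thesis .
    qed
    then show "(\<integral>\<omega>. gain a b (\<lambda>k. X k \<omega>) k \<partial>P) \<le> 0"
      unfolding gain_def Bochner_Integration.integral_sum[OF i2] by (intro sum_nonpos)
  qed
  have cross: "AE \<omega> in P. (\<forall>\<^sub>F k in sequentially. a \<le> X k \<omega>) \<or> (\<forall>\<^sub>F k in sequentially. X k \<omega> \<le> b)"
    if ab: "0 < a" "a < b" for a b
  proof -
    let ?s = "\<lambda>k \<omega>. sales a b (\<lambda>k. X k \<omega>) k"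
    have s0: "0 \<le> ?s k \<omega>" for k \<omega> by (simp add: sales_def sum_nonneg)
    have smeas[measurable]: "?s k \<in> borel_measurable P" for k unfolding sales_def by measurable
    have sle: "?s k \<omega> \<le> (gain a b (\<lambda>k. X k \<omega>) k + a) / (b - a)" if "\<omega> \<in> space P" for k \<omega>
    proof -
      have "(b - a) * ?s k \<omega> \<le> gain a b (\<lambda>k. X k \<omega>) k + a"
        using gain_ge_sales[OF ab(2), of "\<lambda>k. X k \<omega>" k] nn[OF that, of k] ab(1)
        by (auto split: if_splits)
      then show ?thesis using ab by (simp add: pos_le_divide_eq mult.commute)
    qed
    have bnd: "(\<integral>\<^sup>+\<omega>. ennreal (?s k \<omega>) \<partial>P) \<le> ennreal (a / (b - a))" for k
    proof -
      have gi: "integrable P (\<lambda>\<omega>. (gain a b (\<lambda>k. X k \<omega>) k + a) / (b - a))"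
        using gain_int by simp
      have si: "integrable P (?s k)"
      proof (rule Bochner_Integration.integrable_bound[OF gi], measurable, intro AE_I2)
        fix \<omega> assume "\<omega> \<in> space P"
        then have "?s k \<omega> \<le> (gain a b (\<lambda>k. X k \<omega>) k + a) / (b - a)" by (rule sle)
        moreover have "0 \<le> ?s k \<omega>" by (rule s0)
        ultimately show "norm (?s k \<omega>) \<le> norm ((gain a b (\<lambda>k. X k \<omega>) k + a) / (b - a))"
          unfolding real_norm_def by linarith
      qed
      have "(\<integral>\<^sup>+\<omega>. ennreal (?s k \<omega>) \<partial>P) = ennreal (\<integral>\<omega>. ?s k \<omega> \<partial>P)"
        by (rule nn_integral_eq_integral[OF si]) (simp add: s0)
      also have "(\<integral>\<omega>. ?s k \<omega> \<partial>P) \<le> (\<integral>\<omega>. (gain a b (\<lambda>k. X k \<omega>) k + a) / (b - a) \<partial>P)"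
        by (rule integral_mono[OF si gi]) (rule sle)
      also have "\<dots> = ((\<integral>\<omega>. gain a b (\<lambda>k. X k \<omega>) k \<partial>P) + a) / (b - a)"
        using gain_int by (simp add: prob_space)
      also have "\<dots> \<le> a / (b - a)"
        using gain_le[of a b k] ab by (simp add: divide_right_mono)
      finally show ?thesis by (simp add: ennreal_leI)
    qed
    have inc: "incseq (\<lambda>k \<omega>. ennreal (?s k \<omega>))"
      unfolding sales_def by (intro monoI le_funI ennreal_leI sum_mono2) auto
    have "(\<integral>\<^sup>+\<omega>. (SUP k. ennreal (?s k \<omega>)) \<partial>P) = (SUP k. \<integral>\<^sup>+\<omega>. ennreal (?s k \<omega>) \<partial>P)"
      by (rule nn_integral_monotone_convergence_SUP[OF inc]) measurable
    also have "\<dots> \<le> ennreal (a / (b - a))" by (rule SUP_least) (rule bnd)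
    finally have "(\<integral>\<^sup>+\<omega>. (SUP k. ennreal (?s k \<omega>)) \<partial>P) \<noteq> \<infinity>"
      by (metis ennreal_neq_top infinity_ennreal_def neq_top_trans)
    then have "AE \<omega> in P. (SUP k. ennreal (?s k \<omega>)) \<noteq> \<infinity>"
      by (intro nn_integral_PInf_AE) auto
    then show ?thesis
    proof (rule AE_mp, intro AE_I2 impI)
      fix \<omega> assume "(SUP k. ennreal (?s k \<omega>)) \<noteq> \<infinity>"
      then obtain B where B: "B \<ge> 0" "(SUP k. ennreal (?s k \<omega>)) = ennreal B"
        by (cases "SUP k. ennreal (?s k \<omega>)") auto
      have "ennreal (?s k \<omega>) \<le> ennreal B" for k
        unfolding B(2)[symmetric] by (rule SUP_upper) simp
      then have "?s k \<omega> \<le> B" for k using B(1) by (simp add: ennreal_le_iff)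
      then show "(\<forall>\<^sub>F k in sequentially. a \<le> X k \<omega>) \<or> (\<forall>\<^sub>F k in sequentially. X k \<omega> \<le> b)"
        by (rule bounded_sales_imp_no_crossing[OF ab(2)])
    qed
  qed
  have all: "AE \<omega> in P. \<forall>a b. 0 < a \<longrightarrow> a < b \<longrightarrow>
      (\<forall>\<^sub>F k in sequentially. real_of_rat a \<le> X k \<omega>) \<or> (\<forall>\<^sub>F k in sequentially. X k \<omega> \<le> real_of_rat b)"
    unfolding AE_all_countable
  proof (intro allI)
    fix a b :: rat
    show "AE \<omega> in P. 0 < a \<longrightarrow> a < b \<longrightarrow>
      (\<forall>\<^sub>F k in sequentially. real_of_rat a \<le> X k \<omega>) \<or> (\<forall>\<^sub>F k in sequentially. X k \<omega> \<le> real_of_rat b)"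
    proof (cases "0 < a \<and> a < b")
      case True
      then show ?thesis using cross[of "real_of_rat a" "real_of_rat b"] by (simp add: of_rat_less)
    qed auto
  qed
  have dec: "(\<integral>\<omega>. X k \<omega> \<partial>P) \<le> (\<integral>\<omega>. X 0 \<omega> \<partial>P)" for k
  proof (induction k)
    case (Suc k)
    have "space P \<in> sets (F k)" by (metis spF sets.top)
    moreover have "(\<integral>\<omega>. indicator (space P) \<omega> * X i \<omega> \<partial>P) = (\<integral>\<omega>. X i \<omega> \<partial>P)" for i
      by (rule Bochner_Integration.integral_cong) auto
    ultimately show ?case using super[of "space P" k] Suc by simp
  qed simp
  have "AE \<omega> in P. liminf (\<lambda>k. ennreal (X k \<omega>)) \<noteq> \<infinity>"
  proof (rule nn_integral_PInf_AE)
    have e: "(\<integral>\<^sup>+\<omega>. ennreal (X k \<omega>) \<partial>P) \<le> ennreal (\<integral>\<omega>. X 0 \<omega> \<partial>P)" for k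
      using nn_integral_eq_integral[OF int, of k] nn dec[of k] by (simp add: ennreal_leI AE_I2)
    have "(\<integral>\<^sup>+\<omega>. liminf (\<lambda>k. ennreal (X k \<omega>)) \<partial>P) \<le> liminf (\<lambda>k. \<integral>\<^sup>+\<omega>. ennreal (X k \<omega>) \<partial>P)"
      by (rule nn_integral_liminf) measurable
    also have "\<dots> \<le> ennreal (\<integral>\<omega>. X 0 \<omega> \<partial>P)"
      by (rule Liminf_le) (use e in auto)
    finally show "(\<integral>\<^sup>+\<omega>. liminf (\<lambda>k. ennreal (X k \<omega>)) \<partial>P) \<noteq> \<infinity>"
      by (metis ennreal_neq_top infinity_ennreal_def neq_top_trans)
  qed measurable
  with all show ?thesis
  proof (rule AE_mp[OF AE_conjI], intro AE_I2 impI, elim conjE)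
    fix \<omega> assume "\<omega> \<in> space P" "\<forall>a b. 0 < a \<longrightarrow> a < b \<longrightarrow>
      (\<forall>\<^sub>F k in sequentially. real_of_rat a \<le> X k \<omega>) \<or> (\<forall>\<^sub>F k in sequentially. X k \<omega> \<le> real_of_rat b)"
      "liminf (\<lambda>k. ennreal (X k \<omega>)) \<noteq> \<infinity>"
    then show "convergent (\<lambda>k. X k \<omega>)"
      by (intro no_crossings_imp_convergent) (auto simp: nn)
  qed
qed

section \<open>Sums over sliding windows and almost surely summable series\<close>

lemma tendsto_window_sum:
  fixes a :: "nat \<Rightarrow> real"
  assumes nn: "\<And>d. 0 \<le> a d" and lim: "a \<longlonglongrightarrow> 0"
  shows "(\<lambda>k. \<Sum>d\<in>{k - \<tau>..<k}. a d) \<longlonglongrightarrow> 0"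
proof (rule tendsto_sandwich[OF _ _ tendsto_const])
  show "\<forall>\<^sub>F k in sequentially. 0 \<le> (\<Sum>d\<in>{k - \<tau>..<k}. a d)"
    by (intro always_eventually allI sum_nonneg nn)
  show "\<forall>\<^sub>F k in sequentially. (\<Sum>d\<in>{k - \<tau>..<k}. a d) \<le> (\<Sum>j<\<tau>. a (k - Suc j))"
  proof (intro always_eventually allI)
    fix k
    have "(\<Sum>d\<in>{k - \<tau>..<k}. a d) \<le> (\<Sum>d\<in>(\<lambda>j. k - Suc j) ` {..<\<tau>}. a d)"
    proof (rule sum_mono2)
      show "{k - \<tau>..<k} \<subseteq> (\<lambda>j. k - Suc j) ` {..<\<tau>}"
      proof
        fix d assume "d \<in> {k - \<tau>..<k}"
        then show "d \<in> (\<lambda>j. k - Suc j) ` {..<\<tau>}" by (intro image_eqI[of _ _ "k - Suc d"]) auto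
      qed
    qed (auto intro: nn)
    also have "\<dots> \<le> (\<Sum>j<\<tau>. a (k - Suc j))"
      using sum_image_le[of "{..<\<tau>}" a "\<lambda>j. k - Suc j"] nn by (simp add: o_def)
    finally show "(\<Sum>d\<in>{k - \<tau>..<k}. a d) \<le> (\<Sum>j<\<tau>. a (k - Suc j))" .
  qed
  show "(\<lambda>k. \<Sum>j<\<tau>. a (k - Suc j)) \<longlonglongrightarrow> 0"
  proof (rule tendsto_null_sum)
    fix j
    have "filterlim (\<lambda>k. k - Suc j) sequentially sequentially"
      by (rule filterlim_minus_const_nat_at_top)
    then show "(\<lambda>k. a (k - Suc j)) \<longlonglongrightarrow> 0" by (rule filterlim_compose[OF lim])
  qed
qed

lemma AE_summable_of_bounded_expectations:
  fixes f :: "nat \<Rightarrow> 'w \<Rightarrow> real"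
  assumes int: "\<And>k. integrable P (f k)" and nn: "\<And>k \<omega>. 0 \<le> f k \<omega>"
    and bd: "\<And>n. (\<Sum>k<n. \<integral>\<omega>. f k \<omega> \<partial>P) \<le> B"
  shows "AE \<omega> in P. summable (\<lambda>k. f k \<omega>)"
proof -
  have [measurable]: "f k \<in> borel_measurable P" for k using int by auto
  have i0: "0 \<le> (\<integral>\<omega>. f k \<omega> \<partial>P)" for k using nn by simp
  have sm: "summable (\<lambda>k. \<integral>\<omega>. f k \<omega> \<partial>P)"
    by (rule summableI_nonneg_bounded[of _ B]) (use i0 bd in auto)
  have "(\<integral>\<^sup>+\<omega>. (\<Sum>k. ennreal (f k \<omega>)) \<partial>P) = (\<Sum>k. \<integral>\<^sup>+\<omega>. ennreal (f k \<omega>) \<partial>P)"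
    by (rule nn_integral_suminf) simp
  also have "\<dots> = (\<Sum>k. ennreal (\<integral>\<omega>. f k \<omega> \<partial>P))"
    by (intro suminf_cong nn_integral_eq_integral int) (simp add: nn)
  also have "\<dots> = ennreal (\<Sum>k. \<integral>\<omega>. f k \<omega> \<partial>P)"
    by (rule suminf_ennreal2[OF i0 sm])
  finally have "(\<integral>\<^sup>+\<omega>. (\<Sum>k. ennreal (f k \<omega>)) \<partial>P) \<noteq> \<infinity>" by simp
  then have "AE \<omega> in P. (\<Sum>k. ennreal (f k \<omega>)) \<noteq> \<infinity>"
    by (intro nn_integral_PInf_AE) auto
  then show ?thesis
    by (rule AE_mp) (auto intro!: AE_I2 summable_suminf_not_top nn)
qed

section \<open>Equivalent inner products and Opial's argument\<close>

text \<open>An inner product \<open>ip\<close> that is equivalent to the ambient one, with constants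
  \<open>lo\<close> and \<open>up\<close>. In the application it is the one induced by \<open>M\<close>, and
  \<open>up / lo\<close> is its condition number. The ambient inner product stays relevant because masking
  rows is in general nonexpansive only for the latter.\<close>

locale equivalent_inner =
  fixes ip :: "'a::euclidean_space \<Rightarrow> 'a \<Rightarrow> real" and lo up :: real
  assumes ip_bilinear: "bilinear ip" and ip_sym: "ip x y = ip y x"
    and lo_pos: "0 < lo" and lo_le_up: "lo \<le> up"
    and ip_lower: "lo * (x \<bullet> x) \<le> ip x x" and ip_upper: "ip x x \<le> up * (x \<bullet> x)"
begin

abbreviation N :: "'a \<Rightarrow> real" where "N x \<equiv> ip x x"

lemma up_pos: "0 < up" using lo_pos lo_le_up by simp

lemmas ip_simps = bilinear_ladd[OF ip_bilinear] bilinear_radd[OF ip_bilinear]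
  bilinear_lsub[OF ip_bilinear] bilinear_rsub[OF ip_bilinear]
  bilinear_lmul[OF ip_bilinear] bilinear_rmul[OF ip_bilinear]

lemma N_nonneg: "0 \<le> N x"
  by (rule order_trans[OF _ ip_lower]) (use lo_pos in simp)

lemma ip_sum_right: "ip x (\<Sum>i\<in>I. f i) = (\<Sum>i\<in>I. ip x (f i))"
  using ip_bilinear linear_sum[of "ip x" f I] unfolding bilinear_def by blast

lemma ip_sum_left: "ip (\<Sum>i\<in>I. f i) x = (\<Sum>i\<in>I. ip (f i) x)"
  using ip_bilinear linear_sum[of "\<lambda>y. ip y x" f I] unfolding bilinear_def by blast

lemma N_diff: "N (x - y) = N x - 2 * ip x y + N y"
  by (simp add: ip_simps ip_sym[of y x])

lemma young: assumes "b > 0" shows "2 * ip x y \<le> b * N x + N y / b"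
proof -
  have "0 \<le> N (b *\<^sub>R x - y)" by (rule N_nonneg)
  also have "\<dots> = b * (b * N x) - b * (2 * ip x y) + N y"
    by (simp add: ip_simps ip_sym[of y x] algebra_simps)
  finally have "b * (2 * ip x y) \<le> b * (b * N x + N y / b)" using assms by (simp add: algebra_simps)
  then show ?thesis using assms by (simp add: mult_le_cancel_left_pos)
qed

lemma N_triangle: "N (x + y) \<le> 2 * N x + 2 * N y"
  using N_nonneg[of "x - y"] by (simp add: ip_simps ip_sym[of y x])

lemma continuous_on_N: "continuous_on A N"
proof -
  have "bounded_bilinear ip" using ip_bilinear by (simp add: bilinear_conv_bounded_bilinear)
  then show ?thesis
    by (rule bounded_bilinear.continuous_on[OF _ continuous_on_id continuous_on_id])
qed

lemma tendsto_of_N: assumes "((\<lambda>k. N (z k - y)) \<longlongrightarrow> 0) G" shows "(z \<longlongrightarrow> y) G"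
proof -
  have "((\<lambda>k. N (z k - y) / lo) \<longlongrightarrow> 0) G" using tendsto_divide[OF assms tendsto_const[of lo]] lo_pos by simp
  then have "((\<lambda>k. sqrt (N (z k - y) / lo)) \<longlongrightarrow> 0) G"
    using tendsto_real_sqrt by fastforce
  moreover have "\<forall>\<^sub>F k in G. norm (z k - y) \<le> sqrt (N (z k - y) / lo)"
  proof (intro always_eventually allI)
    fix k show "norm (z k - y) \<le> sqrt (N (z k - y) / lo)"
    using ip_lower[of "z k - y"] lo_pos
    by (intro real_le_rsqrt) (simp add: pos_le_divide_eq power2_norm_eq_inner mult.commute)
  qed
  ultimately have "((\<lambda>k. z k - y) \<longlongrightarrow> 0) G"
    by (rule Lim_null_comparison[rotated])
  then show ?thesis by (simp add: LIM_zero_iff)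
qed

text \<open>The points \<open>z k\<close> have a cluster point \<open>y\<close>, and \<open>S y = 0\<close> as
  the residuals vanish. The distances to points of \<open>D\<close> near \<open>y\<close> converge, and along
  the subsequence their limits are small; hence they are eventually small along the whole sequence. It
  suffices to know the convergence of distances on a dense set \<open>D\<close>, which may be countable, so
  that almost sure statements for single points can be combined.\<close>

lemma opial:
  fixes z zh :: "nat \<Rightarrow> 'a"
  assumes contS: "continuous_on UNIV S"
    and diff: "(\<lambda>k. zh k - z k) \<longlonglongrightarrow> 0" and res: "(\<lambda>k. S (zh k)) \<longlonglongrightarrow> (0::'b::real_normed_vector)"
    and D: "D \<subseteq> {x. S x = 0}" "{x. S x = 0} \<subseteq> closure D" "D \<noteq> {}"
    and conv: "\<And>x. x \<in> D \<Longrightarrow> convergent (\<lambda>k. N (z k - x))"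
  shows "\<exists>y. S y = 0 \<and> z \<longlonglongrightarrow> y"
proof -
  obtain x0 where x0: "x0 \<in> D" using D by blast
  have "Bseq (\<lambda>k. N (z k - x0))" using conv[OF x0] by (rule convergent_imp_Bseq)
  then obtain K where K: "K > 0" "\<And>k. norm (N (z k - x0)) \<le> K" by (auto elim: BseqE)
  have "bounded (range z)"
  proof (rule boundedI)
    fix y assume "y \<in> range z"
    then obtain k where y: "y = z k" by blast
    have "lo * (norm (z k - x0))\<^sup>2 \<le> K"
      using ip_lower[of "z k - x0"] K(2)[of k] by (simp add: power2_norm_eq_inner)
    then have "(norm (z k - x0))\<^sup>2 \<le> K / lo" using lo_pos by (simp add: pos_le_divide_eq mult.commute)
    then have "norm (z k - x0) \<le> sqrt (K / lo)" by (rule real_le_rsqrt)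
    moreover have "norm (z k) \<le> norm x0 + norm (z k - x0)" by (rule norm_triangle_sub)
    ultimately show "norm y \<le> norm x0 + sqrt (K / lo)" using y by simp
  qed
  then obtain y r where r: "strict_mono r" "(z \<circ> r) \<longlonglongrightarrow> y"
    using bounded_imp_convergent_subsequence by blast
  have "(\<lambda>k. z (r k) + (zh (r k) - z (r k))) \<longlonglongrightarrow> y + 0"
    using r LIMSEQ_subseq_LIMSEQ[OF diff r(1)] by (intro tendsto_add) (simp_all add: o_def)
  then have "(\<lambda>k. zh (r k)) \<longlonglongrightarrow> y" by simp
  then have "(\<lambda>k. S (zh (r k))) \<longlonglongrightarrow> S y"
    by (rule continuous_on_tendsto_compose[OF contS]) auto
  moreover have "(\<lambda>k. S (zh (r k))) \<longlonglongrightarrow> 0"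
    using LIMSEQ_subseq_LIMSEQ[OF res r(1)] by (simp add: o_def)
  ultimately have Sy: "S y = 0" by (rule LIMSEQ_unique)
  have "(\<lambda>k. N (z k - y)) \<longlonglongrightarrow> 0"
  proof (rule tendstoI)
    fix \<epsilon> :: real assume "\<epsilon> > 0"
    define \<delta> where "\<delta> = \<epsilon> / 4"
    have d0: "\<delta> > 0" using \<open>\<epsilon> > 0\<close> by (simp add: \<delta>_def)
    have "y \<in> closure D" using Sy D by blast
    moreover have "0 < sqrt (\<delta> / up)" using d0 up_pos by simp
    ultimately obtain x where x: "x \<in> D" "dist x y < sqrt (\<delta> / up)" unfolding closure_approachable by blast
    have "(norm (y - x))\<^sup>2 < \<delta> / up"
    proof -
      have "(norm (y - x))\<^sup>2 < (sqrt (\<delta> / up))\<^sup>2"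
        using x(2) by (intro power_strict_mono) (auto simp: dist_norm norm_minus_commute)
      then show ?thesis using d0 up_pos by simp
    qed
    then have "up * (norm (y - x))\<^sup>2 < \<delta>" using up_pos by (simp add: pos_less_divide_eq mult.commute)
    then have Nyx: "N (y - x) < \<delta>" using ip_upper[of "y - x"] by (simp add: power2_norm_eq_inner)
    obtain l where l: "(\<lambda>k. N (z k - x)) \<longlonglongrightarrow> l" using conv[OF x(1)] by (auto simp: convergent_def)
    have "(\<lambda>k. N (z (r k) - x)) \<longlonglongrightarrow> l" using LIMSEQ_subseq_LIMSEQ[OF l r(1)] by (simp add: o_def)
    moreover have "(\<lambda>k. N (z (r k) - x)) \<longlonglongrightarrow> N (y - x)"
    proof -
      have "(\<lambda>k. z (r k) - x) \<longlonglongrightarrow> y - x" using r by (intro tendsto_intros) (simp add: o_def)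
      then show ?thesis
        using continuous_on_tendsto_compose[OF continuous_on_N[of UNIV], of _ "y - x"] by simp
    qed
    ultimately have "l = N (y - x)" by (rule LIMSEQ_unique)
    then have "\<forall>\<^sub>F k in sequentially. N (z k - x) < \<delta>" using l Nyx by (auto dest: order_tendstoD)
    then show "\<forall>\<^sub>F k in sequentially. dist (N (z k - y)) 0 < \<epsilon>"
    proof (rule eventually_mono)
      fix k assume "N (z k - x) < \<delta>"
      moreover have "N (z k - y) \<le> 2 * N (z k - x) + 2 * N (x - y)"
        using N_triangle[of "z k - x" "x - y"] by simp
      moreover have "N (x - y) = N (y - x)" by (simp add: ip_simps)
      ultimately have "N (z k - y) < \<epsilon>" using Nyx by (simp add: \<delta>_def)
      then show "dist (N (z k - y)) 0 < \<epsilon>" using N_nonneg[of "z k - y"] by simp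
    qed
  qed
  then have "z \<longlonglongrightarrow> y" by (rule tendsto_of_N)
  with Sy show ?thesis by blast
qed

end

text \<open>Cocoercivity and Young's inequality give \<open>\<parallel>S x - S y\<parallel>\<^sup>2 \<le> 4
  \<parallel>x - y\<parallel>\<^sup>2\<close> in the norm of \<open>ip\<close>.\<close>

lemma (in equivalent_inner) cocoercive_continuous:
  fixes S :: "'a \<Rightarrow> 'a"
  assumes coc: "\<And>x y. N (S x - S y) / 2 \<le> ip (S x - S y) (x - y)"
  shows "continuous_on UNIV S"
proof (rule lipschitz_on_continuous_on)
  show "(sqrt (4 * up / lo))-lipschitz_on UNIV S"
  proof (rule lipschitz_onI)
    fix x y
    define g d where "g = S x - S y" and "d = x - y"
    have "N g / 2 \<le> ip g d" unfolding g_def d_def by (rule coc)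
    moreover have "2 * ip g d \<le> 1 / 2 * N g + N d / (1 / 2)" by (rule young) simp
    ultimately have "N g \<le> 4 * N d" by simp
    then have "lo * (g \<bullet> g) \<le> 4 * (up * (d \<bullet> d))" using ip_lower[of g] ip_upper[of d] by linarith
    then have "(norm g)\<^sup>2 \<le> 4 * up / lo * (norm d)\<^sup>2"
      using lo_pos by (simp add: power2_norm_eq_inner pos_le_divide_eq mult_ac)
    then have "norm g \<le> sqrt (4 * up / lo * (norm d)\<^sup>2)" by (rule real_le_rsqrt)
    also have "\<dots> = sqrt (4 * up / lo) * norm d"
      by (simp only: real_sqrt_mult[of "4 * up / lo"] real_sqrt_abs abs_norm_cancel)
    finally show "dist (S x) (S y) \<le> sqrt (4 * up / lo) * dist x y"
      by (simp add: dist_norm g_def d_def)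
  qed (use up_pos lo_pos in simp)
qed

section \<open>Asynchronous iterations of a cocoercive residual\<close>

text \<open>With a bounded start, continuous residuals, finitely many agents and bounded delays, every random
  variable below is bounded, which settles all questions of integrability.\<close>

definition bounded_rv :: "'w measure \<Rightarrow> ('w \<Rightarrow> 'b::real_normed_vector) \<Rightarrow> bool" where
  "bounded_rv P f \<longleftrightarrow> (\<exists>B. \<forall>\<omega>\<in>space P. norm (f \<omega>) \<le> B)"

lemma bounded_rvI: "(\<And>\<omega>. \<omega> \<in> space P \<Longrightarrow> norm (f \<omega>) \<le> B) \<Longrightarrow> bounded_rv P f"
  by (auto simp: bounded_rv_def)

lemma bounded_rv_const: "bounded_rv P (\<lambda>\<omega>. c)"
  by (auto simp: bounded_rv_def)

lemma bounded_rv_add: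
  assumes "bounded_rv P f" "bounded_rv P g" shows "bounded_rv P (\<lambda>\<omega>. f \<omega> + g \<omega>)"
proof -
  obtain B C where "\<And>\<omega>. \<omega> \<in> space P \<Longrightarrow> norm (f \<omega>) \<le> B" "\<And>\<omega>. \<omega> \<in> space P \<Longrightarrow> norm (g \<omega>) \<le> C"
    using assms by (auto simp: bounded_rv_def)
  then show ?thesis by (intro bounded_rvI[of _ _ "B + C"] norm_triangle_mono)
qed

lemma bounded_rv_scaleR: "bounded_rv P f \<Longrightarrow> bounded_rv P (\<lambda>\<omega>. c *\<^sub>R f \<omega>)"
  unfolding bounded_rv_def by (metis mult_left_mono abs_ge_zero norm_scaleR)

lemma bounded_rv_mult_left: "bounded_rv P f \<Longrightarrow> bounded_rv P (\<lambda>\<omega>. c * f \<omega>)" for c :: real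
  using bounded_rv_scaleR[of P f c] by simp

lemma bounded_rv_diff:
  "bounded_rv P f \<Longrightarrow> bounded_rv P g \<Longrightarrow> bounded_rv P (\<lambda>\<omega>. f \<omega> - g \<omega>)"
  using bounded_rv_add[of P f "\<lambda>\<omega>. (- 1) *\<^sub>R g \<omega>"] bounded_rv_scaleR[of P g "- 1"] by simp

lemma bounded_rv_sum:
  "(\<And>i. i \<in> I \<Longrightarrow> bounded_rv P (f i)) \<Longrightarrow> bounded_rv P (\<lambda>\<omega>. \<Sum>i\<in>I. f i \<omega>)"
  by (induction I rule: infinite_finite_induct) (auto intro: bounded_rv_const bounded_rv_add)

lemma bounded_rv_continuous:
  fixes h :: "'a::euclidean_space \<Rightarrow> 'b::real_normed_vector"
  assumes h: "continuous_on UNIV h" and f: "bounded_rv P f"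
  shows "bounded_rv P (\<lambda>\<omega>. h (f \<omega>))"
proof -
  obtain B where B: "\<And>\<omega>. \<omega> \<in> space P \<Longrightarrow> norm (f \<omega>) \<le> B" using f by (auto simp: bounded_rv_def)
  have "compact (h ` cball 0 B)"
    by (rule compact_continuous_image[OF continuous_on_subset[OF h]]) auto
  then have "bounded (h ` cball 0 B)" by (rule compact_imp_bounded)
  then obtain C where C: "\<And>y. y \<in> h ` cball 0 B \<Longrightarrow> norm y \<le> C" by (auto simp: bounded_iff)
  show ?thesis by (rule bounded_rvI[of _ _ C]) (use B C in auto)
qed

lemma (in finite_measure) integrable_bounded_rv:
  fixes f :: "'a \<Rightarrow> real"
  assumes "bounded_rv M f" "f \<in> borel_measurable M" shows "integrable M f"
  using assms unfolding bounded_rv_def by (auto intro!: integrable_const_bound AE_I2)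

text \<open>The iteration abstracted from the network: \<open>Sc i\<close> is the part of the residual
  \<open>S\<close> that agent \<open>i\<close> updates, the parts having disjoint rows (hence
  \<open>Sc_sum\<close> and \<open>Sc_orth\<close>), and \<open>\<beta> = \<eta> / n\<close>. The assumption
  \<open>ag_indep\<close> is the conditional independence of the activated agent from the past \<open>F
  k\<close>, in integrated form. By \<open>delay\<close> the delayed point differs from the current one by
  masked versions \<open>D d\<close> of the last \<open>\<tau>\<close> increments.\<close>

locale async_iteration = equivalent_inner ip lo up + prob_space P
  for ip :: "'a::euclidean_space \<Rightarrow> 'a \<Rightarrow> real" and lo up :: real and P :: "'w measure" +
  fixes S :: "'a \<Rightarrow> 'a" and Sc :: "'i::finite \<Rightarrow> 'a \<Rightarrow> 'a"
    and q :: "'i \<Rightarrow> real" and qm \<beta> :: real and \<tau> :: nat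
    and F :: "nat \<Rightarrow> 'w measure" and ag :: "nat \<Rightarrow> 'w \<Rightarrow> 'i"
    and Z Zh :: "nat \<Rightarrow> 'w \<Rightarrow> 'a"
  assumes S_cocoercive: "ip (S x - S y) (S x - S y) / 2 \<le> ip (S x - S y) (x - y)"
    and Sc_cont: "\<And>i. continuous_on UNIV (Sc i)"
    and Sc_sum: "\<And>x. (\<Sum>i\<in>UNIV. Sc i x) = S x"
    and Sc_orth: "\<And>x. (\<Sum>i\<in>UNIV. Sc i x \<bullet> Sc i x) = S x \<bullet> S x"
    and qm_pos: "0 < qm" and q_ge: "\<And>i. qm \<le> q i" and q_sum: "(\<Sum>i\<in>UNIV. q i) = 1"
    and \<beta>_pos: "0 < \<beta>"
    and \<beta>_less: "\<beta> * (2 * real \<tau> * sqrt (up / lo * qm) + up / lo) < qm"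
    and F_sub: "\<And>k. subalgebra P (F k)" and F_mono: "\<And>k. sets (F k) \<subseteq> sets (F (Suc k))"
    and Z_adapted: "\<And>l k. l \<le> k \<Longrightarrow> Z l \<in> borel_measurable (F k)"
    and Zh_adapted: "\<And>k. Zh k \<in> borel_measurable (F k)"
    and ag_meas: "\<And>k. ag k \<in> measurable P (count_space UNIV)"
    and ag_indep: "\<And>k i f. f \<in> borel_measurable (F k) \<Longrightarrow> integrable P f \<Longrightarrow>
        (\<integral>\<omega>. of_bool (ag k \<omega> = i) * f \<omega> \<partial>P) = q i * (\<integral>\<omega>. f \<omega> \<partial>P)"
    and Z0_bounded: "bounded_rv P (Z 0)"
    and Z_Suc: "\<And>k \<omega>. \<omega> \<in> space P \<Longrightarrow>
        Z (Suc k) \<omega> = Z k \<omega> - (\<beta> / q (ag k \<omega>)) *\<^sub>R Sc (ag k \<omega>) (Zh k \<omega>)"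
    and delay: "\<And>k \<omega>. \<omega> \<in> space P \<Longrightarrow> \<exists>D. Zh k \<omega> = Z k \<omega> - (\<Sum>d\<in>{k - \<tau>..<k}. D d) \<and>
        (\<forall>d. norm (D d) \<le> norm (Z (Suc d) \<omega> - Z d \<omega>))"
begin

lemma S_cont: "continuous_on UNIV S"
  by (rule cocoercive_continuous[OF S_cocoercive])

lemma q_pos: "0 < q i" using qm_pos q_ge[of i] by simp

definition incr2 :: "nat \<Rightarrow> 'w \<Rightarrow> real" where
  "incr2 d \<omega> = (norm (Z (Suc d) \<omega> - Z d \<omega>))\<^sup>2"

definition window :: "nat \<Rightarrow> 'w \<Rightarrow> real" where
  "window k \<omega> = (\<Sum>d\<in>{k - \<tau>..<k}. incr2 d \<omega>)"

text \<open>The increment of step \<open>d\<close> enters with weight \<open>\<tau>\<close> right after it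
  occurs and loses \<open>1\<close> in each later step, so that one step of time releases exactly
  \<open>window\<close>. Truncated subtraction makes the weight zero once the increment has left the
  window.\<close>

definition memory :: "nat \<Rightarrow> 'w \<Rightarrow> real" where
  "memory k \<omega> = (\<Sum>d<k. real (d + \<tau> + 1 - k) * incr2 d \<omega>)"

text \<open>The parameter of Young's inequality for the delay term. This value minimises \<open>young_wt +
  \<beta>\<^sup>2 (up / lo) / (qm young_wt)\<close>, the price of one delayed increment, and makes both
  summands equal.\<close>

definition young_wt :: real where "young_wt = \<beta> * sqrt (up / lo / qm)"

text \<open>The factor of the squared increments in the bound of the delay term; with this weight the release
  of \<open>memory\<close> cancels them.\<close>

definition mem_wt :: real where "mem_wt = \<beta> * up / young_wt"

text \<open>The constant in the expected decrease; its positivity is the condition on the step size.\<close>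

definition rate :: real where
  "rate = \<beta> * (1 - \<beta> * (2 * real \<tau> * sqrt (up / lo * qm) + up / lo) / qm)"

definition \<Phi> :: "'a \<Rightarrow> nat \<Rightarrow> 'w \<Rightarrow> real" where
  "\<Phi> x k \<omega> = N (Z k \<omega> - x) + mem_wt * memory k \<omega>"

text \<open>The value of \<open>\<Phi> x (k + 1)\<close> in case agent \<open>i\<close> is activated at step
  \<open>k\<close>. For fixed \<open>i\<close> it is known at time \<open>k\<close>.\<close>

definition \<Phi>_after :: "'a \<Rightarrow> 'i \<Rightarrow> nat \<Rightarrow> 'w \<Rightarrow> real" where
  "\<Phi>_after x i k \<omega> = N (Z k \<omega> - (\<beta> / q i) *\<^sub>R Sc i (Zh k \<omega>) - x) +
     mem_wt * (real \<tau> * (norm ((\<beta> / q i) *\<^sub>R Sc i (Zh k \<omega>)))\<^sup>2 + memory k \<omega> - window k \<omega>)"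

lemma young_wt_pos: "0 < young_wt" using \<beta>_pos up_pos lo_pos qm_pos by (simp add: young_wt_def)
lemma mem_wt_pos: "0 < mem_wt" using \<beta>_pos up_pos young_wt_pos by (simp add: mem_wt_def)
lemma rate_pos: "0 < rate"
  using \<beta>_pos \<beta>_less qm_pos by (simp add: rate_def)

lemma incr2_nonneg: "0 \<le> incr2 d \<omega>" by (simp add: incr2_def)

lemma memory_Suc: "memory (Suc k) \<omega> = real \<tau> * incr2 k \<omega> + memory k \<omega> - window k \<omega>"
proof -
  have "(\<Sum>d<k. real (d + \<tau> + 1 - Suc k) * incr2 d \<omega>) =
      (\<Sum>d<k. real (d + \<tau> + 1 - k) * incr2 d \<omega> - (if k - \<tau> \<le> d then incr2 d \<omega> else 0))"
  proof (rule sum.cong[OF refl])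
    fix d assume "d \<in> {..<k}"
    show "real (d + \<tau> + 1 - Suc k) * incr2 d \<omega> =
       real (d + \<tau> + 1 - k) * incr2 d \<omega> - (if k - \<tau> \<le> d then incr2 d \<omega> else 0)"
    proof (cases "k - \<tau> \<le> d")
      case True
      then have "d + \<tau> + 1 - k = Suc (d + \<tau> + 1 - Suc k)" by simp
      then show ?thesis using True by (simp add: algebra_simps)
    next
      case False
      then have "d + \<tau> + 1 - k = 0" "d + \<tau> + 1 - Suc k = 0" by simp_all
      then show ?thesis using False by simp
    qed
  qed
  also have "\<dots> = memory k \<omega> - window k \<omega>"
  proof -
    have "(\<Sum>d<k. if k - \<tau> \<le> d then incr2 d \<omega> else 0) = window k \<omega>"
      unfolding window_def by (subst sum.inter_filter[symmetric]) (auto intro: sum.cong)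
    then show ?thesis by (simp add: sum_subtractf memory_def)
  qed
  finally show ?thesis by (simp add: memory_def)
qed

lemma memory_nonneg: "0 \<le> memory k \<omega>"
  unfolding memory_def by (intro sum_nonneg mult_nonneg_nonneg incr2_nonneg) simp

lemma memory_le: "memory k \<omega> \<le> real \<tau> * window k \<omega>"
proof -
  have "memory k \<omega> = (\<Sum>d\<in>{k - \<tau>..<k}. real (d + \<tau> + 1 - k) * incr2 d \<omega>)"
    unfolding memory_def by (rule sum.mono_neutral_right) auto
  also have "\<dots> \<le> (\<Sum>d\<in>{k - \<tau>..<k}. real \<tau> * incr2 d \<omega>)"
    by (intro sum_mono mult_right_mono incr2_nonneg) auto
  finally show ?thesis by (simp add: window_def sum_distrib_left)
qed

lemma \<Phi>_Suc:
  assumes "\<omega> \<in> space P" shows "\<Phi> x (Suc k) \<omega> = \<Phi>_after x (ag k \<omega>) k \<omega>"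
  using Z_Suc[OF assms, of k] by (simp add: \<Phi>_def \<Phi>_after_def memory_Suc incr2_def)

text \<open>The left side is the conditional expectation of \<open>\<Phi> x (k + 1)\<close> given the past.
  Weighting by \<open>q i\<close> cancels the factors \<open>1 / q i\<close> of the steps, so the linear term
  becomes \<open>-2 \<beta> \<langle>S (Zh k), Z k - x\<rangle>\<close>; \<open>delayed_ip\<close> bounds it
  by cocoercivity at the delayed point and Young's inequality. The quadratic terms are measured in the ambient
  norm, where the parts of \<open>S\<close> are orthogonal, and only then compared with \<open>ip\<close>.
  This order keeps the loss at one factor \<open>up / lo\<close>.\<close>

lemma descent:
  assumes \<omega>: "\<omega> \<in> space P" and x: "S x = 0"
  shows "(\<Sum>i\<in>UNIV. q i * \<Phi>_after x i k \<omega>) \<le> \<Phi> x k \<omega> - rate * N (S (Zh k \<omega>))"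
proof -
  define z zh g where "z = Z k \<omega>" and "zh = Zh k \<omega>" and "g = S zh"
  obtain D where D: "zh = z - (\<Sum>d\<in>{k - \<tau>..<k}. D d)" "\<And>d. norm (D d) \<le> norm (Z (Suc d) \<omega> - Z d \<omega>)"
    using delay[OF \<omega>, of k] unfolding z_def zh_def by blast
  have qinv: "1 / q i \<le> 1 / qm" for i using q_ge[of i] qm_pos by (simp add: frac_le)
  have Scsq: "(\<Sum>i\<in>UNIV. (1 / q i) * (Sc i zh \<bullet> Sc i zh)) \<le> (1 / qm) * (g \<bullet> g)"
  proof -
    have "(\<Sum>i\<in>UNIV. (1 / q i) * (Sc i zh \<bullet> Sc i zh)) \<le> (\<Sum>i\<in>UNIV. (1 / qm) * (Sc i zh \<bullet> Sc i zh))"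
      by (intro sum_mono mult_right_mono qinv) auto
    also have "\<dots> = (1 / qm) * (g \<bullet> g)" by (simp only: g_def sum_distrib_left[symmetric] Sc_orth)
    finally show ?thesis .
  qed
  have incr_exp: "(\<Sum>i\<in>UNIV. q i * (norm ((\<beta> / q i) *\<^sub>R Sc i zh))\<^sup>2) \<le> \<beta>\<^sup>2 / qm * (g \<bullet> g)"
  proof -
    have "q i * (norm ((\<beta> / q i) *\<^sub>R Sc i zh))\<^sup>2 = \<beta>\<^sup>2 * ((1 / q i) * (Sc i zh \<bullet> Sc i zh))" for i
      using q_pos[of i] unfolding power2_norm_eq_inner by (simp add: power2_eq_square)
    then have "(\<Sum>i\<in>UNIV. q i * (norm ((\<beta> / q i) *\<^sub>R Sc i zh))\<^sup>2) = \<beta>\<^sup>2 * (\<Sum>i\<in>UNIV. (1 / q i) * (Sc i zh \<bullet> Sc i zh))"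
      by (simp add: sum_distrib_left)
    also have "\<dots> \<le> \<beta>\<^sup>2 * ((1 / qm) * (g \<bullet> g))" by (intro mult_left_mono Scsq) simp
    finally show ?thesis by simp
  qed
  have dist_exp: "(\<Sum>i\<in>UNIV. q i * N (z - (\<beta> / q i) *\<^sub>R Sc i zh - x))
      \<le> N (z - x) - 2 * \<beta> * ip g (z - x) + up * (\<beta>\<^sup>2 / qm * (g \<bullet> g))"
  proof -
    have "q i * N (z - (\<beta> / q i) *\<^sub>R Sc i zh - x)
      \<le> q i * N (z - x) - 2 * \<beta> * ip (Sc i zh) (z - x) + up * (q i * (norm ((\<beta> / q i) *\<^sub>R Sc i zh))\<^sup>2)" for i
    proof -
      define v where "v = (\<beta> / q i) *\<^sub>R Sc i zh"
      have "N (z - v - x) = N (z - x) - 2 * ip v (z - x) + N v"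
        using N_diff[of "z - x" v] by (simp add: algebra_simps ip_sym)
      moreover have "N v \<le> up * (norm v)\<^sup>2" using ip_upper[of v] by (simp add: power2_norm_eq_inner)
      ultimately have "N (z - v - x) \<le> N (z - x) - 2 * ip v (z - x) + up * (norm v)\<^sup>2" by simp
      then have "q i * N (z - v - x) \<le> q i * (N (z - x) - 2 * ip v (z - x) + up * (norm v)\<^sup>2)"
        using q_pos[of i] by (intro mult_left_mono) auto
      moreover have "q i * ip v (z - x) = \<beta> * ip (Sc i zh) (z - x)"
        using q_pos[of i] unfolding v_def bilinear_lmul[OF ip_bilinear] by simp
      ultimately show ?thesis unfolding v_def[symmetric] by (simp add: algebra_simps)
    qed
    then have "(\<Sum>i\<in>UNIV. q i * N (z - (\<beta> / q i) *\<^sub>R Sc i zh - x)) \<le>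
      (\<Sum>i\<in>UNIV. q i * N (z - x) - 2 * \<beta> * ip (Sc i zh) (z - x) + up * (q i * (norm ((\<beta> / q i) *\<^sub>R Sc i zh))\<^sup>2))"
      by (rule sum_mono)
    also have "\<dots> = (\<Sum>i\<in>UNIV. q i) * N (z - x) - 2 * \<beta> * ip (\<Sum>i\<in>UNIV. Sc i zh) (z - x)
       + up * (\<Sum>i\<in>UNIV. q i * (norm ((\<beta> / q i) *\<^sub>R Sc i zh))\<^sup>2)"
      by (simp only: sum.distrib sum_subtractf sum_distrib_left sum_distrib_right ip_sum_left)
    also have "\<dots> \<le> N (z - x) - 2 * \<beta> * ip g (z - x) + up * (\<beta>\<^sup>2 / qm * (g \<bullet> g))"
      using mult_left_mono[OF incr_exp, of up] up_pos by (simp add: q_sum Sc_sum g_def)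
    finally show ?thesis .
  qed
  have delayed_ip: "- (2 * ip g (z - x)) \<le> - N g + real \<tau> * young_wt * N g + up / young_wt * window k \<omega>"
  proof -
    have "N g / 2 \<le> ip g (zh - x)" using S_cocoercive[of zh x] x by (simp add: g_def)
    moreover have "ip g (z - x) = ip g (zh - x) + (\<Sum>d\<in>{k - \<tau>..<k}. ip g (D d))"
    proof -
      have "z - x = (zh - x) + (\<Sum>d\<in>{k - \<tau>..<k}. D d)" using D(1) by simp
      then show ?thesis by (simp only: bilinear_radd[OF ip_bilinear] ip_sum_right)
    qed
    moreover have "(\<Sum>d\<in>{k - \<tau>..<k}. - (2 * ip g (D d))) \<le> (\<Sum>d\<in>{k - \<tau>..<k}. young_wt * N g + up / young_wt * incr2 d \<omega>)"
    proof (rule sum_mono)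
      fix d
      have "2 * ip g (- D d) \<le> young_wt * N g + N (- D d) / young_wt" by (rule young[OF young_wt_pos])
      also have "N (- D d) / young_wt \<le> up / young_wt * incr2 d \<omega>"
      proof -
        have "N (- D d) \<le> up * (norm (D d))\<^sup>2" using ip_upper[of "- D d"] by (simp add: power2_norm_eq_inner)
        also have "\<dots> \<le> up * incr2 d \<omega>"
          unfolding incr2_def using D(2)[of d] up_pos by (intro mult_left_mono power_mono) auto
        finally show ?thesis using young_wt_pos by (simp add: divide_right_mono)
      qed
      finally show "- (2 * ip g (D d)) \<le> young_wt * N g + up / young_wt * incr2 d \<omega>"
        by (simp add: bilinear_rneg[OF ip_bilinear])
    qed
    moreover have "(\<Sum>d\<in>{k - \<tau>..<k}. young_wt * N g + up / young_wt * incr2 d \<omega>) \<le> real \<tau> * young_wt * N g + up / young_wt * window k \<omega>"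
    proof -
      have "(\<Sum>d\<in>{k - \<tau>..<k}. young_wt * N g + up / young_wt * incr2 d \<omega>) = real (card {k - \<tau>..<k}) * (young_wt * N g) + up / young_wt * window k \<omega>"
        by (simp add: sum.distrib window_def sum_distrib_left)
      moreover have "real (card {k - \<tau>..<k}) * (young_wt * N g) \<le> real \<tau> * (young_wt * N g)"
        using young_wt_pos N_nonneg[of g] by (intro mult_right_mono) auto
      ultimately show ?thesis by simp
    qed
    ultimately show ?thesis by (simp add: sum_negf sum_distrib_left[symmetric])
  qed
  have gg: "g \<bullet> g \<le> N g / lo" using ip_lower[of g] lo_pos by (simp add: pos_le_divide_eq mult.commute)
  have memory_exp: "(\<Sum>i\<in>UNIV. q i * \<Phi>_after x i k \<omega>) =
     (\<Sum>i\<in>UNIV. q i * N (z - (\<beta> / q i) *\<^sub>R Sc i zh - x)) +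
     mem_wt * (real \<tau> * (\<Sum>i\<in>UNIV. q i * (norm ((\<beta> / q i) *\<^sub>R Sc i zh))\<^sup>2) + memory k \<omega> - window k \<omega>)"
  proof -
    have "(\<Sum>i\<in>UNIV. q i * \<Phi>_after x i k \<omega>) = (\<Sum>i\<in>UNIV. q i * N (z - (\<beta> / q i) *\<^sub>R Sc i zh - x)
        + mem_wt * real \<tau> * (q i * (norm ((\<beta> / q i) *\<^sub>R Sc i zh))\<^sup>2) + q i * (mem_wt * (memory k \<omega> - window k \<omega>)))"
      by (rule sum.cong[OF refl]) (simp only: \<Phi>_after_def z_def zh_def, simp only: algebra_simps)
    then show ?thesis
      by (simp only: sum.distrib sum_distrib_left[symmetric] sum_distrib_right[symmetric] q_sum)
         (simp add: algebra_simps)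
  qed
  have "(\<Sum>i\<in>UNIV. q i * \<Phi>_after x i k \<omega>)
      \<le> (N (z - x) + \<beta> * (- N g + real \<tau> * young_wt * N g + up / young_wt * window k \<omega>) + up * (\<beta>\<^sup>2 / qm * (g \<bullet> g)))
        + mem_wt * (real \<tau> * (\<beta>\<^sup>2 / qm * (g \<bullet> g)) + memory k \<omega> - window k \<omega>)"
  proof -
    have "mem_wt * (real \<tau> * (\<Sum>i\<in>UNIV. q i * (norm ((\<beta> / q i) *\<^sub>R Sc i zh))\<^sup>2) + memory k \<omega> - window k \<omega>)
        \<le> mem_wt * (real \<tau> * (\<beta>\<^sup>2 / qm * (g \<bullet> g)) + memory k \<omega> - window k \<omega>)"
    proof (rule mult_left_mono)
      have "real \<tau> * (\<Sum>i\<in>UNIV. q i * (norm ((\<beta> / q i) *\<^sub>R Sc i zh))\<^sup>2) \<le> real \<tau> * (\<beta>\<^sup>2 / qm * (g \<bullet> g))"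
        by (rule mult_left_mono[OF incr_exp]) simp
      then show "real \<tau> * (\<Sum>i\<in>UNIV. q i * (norm ((\<beta> / q i) *\<^sub>R Sc i zh))\<^sup>2) + memory k \<omega> - window k \<omega>
        \<le> real \<tau> * (\<beta>\<^sup>2 / qm * (g \<bullet> g)) + memory k \<omega> - window k \<omega>" by linarith
    qed (use mem_wt_pos in simp)
    moreover have "- (2 * \<beta> * ip g (z - x)) \<le> \<beta> * (- N g + real \<tau> * young_wt * N g + up / young_wt * window k \<omega>)"
      using mult_left_mono[OF delayed_ip, of \<beta>] \<beta>_pos by (simp add: mult.assoc mult.left_commute)
    ultimately show ?thesis unfolding memory_exp using dist_exp by linarith
  qed
  also have "\<dots> = \<Phi> x k \<omega> - \<beta> * N g + \<beta> * real \<tau> * young_wt * N g + (up + mem_wt * real \<tau>) * (\<beta>\<^sup>2 / qm) * (g \<bullet> g)"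
    by (simp add: \<Phi>_def z_def mem_wt_def algebra_simps)
  also have "\<dots> \<le> \<Phi> x k \<omega> - \<beta> * N g + \<beta> * real \<tau> * young_wt * N g + (up + mem_wt * real \<tau>) * (\<beta>\<^sup>2 / qm) * (N g / lo)"
    using gg mem_wt_pos up_pos qm_pos by (intro add_left_mono mult_left_mono) auto
  also have "\<dots> = \<Phi> x k \<omega> - rate * N g"
  proof -
    define r where "r = sqrt (up / lo / qm)"
    have r: "r > 0" "r\<^sup>2 = up / lo / qm" using up_pos lo_pos qm_pos by (simp_all add: r_def)
    have rq: "sqrt (up / lo * qm) = r * qm"
    proof -
      have "up / lo * qm = (r * qm)\<^sup>2" 
        unfolding power_mult_distrib r(2) using qm_pos by (simp add: power2_eq_square)
      then show ?thesis using r qm_pos by simp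
    qed
    have bb: "young_wt = \<beta> * r" by (simp add: young_wt_def r_def)
    have "mem_wt * (\<beta>\<^sup>2 / qm) / lo = \<beta> * young_wt"
    proof -
      have "mem_wt * (\<beta>\<^sup>2 / qm) / lo = \<beta> * \<beta>\<^sup>2 * (up / lo / qm) / young_wt" by (simp add: mem_wt_def mult_ac)
      also have "\<dots> = \<beta> * \<beta>\<^sup>2 * r\<^sup>2 / young_wt" by (simp only: r(2))
      also have "\<dots> = \<beta> * young_wt" using r(1) \<beta>_pos by (simp add: bb power2_eq_square)
      finally show ?thesis .
    qed
    then have 1: "mem_wt * real \<tau> * (\<beta>\<^sup>2 / qm) * (N g / lo) = \<beta> * real \<tau> * young_wt * N g"
      by (metis (no_types, opaque_lifting) mult.assoc mult.commute times_divide_eq_right)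
    have 2: "rate = \<beta> - 2 * \<beta> * real \<tau> * young_wt - \<beta> * \<beta> * (up / lo) / qm"
      unfolding rate_def rq bb using qm_pos by (simp add: field_simps)
    show ?thesis unfolding 2 distrib_right 1 by (simp add: algebra_simps power2_eq_square)
  qed
  finally show ?thesis by (simp add: g_def zh_def)
qed


lemma bounded_rv_compare:
  assumes "bounded_rv P g" "\<And>\<omega>. \<omega> \<in> space P \<Longrightarrow> norm (f \<omega>) \<le> g \<omega>" shows "bounded_rv P f"
proof -
  obtain B where "\<And>\<omega>. \<omega> \<in> space P \<Longrightarrow> norm (g \<omega>) \<le> B" using assms by (auto simp: bounded_rv_def)
  then show ?thesis using assms(2) by (intro bounded_rvI[of _ _ B]) force
qed

lemma Zh_bounded_step:
  assumes "\<And>d. d \<le> k \<Longrightarrow> bounded_rv P (Z d)" shows "bounded_rv P (Zh k)"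
proof (rule bounded_rv_compare)
  show "bounded_rv P (\<lambda>\<omega>. norm (Z k \<omega>) + (\<Sum>d\<in>{k - \<tau>..<k}. norm (Z (Suc d) \<omega> - Z d \<omega>)))"
    using assms
    by (intro bounded_rv_add bounded_rv_sum bounded_rv_continuous[of norm] continuous_intros bounded_rv_diff) auto
  fix \<omega> assume "\<omega> \<in> space P"
  then obtain D where D: "Zh k \<omega> = Z k \<omega> - (\<Sum>d\<in>{k - \<tau>..<k}. D d)" "\<And>d. norm (D d) \<le> norm (Z (Suc d) \<omega> - Z d \<omega>)"
    using delay by blast
  have "norm (Zh k \<omega>) \<le> norm (Z k \<omega>) + norm (\<Sum>d\<in>{k - \<tau>..<k}. D d)" unfolding D(1) by (rule norm_triangle_ineq4)
  also have "\<dots> \<le> norm (Z k \<omega>) + (\<Sum>d\<in>{k - \<tau>..<k}. norm (Z (Suc d) \<omega> - Z d \<omega>))"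
    by (intro add_left_mono sum_norm_le D(2))
  finally show "norm (Zh k \<omega>) \<le> norm (Z k \<omega>) + (\<Sum>d\<in>{k - \<tau>..<k}. norm (Z (Suc d) \<omega> - Z d \<omega>))" .
qed

lemma Z_bounded: "bounded_rv P (Z k)"
proof (induction k rule: less_induct)
  case (less k)
  show ?case
  proof (cases k)
    case 0 then show ?thesis using Z0_bounded by simp
  next
    case (Suc m)
    have Zh: "bounded_rv P (Zh m)" by (rule Zh_bounded_step) (use less Suc in auto)
    show ?thesis
    proof (rule bounded_rv_compare)
      show "bounded_rv P (\<lambda>\<omega>. norm (Z m \<omega>) + (\<Sum>i\<in>UNIV. norm ((\<beta> / q i) *\<^sub>R Sc i (Zh m \<omega>))))"
        using less[of m] Suc
        by (intro bounded_rv_add bounded_rv_sum bounded_rv_continuous[of norm] continuous_intros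
            bounded_rv_scaleR bounded_rv_continuous[OF Sc_cont Zh]) auto
      fix \<omega> assume "\<omega> \<in> space P"
      then have "norm (Z k \<omega>) \<le> norm (Z m \<omega>) + norm ((\<beta> / q (ag m \<omega>)) *\<^sub>R Sc (ag m \<omega>) (Zh m \<omega>))"
        unfolding Suc Z_Suc[OF \<open>\<omega> \<in> space P\<close>] by (intro norm_triangle_ineq4)
      also have "norm ((\<beta> / q (ag m \<omega>)) *\<^sub>R Sc (ag m \<omega>) (Zh m \<omega>)) \<le> (\<Sum>i\<in>UNIV. norm ((\<beta> / q i) *\<^sub>R Sc i (Zh m \<omega>)))"
        by (rule member_le_sum) auto
      finally show "norm (Z k \<omega>) \<le> norm (Z m \<omega>) + (\<Sum>i\<in>UNIV. norm ((\<beta> / q i) *\<^sub>R Sc i (Zh m \<omega>)))"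
        by simp
    qed
  qed
qed

lemma Zh_bounded: "bounded_rv P (Zh k)"
  by (rule Zh_bounded_step) (rule Z_bounded)

lemma continuous_rv:
  "continuous_on UNIV h \<Longrightarrow> f \<in> borel_measurable M \<Longrightarrow> (\<lambda>\<omega>. h (f \<omega>)) \<in> borel_measurable M"
  by (rule borel_measurable_continuous_on)

lemma incr2_adapted: "d < k \<Longrightarrow> incr2 d \<in> borel_measurable (F k)"
  unfolding incr2_def[abs_def] using Z_adapted[of d k] Z_adapted[of "Suc d" k] by simp

lemma incr2_bounded: "bounded_rv P (incr2 d)"
  unfolding incr2_def[abs_def]
  by (intro bounded_rv_continuous[of "\<lambda>x. (norm x)\<^sup>2"] bounded_rv_diff Z_bounded continuous_intros)

lemma window_adapted: "window k \<in> borel_measurable (F k)"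
  unfolding window_def[abs_def] by (intro borel_measurable_sum incr2_adapted) auto

lemma memory_adapted: "memory k \<in> borel_measurable (F k)"
  unfolding memory_def[abs_def]
  by (intro borel_measurable_sum borel_measurable_times borel_measurable_const incr2_adapted) auto

lemma window_bounded: "bounded_rv P (window k)"
  unfolding window_def[abs_def] by (intro bounded_rv_sum incr2_bounded)

lemma memory_bounded: "bounded_rv P (memory k)"
  unfolding memory_def[abs_def] by (intro bounded_rv_sum bounded_rv_mult_left incr2_bounded)

lemma \<Phi>_adapted: "\<Phi> x k \<in> borel_measurable (F k)"
  unfolding \<Phi>_def[abs_def]
  by (intro borel_measurable_add borel_measurable_times borel_measurable_const memory_adapted
      continuous_rv[OF continuous_on_N] borel_measurable_diff Z_adapted order_refl)

lemma \<Phi>_bounded: "bounded_rv P (\<Phi> x k)"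
  unfolding \<Phi>_def[abs_def]
  by (intro bounded_rv_add bounded_rv_mult_left memory_bounded
      bounded_rv_continuous[OF continuous_on_N] bounded_rv_diff bounded_rv_const Z_bounded)

lemma \<Phi>_after_adapted: "\<Phi>_after x i k \<in> borel_measurable (F k)"
  unfolding \<Phi>_after_def[abs_def]
  by (intro borel_measurable_add borel_measurable_times borel_measurable_const memory_adapted
      window_adapted continuous_rv[OF continuous_on_N] borel_measurable_diff Z_adapted order_refl
      continuous_rv[of "\<lambda>x. (norm x)\<^sup>2"] borel_measurable_scaleR
      continuous_rv[OF Sc_cont] Zh_adapted continuous_intros)

lemma \<Phi>_after_bounded: "bounded_rv P (\<Phi>_after x i k)"
  unfolding \<Phi>_after_def[abs_def]
  by (intro bounded_rv_add bounded_rv_mult_left memory_bounded window_bounded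
      bounded_rv_continuous[OF continuous_on_N] bounded_rv_diff bounded_rv_const Z_bounded
      bounded_rv_continuous[of "\<lambda>x. (norm x)\<^sup>2"] bounded_rv_scaleR
      bounded_rv_continuous[OF Sc_cont] Zh_bounded continuous_intros)

lemma residual_adapted: "(\<lambda>\<omega>. N (S (Zh k \<omega>))) \<in> borel_measurable (F k)"
  by (intro continuous_rv[OF continuous_on_N] continuous_rv[OF S_cont] Zh_adapted)

lemma residual_bounded: "bounded_rv P (\<lambda>\<omega>. N (S (Zh k \<omega>)))"
  by (intro bounded_rv_continuous[OF continuous_on_N] bounded_rv_continuous[OF S_cont] Zh_bounded)

lemma integrable_adapted:
  fixes f :: "'w \<Rightarrow> real"
  assumes "f \<in> borel_measurable (F k)" "bounded_rv P f" shows "integrable P f"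
  by (rule integrable_bounded_rv[OF assms(2) measurable_from_subalg[OF F_sub assms(1)]])

text \<open>Split \<open>\<Phi> x (k + 1)\<close> according to the activated agent; each piece is an indicator
  of the agent times a function known at time \<open>k\<close>, so \<open>ag_indep\<close> replaces the
  indicator by \<open>q i\<close> and \<open>descent\<close> applies pointwise.\<close>

lemma supermartingale_step:
  assumes x: "S x = 0" and A: "A \<in> sets (F k)"
  shows "(\<integral>\<omega>. indicator A \<omega> * \<Phi> x (Suc k) \<omega> \<partial>P)
    \<le> (\<integral>\<omega>. indicator A \<omega> * \<Phi> x k \<omega> \<partial>P) - rate * (\<integral>\<omega>. indicator A \<omega> * N (S (Zh k \<omega>)) \<partial>P)"
proof -
  have A_P[measurable]: "A \<in> sets P" using A F_sub[of k] by (auto simp: subalgebra_def)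
  have ind: "integrable P (\<lambda>\<omega>. indicator A \<omega> * f \<omega>)" "(\<lambda>\<omega>. indicator A \<omega> * f \<omega>) \<in> borel_measurable (F k)"
    if "f \<in> borel_measurable (F k)" "bounded_rv P f" for f :: "'w \<Rightarrow> real"
  proof -
    show "(\<lambda>\<omega>. indicator A \<omega> * f \<omega>) \<in> borel_measurable (F k)"
      using A that(1) by (intro borel_measurable_times borel_measurable_indicator)
    show "integrable P (\<lambda>\<omega>. indicator A \<omega> * f \<omega>)"
      using integrable_mult_indicator[OF A_P integrable_adapted[OF that]] by simp
  qed
  note after = ind[OF \<Phi>_after_adapted \<Phi>_after_bounded]
  have agP[measurable]: "ag k \<in> measurable P (count_space UNIV)" by (rule ag_meas)
  have after_int: "integrable P (\<lambda>\<omega>. of_bool (ag k \<omega> = i) * (indicator A \<omega> * \<Phi>_after x i k \<omega>))" for i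
    by (rule Bochner_Integration.integrable_bound[OF after(1)[of x i]])
       (use after(1)[of x i] in \<open>auto intro!: AE_I2\<close>)
  have "(\<integral>\<omega>. indicator A \<omega> * \<Phi> x (Suc k) \<omega> \<partial>P) =
     (\<integral>\<omega>. (\<Sum>i\<in>UNIV. of_bool (ag k \<omega> = i) * (indicator A \<omega> * \<Phi>_after x i k \<omega>)) \<partial>P)"
  proof (rule Bochner_Integration.integral_cong[OF refl])
    fix \<omega> assume \<omega>: "\<omega> \<in> space P"
    have "(\<Sum>i\<in>UNIV. of_bool (ag k \<omega> = i) * (indicator A \<omega> * \<Phi>_after x i k \<omega>)) =
       (\<Sum>i\<in>UNIV. if ag k \<omega> = i then indicator A \<omega> * \<Phi>_after x i k \<omega> else 0)"
      by (rule sum.cong) auto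
    also have "\<dots> = indicator A \<omega> * \<Phi>_after x (ag k \<omega>) k \<omega>" by simp
    finally show "indicator A \<omega> * \<Phi> x (Suc k) \<omega> =
       (\<Sum>i\<in>UNIV. of_bool (ag k \<omega> = i) * (indicator A \<omega> * \<Phi>_after x i k \<omega>))"
      by (simp add: \<Phi>_Suc[OF \<omega>])
  qed
  also have "\<dots> = (\<Sum>i\<in>UNIV. \<integral>\<omega>. of_bool (ag k \<omega> = i) * (indicator A \<omega> * \<Phi>_after x i k \<omega>) \<partial>P)"
    by (rule Bochner_Integration.integral_sum[OF after_int])
  also have "\<dots> = (\<Sum>i\<in>UNIV. q i * (\<integral>\<omega>. indicator A \<omega> * \<Phi>_after x i k \<omega> \<partial>P))"
    by (intro sum.cong refl ag_indep after)
  also have "\<dots> = (\<integral>\<omega>. (\<Sum>i\<in>UNIV. q i * (indicator A \<omega> * \<Phi>_after x i k \<omega>)) \<partial>P)"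
    using after(1) by (simp add: Bochner_Integration.integral_sum)
  also have "\<dots> \<le> (\<integral>\<omega>. indicator A \<omega> * \<Phi> x k \<omega> - rate * (indicator A \<omega> * N (S (Zh k \<omega>))) \<partial>P)"
  proof (rule integral_mono)
    show "integrable P (\<lambda>\<omega>. \<Sum>i\<in>UNIV. q i * (indicator A \<omega> * \<Phi>_after x i k \<omega>))"
      using after(1) by (intro Bochner_Integration.integrable_sum integrable_mult_right) auto
    show "integrable P (\<lambda>\<omega>. indicator A \<omega> * \<Phi> x k \<omega> - rate * (indicator A \<omega> * N (S (Zh k \<omega>))))"
      by (intro Bochner_Integration.integrable_diff integrable_mult_right
          ind(1)[OF \<Phi>_adapted \<Phi>_bounded] ind(1)[OF residual_adapted residual_bounded])
    fix \<omega> assume "\<omega> \<in> space P"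
    then show "(\<Sum>i\<in>UNIV. q i * (indicator A \<omega> * \<Phi>_after x i k \<omega>))
        \<le> indicator A \<omega> * \<Phi> x k \<omega> - rate * (indicator A \<omega> * N (S (Zh k \<omega>)))"
      using descent[OF _ x] by (cases "\<omega> \<in> A") auto
  qed
  also have "\<dots> = (\<integral>\<omega>. indicator A \<omega> * \<Phi> x k \<omega> \<partial>P) - rate * (\<integral>\<omega>. indicator A \<omega> * N (S (Zh k \<omega>)) \<partial>P)"
    using ind(1)[OF \<Phi>_adapted \<Phi>_bounded] ind(1)[OF residual_adapted residual_bounded] by simp
  finally show ?thesis .
qed

lemma \<Phi>_nonneg: "0 \<le> \<Phi> x k \<omega>"
  using mem_wt_pos memory_nonneg[of k \<omega>] N_nonneg[of "Z k \<omega> - x"] by (simp add: \<Phi>_def)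

lemma AE_\<Phi>_convergent:
  assumes x: "S x = 0" shows "AE \<omega> in P. convergent (\<lambda>k. \<Phi> x k \<omega>)"
proof (rule nonneg_supermartingale_convergent[where F=F,
      OF prob_space_axioms F_sub F_mono \<Phi>_adapted \<Phi>_nonneg])
  show "integrable P (\<Phi> x k)" for k by (rule integrable_adapted[OF \<Phi>_adapted \<Phi>_bounded])
  fix k A assume "A \<in> sets (F k)"
  from supermartingale_step[OF x this]
  have "(\<integral>\<omega>. indicator A \<omega> * \<Phi> x (Suc k) \<omega> \<partial>P)
    \<le> (\<integral>\<omega>. indicator A \<omega> * \<Phi> x k \<omega> \<partial>P) - rate * (\<integral>\<omega>. indicator A \<omega> * N (S (Zh k \<omega>)) \<partial>P)" .
  moreover have "0 \<le> rate * (\<integral>\<omega>. indicator A \<omega> * N (S (Zh k \<omega>)) \<partial>P)"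
    using rate_pos by (intro mult_nonneg_nonneg Bochner_Integration.integral_nonneg) (auto simp: N_nonneg)
  ultimately show "(\<integral>\<omega>. indicator A \<omega> * \<Phi> x (Suc k) \<omega> \<partial>P) \<le> (\<integral>\<omega>. indicator A \<omega> * \<Phi> x k \<omega> \<partial>P)"
    by linarith
qed

text \<open>Summing the expected decreases telescopes against \<open>\<Phi> x 0\<close>, so the expectation of
  the whole series is finite.\<close>

lemma AE_residual_summable:
  assumes x: "S x = 0" shows "AE \<omega> in P. summable (\<lambda>k. N (S (Zh k \<omega>)))"
proof (rule AE_summable_of_bounded_expectations)
  show "integrable P (\<lambda>\<omega>. N (S (Zh k \<omega>)))" for k
    by (rule integrable_adapted[OF residual_adapted residual_bounded])
  show "0 \<le> N (S (Zh k \<omega>))" for k \<omega> by (rule N_nonneg)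
  have step: "(\<integral>\<omega>. \<Phi> x (Suc k) \<omega> \<partial>P) \<le> (\<integral>\<omega>. \<Phi> x k \<omega> \<partial>P) - rate * (\<integral>\<omega>. N (S (Zh k \<omega>)) \<partial>P)" for k
  proof -
    have "(\<integral>\<omega>. indicator (space P) \<omega> * f \<omega> \<partial>P) = (\<integral>\<omega>. f \<omega> \<partial>P)" for f :: "'w \<Rightarrow> real"
      by (rule Bochner_Integration.integral_cong) auto
    moreover have "space P \<in> sets (F k)"
      using F_sub[of k] sets.top[of "F k"] by (simp add: subalgebra_def)
    ultimately show ?thesis using supermartingale_step[OF x, of "space P" k] by simp
  qed
  have tel: "rate * (\<Sum>k<n. \<integral>\<omega>. N (S (Zh k \<omega>)) \<partial>P) \<le> (\<integral>\<omega>. \<Phi> x 0 \<omega> \<partial>P) - (\<integral>\<omega>. \<Phi> x n \<omega> \<partial>P)" for n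
  proof (induction n)
    case (Suc n)
    then show ?case using step[of n] by (simp add: distrib_left)
  qed simp
  fix n
  have "rate * (\<Sum>k<n. \<integral>\<omega>. N (S (Zh k \<omega>)) \<partial>P) \<le> (\<integral>\<omega>. \<Phi> x 0 \<omega> \<partial>P)"
  proof -
    have "0 \<le> (\<integral>\<omega>. \<Phi> x n \<omega> \<partial>P)"
      by (intro Bochner_Integration.integral_nonneg) (rule \<Phi>_nonneg)
    then show ?thesis using tel[of n] by linarith
  qed
  then show "(\<Sum>k<n. \<integral>\<omega>. N (S (Zh k \<omega>)) \<partial>P) \<le> (\<integral>\<omega>. \<Phi> x 0 \<omega> \<partial>P) / rate"
    using rate_pos by (simp add: pos_le_divide_eq mult.commute)
qed

lemma incr2_le_residual:
  assumes \<omega>: "\<omega> \<in> space P" shows "incr2 k \<omega> \<le> (\<beta> / qm)\<^sup>2 / lo * N (S (Zh k \<omega>))"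
proof -
  let ?i = "ag k \<omega>"
  have "incr2 k \<omega> = (\<beta> / q ?i)\<^sup>2 * (Sc ?i (Zh k \<omega>) \<bullet> Sc ?i (Zh k \<omega>))"
    unfolding incr2_def Z_Suc[OF \<omega>] power2_norm_eq_inner by (simp add: power2_eq_square)
  also have "\<dots> \<le> (\<beta> / qm)\<^sup>2 * (S (Zh k \<omega>) \<bullet> S (Zh k \<omega>))"
  proof (rule mult_mono)
    show "(\<beta> / q ?i)\<^sup>2 \<le> (\<beta> / qm)\<^sup>2"
      using \<beta>_pos qm_pos q_pos[of ?i] q_ge[of ?i] by (intro power_mono divide_left_mono) auto
    show "Sc ?i (Zh k \<omega>) \<bullet> Sc ?i (Zh k \<omega>) \<le> S (Zh k \<omega>) \<bullet> S (Zh k \<omega>)"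
      unfolding Sc_orth[symmetric] by (rule member_le_sum) auto
  qed auto
  also have "\<dots> \<le> (\<beta> / qm)\<^sup>2 * (N (S (Zh k \<omega>)) / lo)"
    using ip_lower[of "S (Zh k \<omega>)"] lo_pos
    by (intro mult_left_mono) (auto simp: pos_le_divide_eq mult.commute)
  finally show ?thesis by simp
qed

text \<open>The exceptional null set of \<open>AE_\<Phi>_convergent\<close> depends on \<open>x\<close>, which
  is why only a countable dense set of zeros is used.\<close>

lemma almost_sure_convergence:
  assumes ex: "\<exists>x. S x = 0"
  shows "AE \<omega> in P. \<exists>y. S y = 0 \<and> (\<lambda>k. Z k \<omega>) \<longlonglongrightarrow> y"
proof -
  obtain D where D: "countable D" "D \<subseteq> {x. S x = 0}" "{x. S x = 0} \<subseteq> closure D"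
    using separable by blast
  have "D \<noteq> {}" using D ex by auto
  obtain x0 where x0: "S x0 = 0" using ex by blast
  have "AE \<omega> in P. \<forall>x\<in>D. convergent (\<lambda>k. \<Phi> x k \<omega>)"
    using D AE_\<Phi>_convergent by (subst AE_ball_countable) auto
  then show ?thesis using AE_residual_summable[OF x0]
  proof (rule AE_mp[OF AE_conjI], intro AE_I2 impI, elim conjE)
    fix \<omega> assume \<omega>: "\<omega> \<in> space P" and conv: "\<forall>x\<in>D. convergent (\<lambda>k. \<Phi> x k \<omega>)"
      and summ: "summable (\<lambda>k. N (S (Zh k \<omega>)))"
    have res: "(\<lambda>k. N (S (Zh k \<omega>))) \<longlonglongrightarrow> 0" using summ by (rule summable_LIMSEQ_zero)
    then have S0: "(\<lambda>k. S (Zh k \<omega>)) \<longlonglongrightarrow> 0" using tendsto_of_N[of "\<lambda>k. S (Zh k \<omega>)" 0] by simp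
    have "(\<lambda>k. (\<beta> / qm)\<^sup>2 / lo * N (S (Zh k \<omega>))) \<longlonglongrightarrow> 0"
      using tendsto_mult_left[OF res, of "(\<beta> / qm)\<^sup>2 / lo"] by simp
    then have incr: "(\<lambda>k. incr2 k \<omega>) \<longlonglongrightarrow> 0"
      by (rule tendsto_sandwich[OF _ _ tendsto_const, rotated 2])
         (intro always_eventually allI incr2_nonneg incr2_le_residual[OF \<omega>])+
    then have "(\<lambda>k. window k \<omega>) \<longlonglongrightarrow> 0"
      unfolding window_def by (intro tendsto_window_sum incr2_nonneg)
    then have "(\<lambda>k. real \<tau> * window k \<omega>) \<longlonglongrightarrow> 0"
      using tendsto_mult_left[of "\<lambda>k. window k \<omega>" 0 sequentially "real \<tau>"] by simp
    then have mem: "(\<lambda>k. memory k \<omega>) \<longlonglongrightarrow> 0"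
      by (rule tendsto_sandwich[OF _ _ tendsto_const, rotated 2])
         (auto intro!: always_eventually memory_nonneg memory_le)
    have "(\<lambda>k. sqrt (incr2 k \<omega>)) \<longlonglongrightarrow> 0" using tendsto_real_sqrt[OF incr] by simp
    then have "(\<lambda>k. norm (Z (Suc k) \<omega> - Z k \<omega>)) \<longlonglongrightarrow> 0" by (simp add: incr2_def)
    then have win: "(\<lambda>k. \<Sum>d\<in>{k - \<tau>..<k}. norm (Z (Suc d) \<omega> - Z d \<omega>)) \<longlonglongrightarrow> 0"
      by (intro tendsto_window_sum) auto
    have diff: "(\<lambda>k. Zh k \<omega> - Z k \<omega>) \<longlonglongrightarrow> 0"
    proof (rule Lim_null_comparison[OF _ win], intro always_eventually allI)
      fix k
      obtain D where "Zh k \<omega> = Z k \<omega> - (\<Sum>d\<in>{k - \<tau>..<k}. D d)" "\<And>d. norm (D d) \<le> norm (Z (Suc d) \<omega> - Z d \<omega>)"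
        using delay[OF \<omega>] by blast
      then show "norm (Zh k \<omega> - Z k \<omega>) \<le> (\<Sum>d\<in>{k - \<tau>..<k}. norm (Z (Suc d) \<omega> - Z d \<omega>))"
        by (simp add: sum_norm_le)
    qed
    show "\<exists>y. S y = 0 \<and> (\<lambda>k. Z k \<omega>) \<longlonglongrightarrow> y"
    proof (rule opial[OF S_cont diff S0 D(2,3) \<open>D \<noteq> {}\<close>])
      fix x assume "x \<in> D"
      then obtain l where "(\<lambda>k. \<Phi> x k \<omega>) \<longlonglongrightarrow> l" using conv by (auto simp: convergent_def)
      from tendsto_diff[OF this tendsto_mult_left[OF mem, of mem_wt]]
      have "(\<lambda>k. N (Z k \<omega> - x)) \<longlonglongrightarrow> l" by (simp add: \<Phi>_def)
      then show "convergent (\<lambda>k. N (Z k \<omega> - x))" by (auto simp: convergent_def)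
    qed
  qed
qed

lemma converges_to_random_zero:
  assumes ex: "\<exists>x. S x = 0"
  shows "\<exists>Zlim\<in>borel_measurable P. (\<forall>\<omega>\<in>space P. S (Zlim \<omega>) = 0) \<and>
     (AE \<omega> in P. (\<lambda>k. Z k \<omega>) \<longlonglongrightarrow> Zlim \<omega>)"
proof -
  obtain x0 where x0: "S x0 = 0" using ex by blast
  have ZP[measurable]: "Z k \<in> borel_measurable P" for k
    by (rule measurable_from_subalg[OF F_sub Z_adapted[OF order_refl]])
  define L where "L \<omega> = lim (\<lambda>k. Z k \<omega>)" for \<omega>
  have [measurable]: "L \<in> borel_measurable P" unfolding L_def[abs_def] by measurable
  have SL[measurable]: "(\<lambda>\<omega>. S (L \<omega>)) \<in> borel_measurable P"
    by (rule continuous_rv[OF S_cont]) measurable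
  \<comment> \<open>Off the almost sure event the limit need not exist, or \<open>lim\<close> need not be a
    zero; there the default \<open>x0\<close> is used.\<close>
  define Zlim where "Zlim \<omega> = (if S (L \<omega>) = 0 then L \<omega> else x0)" for \<omega>
  have "Zlim \<in> borel_measurable P" unfolding Zlim_def[abs_def] by measurable
  moreover have "S (Zlim \<omega>) = 0" for \<omega> using x0 by (simp add: Zlim_def)
  moreover have "AE \<omega> in P. (\<lambda>k. Z k \<omega>) \<longlonglongrightarrow> Zlim \<omega>"
    using almost_sure_convergence[OF ex]
  proof (rule AE_mp, intro AE_I2 impI)
    fix \<omega> assume "\<exists>y. S y = 0 \<and> (\<lambda>k. Z k \<omega>) \<longlonglongrightarrow> y"
    then obtain y where y: "S y = 0" "(\<lambda>k. Z k \<omega>) \<longlonglongrightarrow> y" by blast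
    then have "L \<omega> = y" by (simp add: L_def limI)
    then show "(\<lambda>k. Z k \<omega>) \<longlonglongrightarrow> Zlim \<omega>" using y by (simp add: Zlim_def)
  qed
  ultimately show ?thesis by blast
qed

end

section \<open>Matrices acting on stacked rows\<close>

lemma matrix_mult_row:
  fixes A :: "real^'b^'a" and X :: "real^'p^'b"
  shows "(A ** X) $ i = (\<Sum>j\<in>UNIV. A $ i $ j *\<^sub>R X $ j)"
  by (simp add: matrix_matrix_mult_def vec_eq_iff)

lemma matrix_mult_linear: "linear (\<lambda>X :: real^'p^'b. (A :: real^'b^'a) ** X)"
  by (rule linearI) (simp_all add: vec_eq_iff matrix_mult_row scaleR_sum_right sum.distrib algebra_simps)

lemmas matrix_mult_lin_simps = linear_add[OF matrix_mult_linear] linear_diff[OF matrix_mult_linear]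
  linear_scale[OF matrix_mult_linear] linear_0[OF matrix_mult_linear]

lemma matrix_mult_inner_transpose:
  fixes A :: "real^'b^'a" and X :: "real^'p^'b" and Y :: "real^'p^'a"
  shows "(A ** X) \<bullet> Y = X \<bullet> (transpose A ** Y)"
proof -
  have "(A ** X) \<bullet> Y = (\<Sum>i\<in>UNIV. \<Sum>j\<in>UNIV. A $ i $ j * (X $ j \<bullet> Y $ i))"
    by (simp add: inner_vec_def[of "A ** X"] matrix_mult_row inner_sum_left)
  also have "\<dots> = (\<Sum>j\<in>UNIV. \<Sum>i\<in>UNIV. A $ i $ j * (X $ j \<bullet> Y $ i))" by (rule sum.swap)
  also have "\<dots> = X \<bullet> (transpose A ** Y)"
    by (simp add: inner_vec_def[of X] matrix_mult_row inner_sum_right transpose_def)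
  finally show ?thesis .
qed

lemma inner_columns:
  fixes X Y :: "real^'p^'k"
  shows "X \<bullet> Y = (\<Sum>c\<in>UNIV. column c X \<bullet> column c Y)"
  unfolding inner_vec_def column_def by (simp add: inner_vec_def) (rule sum.swap)

lemma column_matrix_mult: "column c ((A :: real^'k^'k) ** X) = A *v column c X"
  by (simp add: column_def vec_eq_iff matrix_matrix_mult_def matrix_vector_mult_def)

text \<open>A matrix acts on \<open>X\<close> column by column, so the bounds for vectors add up.\<close>

lemma matrix_form_bounds:
  fixes A :: "real^'k^'k" and X :: "real^'p^'k"
  assumes sym: "transpose A = A"
  shows "lambda_min A * (X \<bullet> X) \<le> (A ** X) \<bullet> X" and "(A ** X) \<bullet> X \<le> lambda_max A * (X \<bullet> X)"
  unfolding inner_columns[of X X] inner_columns[of "A ** X" X] column_matrix_mult sum_distrib_left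
  by (intro sum_mono lambda_min_rayleigh(2)[OF sym] lambda_max_rayleigh[OF sym])+

lemma matrix_form_equivalent_inner:
  fixes A :: "real^'k^'k"
  assumes sym: "transpose A = A" and pos: "0 < lambda_min A"
  shows "equivalent_inner (\<lambda>X Y :: real^'p^'k. (A ** X) \<bullet> Y) (lambda_min A) (lambda_max A)"
proof
  show "bilinear (\<lambda>X Y :: real^'p^'k. (A ** X) \<bullet> Y)"
    unfolding bilinear_def
    by (intro conjI allI linearI) (simp_all add: matrix_mult_lin_simps inner_simps)
  show "(A ** X) \<bullet> Y = (A ** Y) \<bullet> X" for X Y :: "real^'p^'k"
    using matrix_mult_inner_transpose[of A X Y] sym by (simp add: inner_commute)
  show "lambda_min A * (X \<bullet> X) \<le> (A ** X) \<bullet> X" "(A ** X) \<bullet> X \<le> lambda_max A * (X \<bullet> X)" for X :: "real^'p^'k"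
    by (rule matrix_form_bounds[OF sym])+
  show "0 < lambda_min A" by (rule pos)
  have "lambda_min A \<in> eigenvalues A" by (rule lambda_min_rayleigh(1)[OF sym])
  then show "lambda_min A \<le> lambda_max A"
    unfolding lambda_max_def by (intro Max_ge finite_eigenvalues_symmetric[OF sym])
qed

lemma inverse_of_pos_def:
  fixes A :: "real^'k^'k"
  assumes sym: "transpose A = A" and pos: "0 < lambda_min A"
  shows "matrix_inv A ** A = mat 1" "A ** matrix_inv A = mat 1"
proof -
  have "\<forall>x. A *v x = 0 \<longrightarrow> x = 0"
  proof (intro allI impI)
    fix x assume "A *v x = 0"
    then have "lambda_min A * (x \<bullet> x) \<le> 0" using lambda_min_rayleigh(2)[OF sym, of x] by simp
    then show "x = 0" using pos by (metis inner_gt_zero_iff mult_pos_pos not_le)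
  qed
  then have "invertible A" using matrix_left_invertible_ker[of A] invertible_left_inverse by blast
  then have "\<exists>B. A ** B = mat 1 \<and> B ** A = mat 1" by (simp add: invertible_def)
  then have "A ** matrix_inv A = mat 1 \<and> matrix_inv A ** A = mat 1"
    unfolding matrix_inv_def by (rule someI_ex)
  then show "matrix_inv A ** A = mat 1" "A ** matrix_inv A = mat 1" by auto
qed

section \<open>The preconditioned forward-backward operator\<close>

lemma transpose_Gmat: "transpose (Gmat E lab W) = Gmat E lab W"
  by (auto simp: Gmat_def block_mat_def transpose_def vec_eq_iff of_bool_def split: row_label.split)

lemma transpose_Mmat: "transpose (Mmat E lab W \<alpha>) = Mmat E lab W \<alpha>"
  using transpose_Gmat[of E lab W] by (simp add: Mmat_def transpose_def vec_eq_iff)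

lemma Mmat_mult: "Mmat E lab W \<alpha> ** X = (1 / \<alpha>) *\<^sub>R (Gmat E lab W ** X)" for X :: "real^'p^'k"
  by (simp add: vec_eq_iff matrix_mult_row Mmat_def scaleR_sum_right sum_divide_distrib)

text \<open>Stated with the least eigenvalue of \<open>G\<close>, since the condition on
  \<open>\<alpha>\<close> refers to it.\<close>

lemma Mmat_form_lower:
  fixes X :: "real^'p^'k"
  assumes "0 < \<alpha>"
  shows "lambda_min (Gmat E lab W) / \<alpha> * (X \<bullet> X) \<le> (Mmat E lab W \<alpha> ** X) \<bullet> X"
  using matrix_form_bounds(1)[OF transpose_Gmat, of E lab W X] assms
  by (simp add: Mmat_mult divide_right_mono)

lemma lambda_min_Mmat_pos:
  fixes lab :: "'k::finite \<Rightarrow> 'n::finite row_label"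
  assumes \<alpha>: "0 < \<alpha>" and pos: "0 < lambda_min (Gmat E lab W)"
  shows "0 < lambda_min (Mmat E lab W \<alpha>)"
proof -
  obtain x where x: "x \<noteq> 0" "Mmat E lab W \<alpha> *v x = lambda_min (Mmat E lab W \<alpha>) *\<^sub>R x"
    using lambda_min_rayleigh(1)[OF transpose_Mmat, of E lab W \<alpha>] by (auto simp: eigenvalues_def)
  have "Mmat E lab W \<alpha> *v x = (1 / \<alpha>) *\<^sub>R (Gmat E lab W *v x)"
    by (simp add: Mmat_def scaleR_matrix_vector_assoc)
  then have "lambda_min (Gmat E lab W) / \<alpha> * (x \<bullet> x) \<le> (Mmat E lab W \<alpha> *v x) \<bullet> x"
    using lambda_min_rayleigh(2)[OF transpose_Gmat, of E lab W x] \<alpha> by (simp add: divide_right_mono)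
  moreover have "0 < lambda_min (Gmat E lab W) / \<alpha> * (x \<bullet> x)" using x \<alpha> pos by simp
  ultimately have "0 < lambda_min (Mmat E lab W \<alpha>) * (x \<bullet> x)" using x by simp
  then show ?thesis by (rule zero_less_mult_pos2) (use x in simp)
qed

context
  fixes E :: "('n::{finite,linorder} \<times> 'n) set" and lab :: "'k::finite \<Rightarrow> 'n row_label"
  assumes labelling: "row_labelling E lab"
begin

lemma inj_lab: "lab a = lab b \<longleftrightarrow> a = b"
  using labelling by (auto simp: row_labelling_def bij_betw_def inj_def)

lemma lab_Edge: "lab a = Edge e \<Longrightarrow> e \<in> E"
proof -
  assume "lab a = Edge e"
  moreover have "lab a \<in> range Agent \<union> Edge ` E"
    using labelling by (auto simp: row_labelling_def bij_betw_def)
  ultimately show ?thesis by auto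
qed

lemma lab_inv_Agent: "lab (inv lab (Agent i)) = Agent i"
proof (rule f_inv_into_f)
  show "Agent i \<in> range lab" using labelling by (auto simp: row_labelling_def bij_betw_def)
qed

lemma inv_lab: "lab a = Agent i \<Longrightarrow> inv lab (Agent i) = a"
  using inj_lab lab_inv_Agent by metis

lemma agent_rows_stack0 [simp]: "agent_rows lab (stack0 lab X) = X"
  by (simp add: agent_rows_def stack0_def vec_eq_iff lab_inv_Agent)

lemma agent_rows_diff: "agent_rows lab (Z - Z') = agent_rows lab Z - agent_rows lab Z'"
  by (simp add: agent_rows_def vec_eq_iff)

lemma stack0_diff: "stack0 lab X - stack0 lab Y = stack0 lab (X - Y)"
  by (simp add: stack0_def vec_eq_iff split: row_label.split)

text \<open>\<open>stack0\<close> and \<open>agent_rows\<close> are adjoint, which reduces inner products with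
  the values of \<open>\<A>\<close> and of \<open>\<partial>r\<close> to the agent rows.\<close>

lemma stack0_inner: "stack0 lab X \<bullet> Z = X \<bullet> agent_rows lab Z"
proof -
  have "stack0 lab X \<bullet> Z = (\<Sum>a\<in>range (\<lambda>i. inv lab (Agent i)). stack0 lab X $ a \<bullet> Z $ a)"
    unfolding inner_vec_def[of "stack0 lab X"]
  proof (rule sum.mono_neutral_right)
    show "\<forall>a\<in>UNIV - range (\<lambda>i. inv lab (Agent i)). stack0 lab X $ a \<bullet> Z $ a = 0"
    proof
      fix a assume a: "a \<in> UNIV - range (\<lambda>i. inv lab (Agent i))"
      then show "stack0 lab X $ a \<bullet> Z $ a = 0"
        using inv_lab[of a] by (cases "lab a") (auto simp: stack0_def)
    qed
  qed auto
  also have "\<dots> = (\<Sum>i\<in>UNIV. X $ i \<bullet> agent_rows lab Z $ i)"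
  proof (subst sum.reindex)
    show "inj (\<lambda>i. inv lab (Agent i))"
      by (rule injI) (metis lab_inv_Agent row_label.inject(1))
  qed (simp add: stack0_def agent_rows_def lab_inv_Agent)
  finally show ?thesis by (simp add: inner_vec_def)
qed

lemma opA_cocoercive:
  fixes s :: "'n \<Rightarrow> real^'p \<Rightarrow> real"
  assumes s_cpc: "\<And>i. closed_proper_convex (\<lambda>x. ereal (s i x))"
    and s_grad: "\<And>i x. GDERIV (s i) x :> gs i x"
    and s_lip: "\<And>i x y. norm (gs i x - gs i y) \<le> Lc i * norm (x - y)" and Lc_pos: "\<And>i. 0 < Lc i"
    and Lc_le: "\<And>i. Lc i \<le> L"
  shows "(norm (opA lab gs Z - opA lab gs Z'))\<^sup>2 \<le> L * ((opA lab gs Z - opA lab gs Z') \<bullet> (Z - Z'))"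
proof -
  define x y where "x = agent_rows lab Z" and "y = agent_rows lab Z'"
  define g where "g = (\<chi> i. gs i (x $ i) - gs i (y $ i))"
  have diff: "opA lab gs Z - opA lab gs Z' = stack0 lab g"
    unfolding opA_def stack0_diff by (simp add: g_def x_def y_def vec_eq_iff stack0_def split: row_label.split)
  have row: "(norm (g $ i))\<^sup>2 \<le> L * (g $ i \<bullet> (x $ i - y $ i))" for i
  proof -
    have "(norm (g $ i))\<^sup>2 \<le> Lc i * (g $ i \<bullet> (x $ i - y $ i))"
      unfolding g_def vec_lambda_beta
      by (rule gradient_cocoercive[OF convex_on_of_closed_proper_convex[OF s_cpc] s_grad s_lip Lc_pos])
    moreover then have "0 \<le> g $ i \<bullet> (x $ i - y $ i)"
      using Lc_pos[of i] by (smt (verit) zero_le_power2 mult_pos_neg)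
    ultimately show ?thesis using mult_right_mono[OF Lc_le[of i]] by (meson order_trans)
  qed
  have "(norm (stack0 lab g))\<^sup>2 = (\<Sum>i\<in>UNIV. (norm (g $ i))\<^sup>2)"
    by (simp add: power2_norm_eq_inner stack0_inner) (simp add: inner_vec_def)
  also have "\<dots> \<le> (\<Sum>i\<in>UNIV. L * (g $ i \<bullet> (x $ i - y $ i)))" by (rule sum_mono) (rule row)
  also have "\<dots> = L * (stack0 lab g \<bullet> (Z - Z'))"
    by (simp add: stack0_inner agent_rows_diff sum_distrib_left[symmetric] x_def y_def)
       (simp add: inner_vec_def)
  finally show ?thesis unfolding diff .
qed

definition skew_part ::
    "real ^ ('n::{finite,linorder}) ^ ('n::{finite,linorder}) \<Rightarrow> real \<Rightarrow> real^'k^'k" where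
  "skew_part W \<alpha> = block_mat lab (\<lambda>i j. 0) (\<lambda>i e. Vmat E W e i / \<alpha>)
      (\<lambda>e i. - (Vmat E W e i / \<alpha>)) (\<lambda>e f. 0)"

lemma skew_part_inner: "(skew_part W \<alpha> ** X) \<bullet> X = 0" for X :: "real^'p^'k"
proof -
  have neg: "transpose (skew_part W \<alpha>) = - skew_part W \<alpha>"
    by (simp add: skew_part_def block_mat_def transpose_def vec_eq_iff split: row_label.split)
  have "(skew_part W \<alpha> ** X) \<bullet> X = X \<bullet> (- skew_part W \<alpha> ** X)"
    unfolding neg[symmetric] by (rule matrix_mult_inner_transpose)
  also have "- skew_part W \<alpha> ** X = - (skew_part W \<alpha> ** X)"
    by (simp add: vec_eq_iff matrix_mult_row sum_negf)
  finally show ?thesis by (simp add: inner_commute)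
qed

lemma opB_iff: "B \<in> opB E lab W r \<alpha> Z \<longleftrightarrow>
   (\<exists>U. U \<in> subdiff (sum_rows r) (agent_rows lab Z) \<and> B = stack0 lab U + skew_part W \<alpha> ** Z)"
  by (auto simp: opB_def skew_part_def)

lemma sum_rows_proper:
  assumes cpc: "\<And>i. closed_proper_convex (r i)"
  shows "sum_rows r X \<noteq> - \<infinity>" "\<exists>X. sum_rows r X \<noteq> \<infinity>"
proof -
  have nm: "r i x \<noteq> - \<infinity>" for i x using cpc by (auto simp: closed_proper_convex_def)
  show "sum_rows r X \<noteq> - \<infinity>"
  proof -
    have "(\<Sum>i\<in>I. r i (X $ i)) \<noteq> - \<infinity>" for I
      by (induction I rule: infinite_finite_induct) (auto simp: nm)
    then show ?thesis by (simp add: sum_rows_def)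
  qed
  have "\<forall>i. \<exists>x. r i x \<noteq> \<infinity>" using cpc by (auto simp: closed_proper_convex_def)
  then obtain x where "\<And>i. r i (x i) \<noteq> \<infinity>" by metis
  then have "sum_rows r (\<chi> i. x i) \<noteq> \<infinity>" by (simp add: sum_rows_def sum_Pinfty)
  then show "\<exists>X. sum_rows r X \<noteq> \<infinity>" by blast
qed

text \<open>The skew part contributes nothing to the inner product, and the rest is the monotonicity of a
  subdifferential.\<close>

lemma opB_monotone:
  assumes cpc: "\<And>i. closed_proper_convex (r i)"
    and "B \<in> opB E lab W r \<alpha> Z" "B' \<in> opB E lab W r \<alpha> Z'"
  shows "0 \<le> (B - B') \<bullet> (Z - Z')"
proof -
  obtain U U' where U: "U \<in> subdiff (sum_rows r) (agent_rows lab Z)" "B = stack0 lab U + skew_part W \<alpha> ** Z"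
    and U': "U' \<in> subdiff (sum_rows r) (agent_rows lab Z')" "B' = stack0 lab U' + skew_part W \<alpha> ** Z'"
    using assms(2,3) unfolding opB_iff by blast
  have "B - B' = stack0 lab (U - U') + skew_part W \<alpha> ** (Z - Z')"
    unfolding U U' matrix_mult_lin_simps stack0_diff[symmetric] by simp
  then have "(B - B') \<bullet> (Z - Z') = (U - U') \<bullet> (agent_rows lab Z - agent_rows lab Z')"
    by (simp add: inner_add_left skew_part_inner stack0_inner agent_rows_diff)
  then show ?thesis
    using subdiff_monotone[OF sum_rows_proper[OF cpc] U(1) U'(1)] by simp
qed

lemma subdiff_sum_rows:
  assumes "\<And>i. U $ i \<in> subdiff (r i) (X $ i)" shows "U \<in> subdiff (sum_rows r) X"
  unfolding subdiff_def mem_Collect_eq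
proof
  fix Y
  have "sum_rows r X + ereal (U \<bullet> (Y - X)) = (\<Sum>i\<in>UNIV. r i (X $ i) + ereal (U $ i \<bullet> (Y $ i - X $ i)))"
    by (simp add: sum_rows_def inner_vec_def sum.distrib)
  also have "\<dots> \<le> sum_rows r Y"
    unfolding sum_rows_def using assms by (intro sum_mono) (simp add: subdiff_def)
  finally show "sum_rows r X + ereal (U \<bullet> (Y - X)) \<le> sum_rows r Y" .
qed

text \<open>In \<open>M + skew_part\<close> the lower left block cancels and the upper right block doubles, so
  the system is block triangular. The edge rows of the solution are \<open>\<alpha>\<close> times those of
  \<open>R\<close>. Substituting them into row \<open>i\<close> of the agents leaves \<open>(w i - x) /
  \<alpha> \<in> \<partial>r\<^sub>i(x)\<close>, which a proximal point solves.\<close>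

lemma resolvent_exists:
  fixes R :: "real^'p^'k"
  assumes cpc: "\<And>i. closed_proper_convex (r i)" and \<alpha>: "0 < \<alpha>"
  shows "\<exists>Z' B. B \<in> opB E lab W r \<alpha> Z' \<and> R = Mmat E lab W \<alpha> ** Z' + B"
proof -
  define v where "v i b = (case lab b of Agent j \<Rightarrow> 0 | Edge e \<Rightarrow> 2 * Vmat E W e i)" for i b
  define w where "w i = \<alpha> *\<^sub>R R $ inv lab (Agent i) - (\<Sum>b\<in>UNIV. v i b *\<^sub>R (\<alpha> *\<^sub>R R $ b))" for i
  have "\<forall>i. \<exists>x. (1 / \<alpha>) *\<^sub>R (w i - x) \<in> subdiff (r i) x" using prox_exists[OF cpc \<alpha>] by blast
  then obtain x where x: "\<And>i. (1 / \<alpha>) *\<^sub>R (w i - x i) \<in> subdiff (r i) (x i)" by metis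
  define U where "U = (\<chi> i. (1 / \<alpha>) *\<^sub>R (w i - x i))"
  define Z' where "Z' = (\<chi> a. case lab a of Agent i \<Rightarrow> x i | Edge e \<Rightarrow> \<alpha> *\<^sub>R R $ a)"
  have "agent_rows lab Z' = (\<chi> i. x i)" by (simp add: agent_rows_def Z'_def lab_inv_Agent)
  then have "U \<in> subdiff (sum_rows r) (agent_rows lab Z')"
    using x by (intro subdiff_sum_rows) (simp add: U_def)
  then have "stack0 lab U + skew_part W \<alpha> ** Z' \<in> opB E lab W r \<alpha> Z'" by (auto simp: opB_iff)
  moreover have "R = Mmat E lab W \<alpha> ** Z' + (stack0 lab U + skew_part W \<alpha> ** Z')"
  proof (rule vec_eq_iff[THEN iffD2], rule allI)
    fix a
    have "(Mmat E lab W \<alpha> ** Z' + (stack0 lab U + skew_part W \<alpha> ** Z')) $ a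
        = (\<Sum>b\<in>UNIV. (Mmat E lab W \<alpha> $ a $ b + skew_part W \<alpha> $ a $ b) *\<^sub>R Z' $ b) + stack0 lab U $ a"
      by (simp add: matrix_mult_row sum.distrib scaleR_add_left)
    also have "\<dots> = R $ a"
    proof (cases "lab a")
      case (Edge e)
      have "(\<Sum>b\<in>UNIV. (Mmat E lab W \<alpha> $ a $ b + skew_part W \<alpha> $ a $ b) *\<^sub>R Z' $ b)
          = (\<Sum>b\<in>UNIV. if b = a then (1 / \<alpha>) *\<^sub>R Z' $ b else 0)"
      proof (rule sum.cong[OF refl])
        fix b show "(Mmat E lab W \<alpha> $ a $ b + skew_part W \<alpha> $ a $ b) *\<^sub>R Z' $ b
            = (if b = a then (1 / \<alpha>) *\<^sub>R Z' $ b else 0)"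
          using Edge inj_lab[of a b]
          by (cases "lab b") (auto simp: Mmat_def Gmat_def skew_part_def block_mat_def)
      qed
      then show ?thesis using Edge \<alpha> by (simp add: Z'_def stack0_def)
    next
      case (Agent i)
      have inva: "inv lab (Agent i) = a" by (rule inv_lab[OF Agent])
      have "(\<Sum>b\<in>UNIV. (Mmat E lab W \<alpha> $ a $ b + skew_part W \<alpha> $ a $ b) *\<^sub>R Z' $ b)
          = (\<Sum>b\<in>UNIV. (if b = a then (1 / \<alpha>) *\<^sub>R Z' $ b else 0) + (1 / \<alpha>) *\<^sub>R (v i b *\<^sub>R (\<alpha> *\<^sub>R R $ b)))"
      proof (rule sum.cong[OF refl])
        fix b show "(Mmat E lab W \<alpha> $ a $ b + skew_part W \<alpha> $ a $ b) *\<^sub>R Z' $ b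
            = (if b = a then (1 / \<alpha>) *\<^sub>R Z' $ b else 0) + (1 / \<alpha>) *\<^sub>R (v i b *\<^sub>R (\<alpha> *\<^sub>R R $ b))"
          using Agent inj_lab[of a b] \<alpha>
          by (cases "lab b") (auto simp: Mmat_def Gmat_def skew_part_def block_mat_def v_def Z'_def)
      qed
      also have "\<dots> = (1 / \<alpha>) *\<^sub>R x i + (1 / \<alpha>) *\<^sub>R (\<alpha> *\<^sub>R R $ a - w i)"
      proof -
        have "(\<Sum>b\<in>UNIV. v i b *\<^sub>R (\<alpha> *\<^sub>R R $ b)) = \<alpha> *\<^sub>R R $ a - w i" by (simp add: w_def inva)
        moreover have "(\<Sum>b\<in>UNIV. if b = a then (1 / \<alpha>) *\<^sub>R Z' $ b else 0) = (1 / \<alpha>) *\<^sub>R x i"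
          using Agent by (simp add: Z'_def)
        ultimately show ?thesis by (simp only: sum.distrib scaleR_sum_right[symmetric])
      qed
      finally show ?thesis using Agent \<alpha> by (simp add: stack0_def U_def algebra_simps)
    qed
    finally show "R $ a = (Mmat E lab W \<alpha> ** Z' + (stack0 lab U + skew_part W \<alpha> ** Z')) $ a" ..
  qed
  ultimately show ?thesis by blast
qed

text \<open>Multiplying the defining inclusion by \<open>M\<close> shows that \<open>\<T> Z\<close> is a point
  \<open>Z'\<close> with \<open>M (Z - Z') - \<A> Z \<in> \<B> Z'\<close>. Such a point exists by
  \<open>resolvent_exists\<close> and is unique because \<open>\<B>\<close> is monotone and \<open>M\<close>
  is positive definite, so the definite description in the definition is meaningful.\<close>

lemma opT_inclusion:
  fixes Z :: "real^'p^'k"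
  assumes cpc: "\<And>i. closed_proper_convex (r i)" and \<alpha>: "0 < \<alpha>" and pos: "0 < lambda_min (Gmat E lab W)"
  shows "Mmat E lab W \<alpha> ** (Z - opT E lab W gs r \<alpha> Z) - opA lab gs Z
     \<in> opB E lab W r \<alpha> (opT E lab W gs r \<alpha> Z)"
proof -
  define M where "M = Mmat E lab W \<alpha>"
  define A where "A = opA lab gs Z"
  have Mpos: "0 < lambda_min M" unfolding M_def by (rule lambda_min_Mmat_pos[OF \<alpha> pos])
  have Msym: "transpose M = M" unfolding M_def by (rule transpose_Mmat)
  note inv = inverse_of_pos_def[OF Msym Mpos]
  interpret M: equivalent_inner "\<lambda>X Y :: real^'p^'k. (M ** X) \<bullet> Y" "lambda_min M" "lambda_max M"
    by (rule matrix_form_equivalent_inner[OF Msym Mpos])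
  have iff: "Z - matrix_inv M ** A \<in> (\<lambda>U. Z' + matrix_inv M ** U) ` opB E lab W r \<alpha> Z' \<longleftrightarrow>
     M ** (Z - Z') - A \<in> opB E lab W r \<alpha> Z'" for Z'
  proof
    assume "Z - matrix_inv M ** A \<in> (\<lambda>U. Z' + matrix_inv M ** U) ` opB E lab W r \<alpha> Z'"
    then obtain U where U: "U \<in> opB E lab W r \<alpha> Z'" "Z - matrix_inv M ** A = Z' + matrix_inv M ** U" by blast
    then have "M ** (Z - matrix_inv M ** A) = M ** (Z' + matrix_inv M ** U)" by simp
    then have "M ** Z - A = M ** Z' + U"
      by (simp add: matrix_mult_lin_simps matrix_mul_assoc inv)
    then have "M ** (Z - Z') - A = U" by (simp add: matrix_mult_lin_simps algebra_simps)
    then show "M ** (Z - Z') - A \<in> opB E lab W r \<alpha> Z'" using U by simp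
  next
    assume "M ** (Z - Z') - A \<in> opB E lab W r \<alpha> Z'"
    moreover have "Z - matrix_inv M ** A = Z' + matrix_inv M ** (M ** (Z - Z') - A)"
      by (simp add: matrix_mult_lin_simps matrix_mul_assoc inv)
    ultimately show "Z - matrix_inv M ** A \<in> (\<lambda>U. Z' + matrix_inv M ** U) ` opB E lab W r \<alpha> Z'"
      by (intro image_eqI)
  qed
  have "\<exists>!Z'. M ** (Z - Z') - A \<in> opB E lab W r \<alpha> Z'"
  proof (rule ex_ex1I)
    obtain Z' B where "B \<in> opB E lab W r \<alpha> Z'" "M ** Z - A = M ** Z' + B"
      using resolvent_exists[where r=r, OF cpc \<alpha>] unfolding M_def by blast
    moreover then have "M ** (Z - Z') - A = B" by (simp add: matrix_mult_lin_simps algebra_simps)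
    ultimately show "\<exists>Z'. M ** (Z - Z') - A \<in> opB E lab W r \<alpha> Z'" by metis
  next
    fix Z1 Z2
    assume "M ** (Z - Z1) - A \<in> opB E lab W r \<alpha> Z1" "M ** (Z - Z2) - A \<in> opB E lab W r \<alpha> Z2"
    then have "0 \<le> ((M ** (Z - Z1) - A) - (M ** (Z - Z2) - A)) \<bullet> (Z1 - Z2)"
      by (rule opB_monotone[OF cpc])
    also have "(M ** (Z - Z1) - A) - (M ** (Z - Z2) - A) = - (M ** (Z1 - Z2))"
      by (simp add: matrix_mult_lin_simps)
    finally have "(M ** (Z1 - Z2)) \<bullet> (Z1 - Z2) \<le> 0" by simp
    then have "lambda_min M * ((Z1 - Z2) \<bullet> (Z1 - Z2)) \<le> 0"
      using M.ip_lower[of "Z1 - Z2"] by linarith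
    then have "Z1 - Z2 = 0" using Mpos by (metis inner_gt_zero_iff mult_pos_pos not_le)
    then show "Z1 = Z2" by simp
  qed
  moreover have "opT E lab W gs r \<alpha> Z = (THE Z'. M ** (Z - Z') - A \<in> opB E lab W r \<alpha> Z')"
    unfolding opT_def Let_def M_def[symmetric] A_def[symmetric] iff ..
  ultimately show ?thesis
    unfolding M_def[symmetric] A_def[symmetric] by (metis (no_types, lifting) theI')
qed

text \<open>Let \<open>g\<close>, \<open>e\<close>, \<open>a\<close> be the differences of the values of
  \<open>S\<close>, \<open>\<T>\<close>, \<open>\<A>\<close> at the two points, so that \<open>g + e = Z -
  Z'\<close>. Monotonicity of \<open>\<B>\<close> gives \<open>a \<bullet> e \<le> \<langle>g,
  e\<rangle>\<^sub>M\<close>, and cocoercivity of \<open>\<A>\<close> gives \<open>a \<bullet> e \<ge> - (L /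
  4) \<parallel>g\<parallel>\<^sup>2\<close>, the square completed in \<open>a\<close>. The bound on
  \<open>\<alpha>\<close> turns the right side into \<open>- \<parallel>g\<parallel>\<^sub>M\<^sup>2 /
  2\<close>, and adding \<open>\<parallel>g\<parallel>\<^sub>M\<^sup>2\<close> gives the claim.\<close>

lemma opT_residual_cocoercive:
  fixes Z Z' :: "real^'p^'k" and s :: "'n \<Rightarrow> real^'p \<Rightarrow> real"
  assumes s_cpc: "\<And>i. closed_proper_convex (\<lambda>x. ereal (s i x))"
    and s_grad: "\<And>i x. GDERIV (s i) x :> gs i x"
    and s_lip: "\<And>i x y. norm (gs i x - gs i y) \<le> Lc i * norm (x - y)" and Lc_pos: "\<And>i. 0 < Lc i"
    and Lc_le: "\<And>i. Lc i \<le> L"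
    and r_cpc: "\<And>i. closed_proper_convex (r i)"
    and \<alpha>: "0 < \<alpha>" "\<alpha> < 2 * lambda_min (Gmat E lab W) / L"
  defines "M \<equiv> Mmat E lab W \<alpha>" and "S \<equiv> \<lambda>Z. Z - opT E lab W gs r \<alpha> Z"
  shows "(M ** (S Z - S Z')) \<bullet> (S Z - S Z') / 2 \<le> (M ** (S Z - S Z')) \<bullet> (Z - Z')"
proof -
  define T where "T = opT E lab W gs r \<alpha>"
  define \<rho> where "\<rho> = lambda_min (Gmat E lab W)"
  have L: "0 < L" using Lc_pos Lc_le by (meson less_le_trans)
  have "0 < 2 * \<rho> / L" using \<alpha> by (simp add: \<rho>_def)
  then have \<rho>: "0 < \<rho>" using L by (simp add: zero_less_divide_iff)
  define g e a where "g = S Z - S Z'" and "e = T Z - T Z'" and "a = opA lab gs Z - opA lab gs Z'"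
  have d: "Z - Z' = g + e" by (simp add: g_def e_def S_def T_def)
  have "0 \<le> ((M ** (Z - T Z) - opA lab gs Z) - (M ** (Z' - T Z') - opA lab gs Z')) \<bullet> (T Z - T Z')"
    unfolding M_def T_def
    by (rule opB_monotone[OF r_cpc]) (rule opT_inclusion[OF r_cpc \<alpha>(1) \<rho>[unfolded \<rho>_def]])+
  also have "(M ** (Z - T Z) - opA lab gs Z) - (M ** (Z' - T Z') - opA lab gs Z') = M ** g - a"
    by (simp add: g_def a_def S_def T_def matrix_mult_lin_simps)
  finally have mono: "a \<bullet> e \<le> (M ** g) \<bullet> e" by (simp add: e_def[symmetric] inner_diff_left)
  have coc: "(norm a)\<^sup>2 \<le> L * (a \<bullet> (g + e))"
    unfolding a_def d[symmetric] by (rule opA_cocoercive[OF s_cpc s_grad s_lip Lc_pos Lc_le])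
  have "- (L / 4 * (norm g)\<^sup>2) \<le> a \<bullet> e"
  proof -
    have "0 \<le> (norm (a - (L / 2) *\<^sub>R g))\<^sup>2" by simp
    also have "\<dots> = (norm a)\<^sup>2 - L * (a \<bullet> g) + L\<^sup>2 / 4 * (norm g)\<^sup>2"
      unfolding power2_norm_eq_inner by (simp add: inner_simps inner_commute power2_eq_square)
    also have "\<dots> \<le> L * (a \<bullet> e + L / 4 * (norm g)\<^sup>2)"
      using coc by (simp add: inner_add_right algebra_simps power2_eq_square)
    finally show ?thesis using L by (simp add: zero_le_mult_iff)
  qed
  moreover have "L / 4 * (norm g)\<^sup>2 \<le> (M ** g) \<bullet> g / 2"
  proof -
    have "L * \<alpha> < 2 * \<rho>" using \<alpha>(2) L by (simp add: \<rho>_def pos_less_divide_eq mult.commute)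
    then have "L / 2 \<le> \<rho> / \<alpha>" using \<alpha>(1) by (simp add: pos_le_divide_eq)
    then have "L / 2 * (norm g)\<^sup>2 \<le> \<rho> / \<alpha> * (norm g)\<^sup>2" by (rule mult_right_mono) simp
    also have "\<dots> \<le> (M ** g) \<bullet> g"
      using Mmat_form_lower[OF \<alpha>(1)] unfolding M_def \<rho>_def power2_norm_eq_inner .
    finally show ?thesis by simp
  qed
  ultimately have "- ((M ** g) \<bullet> g / 2) \<le> (M ** g) \<bullet> e" using mono by linarith
  then show ?thesis unfolding d g_def[symmetric] by (simp add: inner_add_right)
qed

end

section \<open>Splitting the residual among the agents\<close>

lemma norm_le_rowwise:
  fixes x y :: "'a::real_normed_vector ^ 'k"
  assumes "\<And>i. norm (x $ i) \<le> norm (y $ i)" shows "norm x \<le> norm y"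
  unfolding norm_vec_def by (rule L2_set_mono) (use assms in auto)

lemma measurable_vec:
  fixes f :: "'w \<Rightarrow> real ^ 'p ^ 'k"
  assumes "\<And>a. (\<lambda>\<omega>. f \<omega> $ a) \<in> borel_measurable M" shows "f \<in> borel_measurable M"
proof -
  have cont: "continuous_on UNIV (\<lambda>v :: real^'p. (\<chi> b. if b = a then v else 0) :: real^'p^'k)" for a
  proof (rule continuous_on_vec_lambda)
    fix b show "continuous_on UNIV (\<lambda>v :: real^'p. if b = a then v else 0)" by (cases "b = a") auto
  qed
  have "f = (\<lambda>\<omega>. \<Sum>a\<in>UNIV. (\<chi> b. if b = a then f \<omega> $ a else 0))"
    by (simp add: fun_eq_iff vec_eq_iff)
  moreover have "(\<lambda>\<omega>. \<Sum>a\<in>UNIV. (\<chi> b. if b = a then f \<omega> $ a else 0)) \<in> borel_measurable M"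
    by (intro borel_measurable_sum borel_measurable_continuous_on[OF cont] assms)
  ultimately show ?thesis by simp
qed

lemma measurable_row: "f \<in> borel_measurable M \<Longrightarrow> (\<lambda>\<omega>. f \<omega> $ a) \<in> borel_measurable M"
  for f :: "'w \<Rightarrow> real ^ 'p ^ 'k"
  by (rule borel_measurable_continuous_on[of "\<lambda>x. x $ a"]) (intro continuous_intros)

definition row_owner :: "('k \<Rightarrow> 'n row_label) \<Rightarrow> 'k \<Rightarrow> 'n" where
  "row_owner lab a = (case lab a of Agent i \<Rightarrow> i | Edge e \<Rightarrow> fst e)"

lemma owned_rows_iff:
  fixes lab :: "'k::finite \<Rightarrow> 'n::{finite,linorder} row_label"
  assumes "row_labelling E lab" shows "a \<in> owned_rows E lab i \<longleftrightarrow> row_owner lab a = i"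
  using lab_Edge[OF assms, of a] by (cases "lab a") (auto simp: owned_rows_def row_owner_def)

lemma opS_row:
  fixes lab :: "'k::finite \<Rightarrow> 'n::{finite,linorder} row_label"
  assumes "row_labelling E lab"
  shows "opS E lab T i Z $ a = (if row_owner lab a = i then (Z - T Z) $ a else 0)"
  by (simp add: opS_def owned_rows_iff[OF assms])

text \<open>Every row is owned by exactly one agent.\<close>

lemma opS_sum:
  fixes lab :: "'k::finite \<Rightarrow> 'n::{finite,linorder} row_label"
  assumes "row_labelling E lab"
  shows "(\<Sum>i\<in>UNIV. opS E lab T i Z) = Z - T Z"
  by (simp add: vec_eq_iff opS_row[OF assms] del: vector_minus_component)

lemma opS_norm_sum:
  fixes lab :: "'k::finite \<Rightarrow> 'n::{finite,linorder} row_label"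
  assumes "row_labelling E lab"
  shows "(\<Sum>i\<in>UNIV. opS E lab T i Z \<bullet> opS E lab T i Z) = (Z - T Z) \<bullet> (Z - T Z)"
proof -
  have "(\<Sum>i\<in>UNIV. opS E lab T i Z \<bullet> opS E lab T i Z)
      = (\<Sum>i\<in>UNIV. \<Sum>a\<in>UNIV. if row_owner lab a = i then (Z - T Z) $ a \<bullet> (Z - T Z) $ a else 0)"
    unfolding inner_vec_def[of "opS E lab T i Z" for i]
    by (intro sum.cong refl) (simp add: opS_row[OF assms])
  also have "\<dots> = (\<Sum>a\<in>UNIV. \<Sum>i\<in>UNIV. if row_owner lab a = i then (Z - T Z) $ a \<bullet> (Z - T Z) $ a else 0)"
    by (rule sum.swap)
  also have "\<dots> = (Z - T Z) \<bullet> (Z - T Z)" by (simp add: inner_vec_def[of "Z - T Z"])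
  finally show ?thesis .
qed

lemma opS_continuous:
  fixes lab :: "'k::finite \<Rightarrow> 'n::{finite,linorder} row_label" and T :: "real^'p^'k \<Rightarrow> real^'p^'k"
  assumes "continuous_on UNIV (\<lambda>Z. Z - T Z)"
  shows "continuous_on UNIV (opS E lab T i)"
  unfolding opS_def[abs_def]
proof (rule continuous_on_vec_lambda)
  fix a
  show "continuous_on UNIV (\<lambda>Z. if a \<in> owned_rows E lab i then (Z - T Z) $ a else 0)"
    using continuous_on_component[OF assms, of a] by (cases "a \<in> owned_rows E lab i") auto
qed

section \<open>Delays and the history of the algorithm\<close>

definition row_delay ::
  "('k \<Rightarrow> 'n row_label) \<Rightarrow> (nat \<Rightarrow> 'n \<Rightarrow> 'w \<Rightarrow> nat) \<Rightarrow> (nat \<Rightarrow> 'n \<times> 'n \<Rightarrow> 'w \<Rightarrow> nat) \<Rightarrow> nat \<Rightarrow> 'k \<Rightarrow> 'w \<Rightarrow> nat" where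
  "row_delay lab \<tau>d \<delta>d k a \<omega> = (case lab a of Agent j \<Rightarrow> \<tau>d k j \<omega> | Edge e \<Rightarrow> \<delta>d k e \<omega>)"

lemma delayed_row: "delayed lab \<tau>d \<delta>d Z k \<omega> $ a = Z (k - row_delay lab \<tau>d \<delta>d k a \<omega>) \<omega> $ a"
  by (simp add: delayed_def row_delay_def split: row_label.split)

text \<open>A row that is delayed by \<open>m\<close> lacks the increments of the last \<open>m\<close> steps.
  As rows have different delays, the increment of step \<open>d\<close> is to be taken only in the rows that
  do not see it yet.\<close>

lemma delayed_as_masked_increments:
  fixes Z :: "nat \<Rightarrow> 'w \<Rightarrow> real^'p^'k"
  assumes bd: "\<And>a. row_delay lab \<tau>d \<delta>d k a \<omega> \<le> \<tau>"
  shows "\<exists>D. delayed lab \<tau>d \<delta>d Z k \<omega> = Z k \<omega> - (\<Sum>d\<in>{k - \<tau>..<k}. D d) \<and>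
     (\<forall>d. norm (D d) \<le> norm (Z (Suc d) \<omega> - Z d \<omega>))"
proof (intro exI conjI allI)
  define D :: "nat \<Rightarrow> real^'p^'k" where
    "D d = (\<chi> a. if k - row_delay lab \<tau>d \<delta>d k a \<omega> \<le> d then (Z (Suc d) \<omega> - Z d \<omega>) $ a else 0)" for d
  show "norm (D d) \<le> norm (Z (Suc d) \<omega> - Z d \<omega>)" for d
    by (rule norm_le_rowwise) (simp add: D_def)
  show "delayed lab \<tau>d \<delta>d Z k \<omega> = Z k \<omega> - (\<Sum>d\<in>{k - \<tau>..<k}. D d)"
  proof (rule vec_eq_iff[THEN iffD2], rule allI)
    fix a
    define m where "m = k - row_delay lab \<tau>d \<delta>d k a \<omega>"
    have m: "k - \<tau> \<le> m" "m \<le> k" using bd[of a] by (simp_all add: m_def)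
    have "(\<Sum>d\<in>{k - \<tau>..<k}. D d $ a) = (\<Sum>d\<in>{m..<k}. Z (Suc d) \<omega> $ a - Z d \<omega> $ a)"
      by (rule sum.mono_neutral_cong_right) (use m in \<open>auto simp: D_def m_def[symmetric]\<close>)
    also have "\<dots> = Z k \<omega> $ a - Z m \<omega> $ a" by (rule sum_Suc_diff'[OF m(2)])
    finally show "delayed lab \<tau>d \<delta>d Z k \<omega> $ a = (Z k \<omega> - (\<Sum>d\<in>{k - \<tau>..<k}. D d)) $ a"
      by (simp add: delayed_row m_def)
  qed
qed

lemma delayed_measurable:
  fixes Z :: "nat \<Rightarrow> 'w \<Rightarrow> real^'p^'k"
  assumes Z: "\<And>l. l \<le> k \<Longrightarrow> Z l \<in> borel_measurable M"
    and del: "\<And>a. row_delay lab \<tau>d \<delta>d k a \<in> measurable M (count_space UNIV)"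
  shows "delayed lab \<tau>d \<delta>d Z k \<in> borel_measurable M"
proof (rule measurable_vec)
  fix a
  have "(\<lambda>\<omega>. Z (k - row_delay lab \<tau>d \<delta>d k a \<omega>) \<omega> $ a) \<in> borel_measurable M"
  proof (rule measurable_compose_countable[where f="\<lambda>m \<omega>. Z (k - m) \<omega> $ a", OF _ del])
    fix m show "(\<lambda>\<omega>. Z (k - m) \<omega> $ a) \<in> borel_measurable M" by (intro measurable_row Z) simp
  qed
  then show "(\<lambda>\<omega>. delayed lab \<tau>d \<delta>d Z k \<omega> $ a) \<in> borel_measurable M" by (simp add: delayed_row)
qed

lemma space_history [simp]: "space (history P Z Zh k) = space P"
  unfolding history_def by (rule space_measure_of) auto

lemma sets_history: "sets (history P Z Zh k) = sigma_sets (space P)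
     (\<Union>l\<in>{..k}. {Z l -` A \<inter> space P | A. A \<in> sets borel} \<union>
                 {Zh l -` A \<inter> space P | A. A \<in> sets borel})"
  unfolding history_def by (rule sets_measure_of) auto

lemma sets_history_mono: "sets (history P Z Zh k) \<subseteq> sets (history P Z Zh (Suc k))"
  unfolding sets_history by (rule sigma_sets_mono') (intro UN_mono; auto)

lemma adapted_history:
  fixes Z Zh :: "nat \<Rightarrow> 'w \<Rightarrow> 'a::topological_space"
  assumes "l \<le> k"
  shows "Z l \<in> borel_measurable (history P Z Zh k)" "Zh l \<in> borel_measurable (history P Z Zh k)"
proof -
  show "Z l \<in> borel_measurable (history P Z Zh k)"
  proof (rule measurableI)
    fix A :: "'a set" assume "A \<in> sets borel"
    then have "Z l -` A \<inter> space P \<in> sets (history P Z Zh k)"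
      unfolding sets_history using assms by (intro sigma_sets.Basic) auto
    then show "Z l -` A \<inter> space (history P Z Zh k) \<in> sets (history P Z Zh k)" by simp
  qed simp
  show "Zh l \<in> borel_measurable (history P Z Zh k)"
  proof (rule measurableI)
    fix A :: "'a set" assume "A \<in> sets borel"
    then have "Zh l -` A \<inter> space P \<in> sets (history P Z Zh k)"
      unfolding sets_history using assms by (intro sigma_sets.Basic) auto
    then show "Zh l -` A \<inter> space (history P Z Zh k) \<in> sets (history P Z Zh k)" by simp
  qed simp
qed

lemma subalgebra_history:
  assumes "\<And>l. Z l \<in> borel_measurable P" "\<And>l. Zh l \<in> borel_measurable P"
  shows "subalgebra P (history P Z Zh k)"
proof -
  have "sets (history P Z Zh k) \<subseteq> sets P"
    unfolding sets_history
    by (rule sets.sigma_sets_subset) (use assms in \<open>auto intro: measurable_sets\<close>)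
  then show ?thesis by (simp add: subalgebra_def)
qed

text \<open>The defining property of the conditional expectation, tested against a function \<open>f\<close>
  that is measurable for the history.\<close>

lemma cond_independence_integral:
  assumes "prob_space P" and sub: "subalgebra P (history P Z Zh k)"
    and ag: "ag k \<in> measurable P (count_space UNIV)"
    and ci: "cond_independence P Z Zh ag q"
    and f: "f \<in> borel_measurable (history P Z Zh k)" "integrable P f"
  shows "(\<integral>\<omega>. of_bool (ag k \<omega> = i) * f \<omega> \<partial>P) = q i * (\<integral>\<omega>. f \<omega> \<partial>P)"
proof -
  interpret prob_space P by fact
  interpret finite_measure_subalgebra P "history P Z Zh k"
    by unfold_locales (rule sub)
  let ?I = "{\<omega> \<in> space P. ag k \<omega> = i}"
  have I: "?I \<in> sets P" using ag by measurable
  have fP: "f \<in> borel_measurable P" by (rule measurable_from_subalg[OF sub f(1)])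
  have int: "integrable P (\<lambda>\<omega>. f \<omega> * indicator ?I \<omega>)"
    using integrable_mult_indicator[OF I f(2)] by (simp add: mult.commute)
  have "(\<integral>\<omega>. of_bool (ag k \<omega> = i) * f \<omega> \<partial>P) = (\<integral>\<omega>. f \<omega> * indicator ?I \<omega> \<partial>P)"
    by (rule Bochner_Integration.integral_cong) (auto simp: indicator_def)
  also have "\<dots> = (\<integral>\<omega>. f \<omega> * real_cond_exp P (history P Z Zh k) (indicator ?I) \<omega> \<partial>P)"
    by (rule real_cond_exp_intg(2)[symmetric, OF int f(1)]) (use I in simp)
  also have "\<dots> = (\<integral>\<omega>. q i * f \<omega> \<partial>P)"
  proof (rule integral_cong_AE)
    show "AE \<omega> in P. f \<omega> * real_cond_exp P (history P Z Zh k) (indicator ?I) \<omega> = q i * f \<omega>"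
    proof -
      have "AE \<omega> in P. real_cond_exp P (history P Z Zh k) (indicator ?I) \<omega> = q i"
        using ci unfolding cond_independence_def by blast
      then show ?thesis by eventually_elim simp
    qed
  qed (use fP in auto)
  also have "\<dots> = q i * (\<integral>\<omega>. f \<omega> \<partial>P)" by simp
  finally show ?thesis .
qed

section \<open>Convergence of the asynchronous algorithm\<close>

theorem theorem4:
  fixes E :: "('n::{finite,linorder} \<times> 'n) set"
    and lab :: "'k::finite \<Rightarrow> 'n row_label"
    and W :: "real ^ ('n::{finite,linorder}) ^ ('n::{finite,linorder})"
    and s :: "'n \<Rightarrow> real ^ 'p \<Rightarrow> real"
    and gs :: "'n \<Rightarrow> real ^ 'p \<Rightarrow> real ^ 'p"
    and r :: "'n \<Rightarrow> real ^ 'p \<Rightarrow> ereal"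
    and Lc :: "'n \<Rightarrow> real"
    and \<alpha> L \<kappa> \<eta> \<eta>max qmin :: real
    and q :: "'n \<Rightarrow> real"
    and \<tau> :: nat
    and T :: "real ^ 'p ^ 'k \<Rightarrow> real ^ 'p ^ 'k"
    and P :: "'w measure"
    and ag :: "nat \<Rightarrow> 'w \<Rightarrow> 'n"
    and \<tau>d :: "nat \<Rightarrow> 'n \<Rightarrow> 'w \<Rightarrow> nat"
    and \<delta>d :: "nat \<Rightarrow> 'n \<times> 'n \<Rightarrow> 'w \<Rightarrow> nat"
    and Z0 :: "real ^ 'p ^ 'k"
    and Z Zh :: "nat \<Rightarrow> 'w \<Rightarrow> real ^ 'p ^ 'k"
  assumes network: "connected_network E" "mixing_matrix E W" "row_labelling E lab"
    and s_cpc: "\<And>i. closed_proper_convex (\<lambda>x. ereal (s i x))"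
    and r_cpc: "\<And>i. closed_proper_convex (r i)"
    and s_grad: "\<And>i x. GDERIV (s i) x :> gs i x"
    and s_lipschitz: "\<And>i x y. norm (gs i x - gs i y) \<le> Lc i * norm (x - y)" "\<And>i. Lc i > 0"
    and L_eq: "L = Max (range Lc)"
    and step: "0 < \<alpha>" "\<alpha> < 2 * lambda_min (Gmat E lab W) / L"
    and kappa_eq: "\<kappa> = cond_number (Mmat E lab W \<alpha>)"
    and T_eq: "T = opT E lab W gs r \<alpha>"
    and Fix_nonempty: "Fix T \<noteq> {}"
    and prob: "prob_space P"
    and delays_measurable:
      "\<And>k j. \<tau>d k j \<in> measurable P (count_space UNIV)"
      "\<And>k e. e \<in> E \<Longrightarrow> \<delta>d k e \<in> measurable P (count_space UNIV)"
    and bounded_delay: "\<tau> > 0"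
      "\<And>k j \<omega>. \<omega> \<in> space P \<Longrightarrow> \<tau>d k j \<omega> \<le> \<tau>"
      "\<And>k e \<omega>. \<omega> \<in> space P \<Longrightarrow> e \<in> E \<Longrightarrow> \<delta>d k e \<omega> \<le> \<tau>"
    and Z_init: "\<And>\<omega>. \<omega> \<in> space P \<Longrightarrow> Z 0 \<omega> = Z0"
    and Zh_eq: "Zh = delayed lab \<tau>d \<delta>d Z"
    and Z_step: "\<And>k \<omega>. \<omega> \<in> space P \<Longrightarrow>
      Z (Suc k) \<omega> = Z k \<omega> -
        (\<eta> / (real CARD('n) * q (ag k \<omega>))) *\<^sub>R opS E lab T (ag k \<omega>) (Zh k \<omega>)"
    and activation: "activation P ag q"
    and cond_indep: "cond_independence P Z Zh ag q"
    and qmin_eq: "qmin = Min (range q)"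
    and eta_max: "0 < \<eta>max"
      "\<eta>max < real CARD('n) * qmin / (2 * real \<tau> * sqrt (\<kappa> * qmin) + \<kappa>)"
    and eta: "0 < \<eta>" "\<eta> \<le> \<eta>max"
  shows "\<exists>Zlim \<in> borel_measurable P.
           (\<forall>\<omega> \<in> space P. Zlim \<omega> \<in> Fix T) \<and>
           (AE \<omega> in P. (\<lambda>k. Z k \<omega>) \<longlonglongrightarrow> Zlim \<omega>)"
proof -
  interpret prob_space P by (rule prob)
  define M where "M = Mmat E lab W \<alpha>"
  define S where "S = (\<lambda>Z. Z - T Z)"
  define \<beta> where "\<beta> = \<eta> / real CARD('n)"
  define lo up where "lo = lambda_min M" and "up = lambda_max M"
  have Lc_le: "Lc i \<le> L" for i unfolding L_eq by simp
  have L: "0 < L" using s_lipschitz(2) Lc_le by (meson less_le_trans)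
  have "0 < 2 * lambda_min (Gmat E lab W) / L" using step by simp
  then have G_pos: "0 < lambda_min (Gmat E lab W)" using L by (simp add: zero_less_divide_iff)
  interpret equivalent_inner "\<lambda>X Y :: real^'p^'k. (M ** X) \<bullet> Y" lo up
    unfolding M_def lo_def up_def
    by (rule matrix_form_equivalent_inner[OF transpose_Mmat lambda_min_Mmat_pos[OF step(1) G_pos]])
  have coc: "(M ** (S x - S y)) \<bullet> (S x - S y) / 2 \<le> (M ** (S x - S y)) \<bullet> (x - y)" for x y
    unfolding M_def S_def T_eq
    by (rule opT_residual_cocoercive[OF network(3) s_cpc s_grad s_lipschitz Lc_le r_cpc step])
  have S_cont: "continuous_on UNIV S" by (rule cocoercive_continuous[OF coc])
  have opS_cont: "continuous_on UNIV (opS E lab T i)" for i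
    by (rule opS_continuous) (use S_cont in \<open>simp add: S_def\<close>)
  have ag_meas: "ag k \<in> measurable P (count_space UNIV)" for k
    using activation by (simp add: activation_def)
  have q_pos: "0 < q i" for i using activation by (simp add: activation_def)
  have qmin_pos: "0 < qmin" unfolding qmin_eq using q_pos by (subst Min_gr_iff) auto
  have qmin_le: "qmin \<le> q i" for i unfolding qmin_eq by simp
  have row_delay_meas: "row_delay lab \<tau>d \<delta>d k a \<in> measurable P (count_space UNIV)" for k a
    using delays_measurable lab_Edge[OF network(3), of a]
    unfolding row_delay_def[abs_def] by (cases "lab a") auto
  have row_delay_le: "row_delay lab \<tau>d \<delta>d k a \<omega> \<le> \<tau>" if "\<omega> \<in> space P" for k a \<omega>
    using bounded_delay that lab_Edge[OF network(3), of a] by (cases "lab a") (auto simp: row_delay_def)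
  have Z_meas: "Z k \<in> borel_measurable P" for k
  proof (induction k rule: less_induct)
    case (less k)
    show ?case
    proof (cases k)
      case 0
      have "(\<lambda>\<omega>. Z0) \<in> borel_measurable P" by simp
      then show ?thesis unfolding 0 by (subst measurable_cong[OF Z_init])
    next
      case (Suc m)
      have Zh: "Zh m \<in> borel_measurable P"
        unfolding Zh_eq by (rule delayed_measurable[OF _ row_delay_meas]) (use less Suc in auto)
      have "(\<lambda>\<omega>. Z m \<omega> - (\<eta> / (real CARD('n) * q (ag m \<omega>))) *\<^sub>R opS E lab T (ag m \<omega>) (Zh m \<omega>))
          \<in> borel_measurable P"
      proof (rule measurable_compose_countable'[where I=UNIV and g="ag m" and
            f="\<lambda>i \<omega>. Z m \<omega> - (\<eta> / (real CARD('n) * q i)) *\<^sub>R opS E lab T i (Zh m \<omega>)"])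
        fix i
        show "(\<lambda>\<omega>. Z m \<omega> - (\<eta> / (real CARD('n) * q i)) *\<^sub>R opS E lab T i (Zh m \<omega>)) \<in> borel_measurable P"
          using less[of m] Suc
          by (intro borel_measurable_diff borel_measurable_scaleR borel_measurable_const
              borel_measurable_continuous_on[OF opS_cont Zh]) auto
      qed (auto simp: ag_meas countable_finite)
      then show ?thesis unfolding Suc by (subst measurable_cong[OF Z_step])
    qed
  qed
  have Zh_meas: "Zh k \<in> borel_measurable P" for k
    unfolding Zh_eq by (rule delayed_measurable[OF Z_meas row_delay_meas])
  note sub = subalgebra_history[OF Z_meas Zh_meas]
  note indep = cond_independence_integral[OF prob sub ag_meas cond_indep]
  have q_sum: "(\<Sum>i\<in>UNIV. q i) = 1"
  proof -
    have "(\<integral>\<omega>. of_bool (ag 0 \<omega> = i) \<partial>P) = q i" for i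
    proof -
      have "(\<integral>\<omega>. of_bool (ag 0 \<omega> = i) * 1 \<partial>P) = q i * (\<integral>\<omega>. 1 \<partial>P)"
        by (rule indep) auto
      moreover have "(\<integral>\<omega>. (1 :: real) \<partial>P) = 1" by (simp add: prob_space)
      ultimately show ?thesis by (simp only: mult_1_right)
    qed
    moreover have "integrable P (\<lambda>\<omega>. of_bool (ag 0 \<omega> = i) :: real)" for i
      using ag_meas[of 0] by (intro integrable_const_bound[of _ 1]) auto
    ultimately have "(\<Sum>i\<in>UNIV. q i) = (\<integral>\<omega>. (\<Sum>i\<in>UNIV. of_bool (ag 0 \<omega> = i)) \<partial>P)"
      by (simp only: Bochner_Integration.integral_sum)
    also have "\<dots> = (\<integral>\<omega>. (1 :: real) \<partial>P)"
      by (rule Bochner_Integration.integral_cong) (simp_all add: of_bool_def)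
    finally show ?thesis by (simp add: prob_space)
  qed
  have \<beta>_less: "\<beta> * (2 * real \<tau> * sqrt (up / lo * qmin) + up / lo) < qmin"
  proof -
    have \<kappa>: "\<kappa> = up / lo" by (simp add: kappa_eq cond_number_def up_def lo_def M_def)
    have "0 < 2 * real \<tau> * sqrt (\<kappa> * qmin) + \<kappa>"
      using up_pos lo_pos qmin_pos by (intro add_nonneg_pos) (auto simp: \<kappa>)
    then have "\<eta>max * (2 * real \<tau> * sqrt (\<kappa> * qmin) + \<kappa>) < real CARD('n) * qmin"
      using eta_max(2) by (simp add: pos_less_divide_eq)
    moreover have "\<eta> * (2 * real \<tau> * sqrt (\<kappa> * qmin) + \<kappa>) \<le> \<eta>max * (2 * real \<tau> * sqrt (\<kappa> * qmin) + \<kappa>)"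
      using eta \<open>0 < 2 * real \<tau> * sqrt (\<kappa> * qmin) + \<kappa>\<close> by (intro mult_right_mono) auto
    ultimately have "\<eta> * (2 * real \<tau> * sqrt (\<kappa> * qmin) + \<kappa>) < real CARD('n) * qmin" by linarith
    then have "\<eta> * (2 * real \<tau> * sqrt (\<kappa> * qmin) + \<kappa>) / real CARD('n) < qmin"
      by (simp add: pos_divide_less_eq mult.commute)
    then show ?thesis unfolding \<kappa> \<beta>_def by simp
  qed
  \<comment> \<open>The locale's step size \<open>\<beta>\<close> is \<open>\<eta> / n\<close>, and the
    condition number \<open>\<kappa>\<close> is \<open>up / lo\<close>.\<close>
  interpret async_iteration "\<lambda>X Y :: real^'p^'k. (M ** X) \<bullet> Y" lo up P S "opS E lab T" q qmin \<beta> \<tau>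
    "history P Z Zh" ag Z Zh
  proof
    show "(M ** (S x - S y)) \<bullet> (S x - S y) / 2 \<le> (M ** (S x - S y)) \<bullet> (x - y)" for x y by (rule coc)
    show "continuous_on UNIV (opS E lab T i)" for i by (rule opS_cont)
    show "(\<Sum>i\<in>UNIV. opS E lab T i x) = S x" for x
      unfolding S_def by (rule opS_sum[OF network(3)])
    show "(\<Sum>i\<in>UNIV. opS E lab T i x \<bullet> opS E lab T i x) = S x \<bullet> S x" for x
      unfolding S_def by (rule opS_norm_sum[OF network(3)])
    show "0 < qmin" "qmin \<le> q i" "(\<Sum>i\<in>UNIV. q i) = 1" for i by (fact qmin_pos qmin_le q_sum)+
    show "0 < \<beta>" using eta by (simp add: \<beta>_def)
    show "\<beta> * (2 * real \<tau> * sqrt (up / lo * qmin) + up / lo) < qmin" by (rule \<beta>_less)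
    show "subalgebra P (history P Z Zh k)" for k by (rule sub)
    show "sets (history P Z Zh k) \<subseteq> sets (history P Z Zh (Suc k))" for k by (rule sets_history_mono)
    show "Z l \<in> borel_measurable (history P Z Zh k)" if "l \<le> k" for l k by (rule adapted_history[OF that])
    show "Zh k \<in> borel_measurable (history P Z Zh k)" for k by (rule adapted_history(2)[OF order_refl])
    show "ag k \<in> measurable P (count_space UNIV)" for k by (rule ag_meas)
    show "(\<integral>\<omega>. of_bool (ag k \<omega> = i) * f \<omega> \<partial>P) = q i * (\<integral>\<omega>. f \<omega> \<partial>P)"
      if "f \<in> borel_measurable (history P Z Zh k)" "integrable P f" for f k i
      by (rule indep[OF that])
    show "bounded_rv P (Z 0)" using Z_init by (auto intro!: bounded_rvI[of _ _ "norm Z0"])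
    show "Z (Suc k) \<omega> = Z k \<omega> - (\<beta> / q (ag k \<omega>)) *\<^sub>R opS E lab T (ag k \<omega>) (Zh k \<omega>)"
      if "\<omega> \<in> space P" for k \<omega>
      using Z_step[OF that, of k] by (simp add: \<beta>_def)
    show "\<exists>D. Zh k \<omega> = Z k \<omega> - (\<Sum>d\<in>{k - \<tau>..<k}. D d) \<and> (\<forall>d. norm (D d) \<le> norm (Z (Suc d) \<omega> - Z d \<omega>))"
      if "\<omega> \<in> space P" for k \<omega>
      unfolding Zh_eq by (rule delayed_as_masked_increments) (rule row_delay_le[OF that])
  qed
  have Fix_iff: "x \<in> Fix T \<longleftrightarrow> S x = 0" for x by (auto simp: Fix_def S_def)
  then have "\<exists>x. S x = 0" using Fix_nonempty by blast
  from converges_to_random_zero[OF this] show ?thesis by (simp add: Fix_iff)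
qed

end
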